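(* Assume that, for some $c>0$ and $\eta>0$, $$|I_{m,n}^{\mathbf a,\mathbf b}|\ge c\,(m+n)^{-1/10+\eta}\qquad\text{for all } m,n\in\mathbb Z_{>0}.$$ Let $\epsilon>0$. Then, $\mathbf P$-almost surely, there exists a random $L\in\mathbb Z_{>0}$ such that $$|\mathrm G^{\mathbf a,\mathbf b}(m,n)-\mathcal M^{\mathbf a,\mathbf b}(m,n)|\le\epsilon(m+n)\qquad\text{for all } m,n\in\mathbb Z_{>0}\text{ with } m+n\ge L.$$
   Context: $[n]=\{1,\dots,n\}$; $\mathrm{Exp}(\lambda)$ is the exponential distribution with rate $\lambda$ (mean $1/\lambda$). Fix two collections of real parameters $\mathbf a=\{\mathbf a_m(i):m\in\mathbb Z_{>0},i\in[m]\}$ and $\mathbf b=\{\mathbf b_n(j):n\in\mathbb Z_{>0},j\in[n]\}$ such that $\mathbf a_m(i)+\mathbf b_n(j)>0$ for all $m,n\in\mathbb Z_{>0}$, $i\in[m]$, $j\in[n]$. Write $\min\mathbf a_m=\min_{i\in[m]}\mathbf a_m(i)$ and $\min\mathbf b_n=\min_{j\in[n]}\mathbf b_n(j)$. Let $(\Omega,\mathbf P)$ be $\Omega=\mathbb R^{\mathbb Z_{>0}^2}$ with the product measure under which the coordinates are i.i.d. $\mathrm{Exp}(1)$. For each $m,n\in\mathbb Z_{>0}$ let $\{\omega_{m,n}^{\mathbf a,\mathbf b}(i,j): i\in[m],j\in[n]\}$ be independent random variables on $(\Omega,\mathbf P)$ with $\omega_{m,n}^{\mathbf a,\mathbf b}(i,j)\sim\mathrm{Exp}(\mathbf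 a_m(i)+\mathbf b_n(j))$; no assumption is made about the joint distribution of these collections for different $(m,n)$. The last-passage time is $$\mathrm G^{\mathbf a,\mathbf b}(m,n)=\max_{\pi}\sum_{(i,j)\in\pi}\omega^{\mathbf a,\mathbf b}_{m,n}(i,j),$$ the maximum over all up-right lattice paths $\pi$ from $(1,1)$ to $(m,n)$ (steps $(1,0)$ or $(0,1)$). For $m,n\in\mathbb Z_{>0}$ let $I_{m,n}^{\mathbf a,\mathbf b}=(-\min\mathbf a_m,\min\mathbf b_n)$, an interval of length $|I_{m,n}^{\mathbf a,\mathbf b}|=\min\mathbf a_m+\min\mathbf b_n>0$, and $$\mathcal M^{\mathbf a,\mathbf b}(m,n)=\inf_{z\in I_{m,n}^{\mathbf a,\mathbf b}}\Big\{\sum_{i=1}^m\frac1{\mathbf a_m(i)+z}+\sum_{j=1}^n\frac1{\mathbf b_n(j)-z}\Big\}.$$ *)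

theory Defs
  imports "HOL-Probability.Probability"
begin

(* Index sets start at 1, as in the mathematics: a m i is only meaningful for m >= 1 and
   i in {1..m}, and points of the lattice are pairs in {1..} x {1..}. *)

definition lpp_space :: "(nat \<times> nat \<Rightarrow> real) measure" where
  "lpp_space = (\<Pi>\<^sub>M p\<in>{1..} \<times> {1..}. density lborel (exponential_density 1))"

definition min_param :: "(nat \<Rightarrow> nat \<Rightarrow> real) \<Rightarrow> nat \<Rightarrow> real" where
  "min_param a m = Min (a m ` {1..m})"

definition param_interval ::
  "(nat \<Rightarrow> nat \<Rightarrow> real) \<Rightarrow> (nat \<Rightarrow> nat \<Rightarrow> real) \<Rightarrow> nat \<Rightarrow> nat \<Rightarrow> real set" where
  "param_interval a b m n = {- min_param a m <..< min_param b n}"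

definition shape_centering ::
  "(nat \<Rightarrow> nat \<Rightarrow> real) \<Rightarrow> (nat \<Rightarrow> nat \<Rightarrow> real) \<Rightarrow> nat \<Rightarrow> nat \<Rightarrow> real" where
  "shape_centering a b m n =
     (INF z\<in>param_interval a b m n.
        (\<Sum>i=1..m. 1 / (a m i + z)) + (\<Sum>j=1..n. 1 / (b n j - z)))"

definition up_right_step :: "nat \<times> nat \<Rightarrow> nat \<times> nat \<Rightarrow> bool" where
  "up_right_step p q \<longleftrightarrow> q = (fst p + 1, snd p) \<or> q = (fst p, snd p + 1)"

definition up_right_paths :: "nat \<Rightarrow> nat \<Rightarrow> (nat \<times> nat) list set" where
  "up_right_paths m n =
     {\<pi>. \<pi> \<noteq> [] \<and> hd \<pi> = (1, 1) \<and> last \<pi> = (m, n) \<and> successively up_right_step \<pi>}"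

definition last_passage_time :: "(nat \<times> nat \<Rightarrow> real) \<Rightarrow> nat \<Rightarrow> nat \<Rightarrow> real" where
  "last_passage_time w m n = Max ((\<lambda>\<pi>. \<Sum>p\<leftarrow>\<pi>. w p) ` up_right_paths m n)"

(* The maximum in last_passage_time is over a finite nonempty set. *)

lemma up_right_path_bounds:
  assumes "successively up_right_step \<pi>" "\<pi> \<noteq> []"
  shows "fst (last \<pi>) + snd (last \<pi>) + 1 = fst (hd \<pi>) + snd (hd \<pi>) + length \<pi> \<and>
         (\<forall>p\<in>set \<pi>. fst p \<le> fst (last \<pi>) \<and> snd p \<le> snd (last \<pi>))"
  using assms
proof (induction \<pi>)
  case (Cons p \<pi>)
  show ?case
  proof (cases \<pi>)
    case (Cons q \<pi>')
    with Cons.prems have "up_right_step p q" "successively up_right_step \<pi>" by auto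
    with Cons.IH Cons show ?thesis by (auto simp: up_right_step_def)
  qed simp
qed simp

lemma finite_up_right_paths: "finite (up_right_paths m n)"
proof (rule finite_subset)
  show "up_right_paths m n \<subseteq> {\<pi>. set \<pi> \<subseteq> {..m} \<times> {..n} \<and> length \<pi> \<le> m + n}"
    using up_right_path_bounds by (fastforce simp: up_right_paths_def)
  show "finite {\<pi>. set \<pi> \<subseteq> {..m} \<times> {..n} \<and> length \<pi> \<le> m + n}"
    by (rule finite_lists_length_le) auto
qed

lemma up_right_paths_nonempty:
  assumes "m \<ge> 1" "n \<ge> 1"
  shows "up_right_paths m n \<noteq> {}"
proof -
  have snoc: "\<pi> @ [q] \<in> up_right_paths (fst q) (snd q)"
    if "\<pi> \<in> up_right_paths k l" "up_right_step (k, l) q" for \<pi> k l q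
    using that by (auto simp: up_right_paths_def successively_append_iff)
  have row: "up_right_paths m 1 \<noteq> {}"
    using assms(1)
  proof (induction m rule: dec_induct)
    case base
    have "[(1, 1)] \<in> up_right_paths 1 1" by (simp add: up_right_paths_def)
    then show ?case by blast
  next
    case (step k)
    then show ?case using snoc[of _ k 1 "(Suc k, 1)"] by (auto simp: up_right_step_def)
  qed
  show ?thesis
    using assms(2)
  proof (induction n rule: dec_induct)
    case base
    show ?case by (rule row)
  next
    case (step l)
    then show ?case using snoc[of _ m l "(m, Suc l)"] by (auto simp: up_right_step_def)
  qed
qed

end

theory Submission
  imports Defs "HOL-Real_Asymp.Real_Asymp"
begin

text \<open>
  Write \<open>N = m + n\<close>, let \<open>A\<^sub>k(z)\<close> and \<open>B\<^sub>l(z)\<close> be the partial sums of \<open>1 / (a\<^sub>i + z)\<close> and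
  \<open>1 / (b\<^sub>j - z)\<close>, and put \<open>f(z) = A\<^sub>m(z) + B\<^sub>n(z)\<close>, so that the centering is the infimum of \<open>f\<close>.

  The idea is to compare with a stationary model.  Add a row 0 with weights of rates \<open>a\<^sub>i + z\<close> and
  a column 0 with weights of rates \<open>b\<^sub>j - z\<close>.  By Burke's property the increments of the enlarged
  last-passage time up the column \<open>m\<close> are again independent exponentials of rates \<open>b\<^sub>j - z\<close>
  (lemmas \<open>site_map_preserves\<close> and \<open>burke_columns_increments\<close>).  Hence the enlarged time at the
  corner is a sum over row 0 plus a sum of independent increments.  Its mean is \<open>f(z)\<close>, and
  Chernoff's bound applies to each of the two sums (\<open>stationary_corner_concentration\<close>).

  Upper bound: a path from \<open>(k, 1)\<close> to the corner, preceded by \<open>k\<close> steps in row 0, is a competitor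
  in the enlarged model, so its weight is at most about \<open>f(w) - A\<^sub>k(w)\<close>, for every \<open>w\<close>
  (\<open>path_upper_bound\<close>).  For \<open>k = 1\<close> and \<open>w\<close> the minimiser \<open>\<zeta>\<close> of \<open>f\<close> this is the upper half of
  the theorem.

  Lower bound: the optimal enlarged path has weight about \<open>f(z)\<close> and leaves the boundary at some
  \<open>(k, 1)\<close> or \<open>(1, l)\<close>.  Leaving row 0 at \<open>k\<close> is harmless if \<open>A\<^sub>k(z)\<close> is small compared with \<open>N\<close>,
  because then little is lost by deleting the boundary part.  Otherwise, by the upper bound at a
  parameter \<open>w < z\<close>, such a path has weight at most about \<open>f(w) - (A\<^sub>k(w) - A\<^sub>k(z))\<close>.
  If \<open>z = \<zeta>\<close> then \<open>f(w) - f(z)\<close> is of second order in \<open>z - w\<close>, and \<open>A\<^sub>k(w) - A\<^sub>k(z)\<close> is of first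
  order, so the path is not optimal.  The same works for column 0 with \<open>w > z\<close>.

  This needs room on both sides of \<open>\<zeta>\<close> (\<open>path_lower_bound_interior\<close>).  If \<open>\<zeta>\<close> is very close to
  the end \<open>min b\<close> of the interval, then the row with the smallest \<open>b\<^sub>j\<close> has almost the same weights
  as row 0, and the best path may follow it over a long distance.  In that case (\<open>path_lower_bound_edge\<close>)
  the path is built in two pieces, one on each side of a well chosen site of this row.  In each
  piece the row lies at the edge of the rectangle, so that time spent on row 0 can be imitated
  inside the rectangle, and only exits from column 0 must be excluded, with \<open>z\<close> slightly to the
  left of \<open>min b\<close>.  The other end of the interval follows by exchanging rows and columns.

  If the interval has length at least \<open>\<kappa>\<close>, the sums of \<open>1 / (a\<^sub>i + \<zeta>)\<^sup>2\<close> and \<open>1 / (b\<^sub>j - \<zeta>)\<^sup>2\<close> are at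
  most \<open>4 N / \<kappa>\<^sup>2\<close>, so fluctuations have size \<open>\<tau>\<close> of order \<open>sqrt N / \<kappa>\<close>.  The distance \<open>\<rho>\<close> below
  which \<open>\<zeta>\<close> counts as close to an end is of order \<open>\<kappa>\<^sup>2\<close>, the shift \<open>h = \<bar>z - w\<bar>\<close> is of order
  \<open>\<rho> \<kappa>\<^sup>2\<close>, and the margin by which bad exits are excluded is of order \<open>h N\<close>.  The ratio of margin
  and fluctuation is of order \<open>\<kappa>\<close> to the power 5 times \<open>sqrt N\<close>.  With \<open>\<kappa>\<close> of order
  \<open>N powr (- 1 / 10 + \<eta>)\<close> it is a positive power of \<open>N\<close>, so the failure probabilities decay faster
  than any power of \<open>N\<close> and the Borel--Cantelli lemma applies.
\<close>

section \<open>Burke's property for exponential weights\<close>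

abbreviation (input) edens :: "real \<Rightarrow> real \<Rightarrow> ennreal" where
  "edens l x \<equiv> ennreal (exponential_density l x)"

abbreviation (input) exp_dist :: "real \<Rightarrow> real measure" where
  "exp_dist l \<equiv> density lborel (\<lambda>x. ennreal (exponential_density l x))"

text \<open>
  For nonnegative \<open>v\<close> and \<open>w\<close> both sides depend only on \<open>d\<close> and \<open>v + w\<close>.  This
  exchangeability of the minimum of two exponential variables with a fresh exponential variable of
  the total rate is the whole content of Burke's property below.
\<close>
lemma edens_swap:
  assumes "0 < p" "0 < q" "0 \<le> d"
  shows "edens p (v + d) * edens q v * edens (p + q) w
       = edens p (w + d) * edens q w * edens (p + q) v"
proof (cases "v < 0 \<or> w < 0")
  case True
  then show ?thesis by (auto simp: exponential_density_def)
next
  case False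
  with assms show ?thesis
    by (auto simp: exponential_density_def ennreal_mult[symmetric] algebra_simps simp flip: exp_add)
qed

text \<open>
  In the coordinates \<open>d = h - v\<close>, \<open>v\<close> and \<open>w\<close> the map merely exchanges \<open>v\<close> and \<open>w\<close>, so the claim is
  Fubini's theorem together with the symmetry of the density.  The set \<open>R\<close> of allowed differences
  is a parameter in order that the diagonal can later be counted exactly once.
\<close>
lemma burke_half:
  fixes g :: "real \<times> real \<times> real \<Rightarrow> ennreal"
  assumes pq: "0 < p" "0 < q" and R: "R \<subseteq> {0..}" and [measurable]: "R \<in> sets borel" "g \<in> borel_measurable borel"
  shows "(\<integral>\<^sup>+h. \<integral>\<^sup>+v. \<integral>\<^sup>+w. edens p h * edens q v * edens (p + q) w * indicator R (h - v) * g (w + (h - v), w, v) \<partial>lborel \<partial>lborel \<partial>lborel)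
       = (\<integral>\<^sup>+h. \<integral>\<^sup>+v. \<integral>\<^sup>+w. edens p h * edens q v * edens (p + q) w * indicator R (h - v) * g (h, v, w) \<partial>lborel \<partial>lborel \<partial>lborel)"
proof -
  have [measurable]: "g \<in> borel_measurable (borel \<Otimes>\<^sub>M borel \<Otimes>\<^sub>M borel)"
    by (simp add: borel_prod)
  have shift: "(\<integral>\<^sup>+h. f (h::real) \<partial>lborel) = (\<integral>\<^sup>+d. f (v + d) \<partial>lborel)"
    if [measurable]: "f \<in> borel_measurable borel" for f :: "real \<Rightarrow> ennreal" and v
    using nn_integral_real_affine[of f 1 v] by simp
  have split: "(\<integral>\<^sup>+h. \<integral>\<^sup>+v. F h v \<partial>lborel \<partial>lborel) = (\<integral>\<^sup>+d. \<integral>\<^sup>+v. F (v + d) v \<partial>lborel \<partial>lborel)"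
    if [measurable]: "case_prod F \<in> borel_measurable (borel \<Otimes>\<^sub>M borel)" for F :: "real \<Rightarrow> real \<Rightarrow> ennreal"
  proof -
    have "(\<integral>\<^sup>+h. \<integral>\<^sup>+v. F h v \<partial>lborel \<partial>lborel) = (\<integral>\<^sup>+v. \<integral>\<^sup>+h. F h v \<partial>lborel \<partial>lborel)"
      by (rule lborel_pair.Fubini'[symmetric]) simp
    also have "\<dots> = (\<integral>\<^sup>+v. \<integral>\<^sup>+d. F (v + d) v \<partial>lborel \<partial>lborel)"
      by (intro nn_integral_cong shift) simp
    also have "\<dots> = (\<integral>\<^sup>+d. \<integral>\<^sup>+v. F (v + d) v \<partial>lborel \<partial>lborel)"
      by (rule lborel_pair.Fubini') simp
    finally show ?thesis .
  qed
  have "(\<integral>\<^sup>+h. \<integral>\<^sup>+v. \<integral>\<^sup>+w. edens p h * edens q v * edens (p + q) w * indicator R (h - v) * g (w + (h - v), w, v) \<partial>lborel \<partial>lborel \<partial>lborel)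
     = (\<integral>\<^sup>+d. \<integral>\<^sup>+v. \<integral>\<^sup>+w. edens p (v + d) * edens q v * edens (p + q) w * indicator R d * g (w + d, w, v) \<partial>lborel \<partial>lborel \<partial>lborel)"
    by (subst split) auto
  also have "\<dots> = (\<integral>\<^sup>+d. \<integral>\<^sup>+v. \<integral>\<^sup>+w. edens p (w + d) * edens q w * edens (p + q) v * indicator R d * g (w + d, w, v) \<partial>lborel \<partial>lborel \<partial>lborel)"
  proof (intro nn_integral_cong)
    fix d v w :: real
    show "edens p (v + d) * edens q v * edens (p + q) w * indicator R d * g (w + d, w, v)
       = edens p (w + d) * edens q w * edens (p + q) v * indicator R d * g (w + d, w, v)"
    proof (cases "d \<in> R")
      case True
      with R have "0 \<le> d" by auto
      then show ?thesis using edens_swap[OF pq] by simp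
    qed simp
  qed
  also have "\<dots> = (\<integral>\<^sup>+d. \<integral>\<^sup>+w. \<integral>\<^sup>+v. edens p (w + d) * edens q w * edens (p + q) v * indicator R d * g (w + d, w, v) \<partial>lborel \<partial>lborel \<partial>lborel)"
    by (intro nn_integral_cong lborel_pair.Fubini') simp
  also have "\<dots> = (\<integral>\<^sup>+h. \<integral>\<^sup>+v. \<integral>\<^sup>+w. edens p h * edens q v * edens (p + q) w * indicator R (h - v) * g (h, v, w) \<partial>lborel \<partial>lborel \<partial>lborel)"
    by (subst split) auto
  finally show ?thesis .
qed

text \<open>
  One step of the last-passage recursion in terms of increments: \<open>h\<close> and \<open>v\<close> are the increments
  along the lower and the left edge of a unit square, \<open>w\<close> is the weight of its upper right corner,
  and the first two components are the increments along the upper and the right edge.  The third component makes the map an involution, so that all three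
  coordinates keep their joint law.
\<close>
definition burke_step :: "real \<Rightarrow> real \<Rightarrow> real \<Rightarrow> real \<times> real \<times> real" where
  "burke_step h v w = (w + max 0 (h - v), w + max 0 (v - h), min h v)"

text \<open>
  The half spaces \<open>v \<le> h\<close> and \<open>h < v\<close> are each handled by \<open>burke_half\<close>, the second one
  after exchanging the roles of \<open>h\<close> and \<open>v\<close>.
\<close>
lemma burke_integral_lborel:
  fixes g :: "real \<times> real \<times> real \<Rightarrow> ennreal"
  assumes pq: "0 < p" "0 < q" and [measurable]: "g \<in> borel_measurable (borel \<Otimes>\<^sub>M borel \<Otimes>\<^sub>M borel)"
  shows "(\<integral>\<^sup>+h. \<integral>\<^sup>+v. \<integral>\<^sup>+w. edens p h * edens q v * edens (p + q) w * g (burke_step h v w) \<partial>lborel \<partial>lborel \<partial>lborel)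
       = (\<integral>\<^sup>+h. \<integral>\<^sup>+v. \<integral>\<^sup>+w. edens p h * edens q v * edens (p + q) w * g (h, v, w) \<partial>lborel \<partial>lborel \<partial>lborel)"
    (is "?I (\<lambda>h v w. g (burke_step h v w)) = ?I (\<lambda>h v w. g (h, v, w))")
proof -
  define g' where "g' = (\<lambda>(x, y, z). g (y, x, z))"
  have [measurable]: "g' \<in> borel_measurable (borel \<Otimes>\<^sub>M borel \<Otimes>\<^sub>M borel)"
    unfolding g'_def by measurable
  have gb: "g \<in> borel_measurable borel" "g' \<in> borel_measurable borel"
    using assms(3) \<open>g' \<in> _\<close> by (simp_all add: borel_prod)
  have part: "?I (\<lambda>h v w. F (h, v, w)) =
      (\<integral>\<^sup>+h. \<integral>\<^sup>+v. \<integral>\<^sup>+w. edens p h * edens q v * edens (p + q) w * indicator {0..} (h - v) * F (h, v, w) \<partial>lborel \<partial>lborel \<partial>lborel)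
    + (\<integral>\<^sup>+h. \<integral>\<^sup>+v. \<integral>\<^sup>+w. edens q h * edens p v * edens (q + p) w * indicator {0<..} (h - v) * F (v, h, w) \<partial>lborel \<partial>lborel \<partial>lborel)"
    (is "_ = ?A + ?B")
    if [measurable]: "F \<in> borel_measurable (borel \<Otimes>\<^sub>M borel \<Otimes>\<^sub>M borel)"
    for F :: "real \<times> real \<times> real \<Rightarrow> ennreal"
  proof -
    have "?B = (\<integral>\<^sup>+v. \<integral>\<^sup>+h. \<integral>\<^sup>+w. edens q h * edens p v * edens (q + p) w * indicator {0<..} (h - v) * F (v, h, w) \<partial>lborel \<partial>lborel \<partial>lborel)"
      by (rule lborel_pair.Fubini'[symmetric]) simp
    then have "?A + ?B = (\<integral>\<^sup>+h. \<integral>\<^sup>+v. \<integral>\<^sup>+w. edens p h * edens q v * edens (p + q) w * indicator {0..} (h - v) * F (h, v, w) \<partial>lborel \<partial>lborel \<partial>lborel)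
      + (\<integral>\<^sup>+h. \<integral>\<^sup>+v. \<integral>\<^sup>+w. edens q v * edens p h * edens (q + p) w * indicator {0<..} (v - h) * F (h, v, w) \<partial>lborel \<partial>lborel \<partial>lborel)"
      by simp
    also have "\<dots> = (\<integral>\<^sup>+h. \<integral>\<^sup>+v. \<integral>\<^sup>+w. edens p h * edens q v * edens (p + q) w * indicator {0..} (h - v) * F (h, v, w)
         + edens q v * edens p h * edens (q + p) w * indicator {0<..} (v - h) * F (h, v, w) \<partial>lborel \<partial>lborel \<partial>lborel)"
      by (simp add: nn_integral_add)
    also have "\<dots> = ?I (\<lambda>h v w. F (h, v, w))"
      by (intro nn_integral_cong) (auto simp: indicator_def ac_simps)
    finally show ?thesis by simp
  qed
  have m[measurable]: "(\<lambda>(h, v, w). g (burke_step h v w)) \<in> borel_measurable (borel \<Otimes>\<^sub>M borel \<Otimes>\<^sub>M borel)"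
    unfolding burke_step_def by measurable
  have "?I (\<lambda>h v w. g (burke_step h v w)) = 
      (\<integral>\<^sup>+h. \<integral>\<^sup>+v. \<integral>\<^sup>+w. edens p h * edens q v * edens (p + q) w * indicator {0..} (h - v) * g (w + (h - v), w, v) \<partial>lborel \<partial>lborel \<partial>lborel)
    + (\<integral>\<^sup>+h. \<integral>\<^sup>+v. \<integral>\<^sup>+w. edens q h * edens p v * edens (q + p) w * indicator {0<..} (h - v) * g' (w + (h - v), w, v) \<partial>lborel \<partial>lborel \<partial>lborel)"
    apply (subst part[OF m, unfolded prod.case])
    apply (intro arg_cong2[where f="(+)"] nn_integral_cong)
    subgoal for h v w by (cases "0 \<le> h - v") (auto simp: burke_step_def max_def min_def)
    subgoal for h v w by (cases "0 < h - v") (auto simp: burke_step_def g'_def max_def min_def)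
    done
  also have "\<dots> = (\<integral>\<^sup>+h. \<integral>\<^sup>+v. \<integral>\<^sup>+w. edens p h * edens q v * edens (p + q) w * indicator {0..} (h - v) * g (h, v, w) \<partial>lborel \<partial>lborel \<partial>lborel)
    + (\<integral>\<^sup>+h. \<integral>\<^sup>+v. \<integral>\<^sup>+w. edens q h * edens p v * edens (q + p) w * indicator {0<..} (h - v) * g' (h, v, w) \<partial>lborel \<partial>lborel \<partial>lborel)"
    by (intro arg_cong2[where f="(+)"] burke_half pq gb) auto
  also have "\<dots> = ?I (\<lambda>h v w. g (h, v, w))"
    by (subst part) (auto simp: g'_def)
  finally show ?thesis .
qed

lemma burke_integral:
  fixes g :: "real \<times> real \<times> real \<Rightarrow> ennreal"
  assumes pq: "0 < p" "0 < q" and [measurable]: "g \<in> borel_measurable (borel \<Otimes>\<^sub>M borel \<Otimes>\<^sub>M borel)"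
  shows "(\<integral>\<^sup>+h. \<integral>\<^sup>+v. \<integral>\<^sup>+w. g (burke_step h v w) \<partial>exp_dist (p + q) \<partial>exp_dist q \<partial>exp_dist p)
       = (\<integral>\<^sup>+h. \<integral>\<^sup>+v. \<integral>\<^sup>+w. g (h, v, w) \<partial>exp_dist (p + q) \<partial>exp_dist q \<partial>exp_dist p)"
proof -
  have conv: "(\<integral>\<^sup>+h. \<integral>\<^sup>+v. \<integral>\<^sup>+w. F (h, v, w) \<partial>exp_dist (p + q) \<partial>exp_dist q \<partial>exp_dist p) =
      (\<integral>\<^sup>+h. \<integral>\<^sup>+v. \<integral>\<^sup>+w. edens p h * edens q v * edens (p + q) w * F (h, v, w) \<partial>lborel \<partial>lborel \<partial>lborel)"
    if [measurable]: "F \<in> borel_measurable (borel \<Otimes>\<^sub>M borel \<Otimes>\<^sub>M borel)"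
    for F :: "real \<times> real \<times> real \<Rightarrow> ennreal"
  proof -
    have "(\<integral>\<^sup>+h. \<integral>\<^sup>+v. \<integral>\<^sup>+w. F (h, v, w) \<partial>exp_dist (p + q) \<partial>exp_dist q \<partial>exp_dist p)
      = (\<integral>\<^sup>+h. \<integral>\<^sup>+v. \<integral>\<^sup>+w. F (h, v, w) * edens (p + q) w \<partial>lborel \<partial>exp_dist q \<partial>exp_dist p)"
      by (simp add: nn_integral_density mult.commute)
    also have "\<dots> = (\<integral>\<^sup>+h. edens p h * (\<integral>\<^sup>+v. edens q v * (\<integral>\<^sup>+w. F (h, v, w) * edens (p + q) w \<partial>lborel) \<partial>lborel) \<partial>lborel)"
      by (simp add: nn_integral_density)
    also have "\<dots> = (\<integral>\<^sup>+h. \<integral>\<^sup>+v. \<integral>\<^sup>+w. edens p h * (edens q v * (F (h, v, w) * edens (p + q) w)) \<partial>lborel \<partial>lborel \<partial>lborel)"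
      by (simp add: nn_integral_cmult)
    finally show ?thesis by (simp add: ac_simps)
  qed
  have m: "(\<lambda>(h, v, w). g (burke_step h v w)) \<in> borel_measurable (borel \<Otimes>\<^sub>M borel \<Otimes>\<^sub>M borel)"
    unfolding burke_step_def by measurable
  show ?thesis
    using burke_integral_lborel[OF assms] by (subst conv[OF m, unfolded prod.case], subst conv) auto
qed


definition expo :: "'k set \<Rightarrow> ('k \<Rightarrow> real) \<Rightarrow> ('k \<Rightarrow> real) measure" where
  "expo K r = (\<Pi>\<^sub>M k\<in>K. exp_dist (r k))"

lemma sets_expo [measurable_cong]: "sets (expo K r) = sets (\<Pi>\<^sub>M k\<in>K. borel)"
  unfolding expo_def by (rule sets_PiM_cong) simp_all

lemma space_expo: "space (expo K r) = PiE K (\<lambda>_. UNIV)"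
  by (simp add: expo_def space_PiM)

lemma prob_space_expo:
  assumes "\<And>k. k \<in> K \<Longrightarrow> 0 < r k"
  shows "prob_space (expo K r)"
  unfolding expo_def by (intro prob_space_PiM prob_space_exponential_density assms)

text \<open>
  The slots \<open>k1\<close> and \<open>k2\<close> of a weight configuration store the current horizontal and vertical
  increments, and \<open>k3\<close> is the slot of the site that is being processed.
\<close>
definition site_map :: "'k \<Rightarrow> 'k \<Rightarrow> 'k \<Rightarrow> ('k \<Rightarrow> real) \<Rightarrow> 'k \<Rightarrow> real" where
  "site_map k1 k2 k3 x = (case burke_step (x k1) (x k2) (x k3) of
     (h, v, w) \<Rightarrow> x(k1 := h, k2 := v, k3 := w))"

lemma site_map_measurable [measurable]:
  assumes "k1 \<in> K" "k2 \<in> K" "k3 \<in> K"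
  shows "site_map k1 k2 k3 \<in> expo K r \<rightarrow>\<^sub>M expo K r"
proof -
  have [measurable]: "(\<lambda>x. x k) \<in> borel_measurable (\<Pi>\<^sub>M k\<in>K. borel :: real measure)" if "k \<in> K" for k
    using that by measurable
  note [measurable] = this[OF assms(1)] this[OF assms(2)] this[OF assms(3)]
  have "(\<lambda>x. x(k1 := x k3 + max 0 (x k1 - x k2), k2 := x k3 + max 0 (x k2 - x k1), k3 := min (x k1) (x k2)))
     \<in> (\<Pi>\<^sub>M k\<in>K. borel :: real measure) \<rightarrow>\<^sub>M (\<Pi>\<^sub>M k\<in>K. borel)"
    using assms by (intro measurable_fun_upd[of K K]) auto
  then have "(\<lambda>x. x(k1 := x k3 + max 0 (x k1 - x k2), k2 := x k3 + max 0 (x k2 - x k1), k3 := min (x k1) (x k2)))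
     \<in> expo K r \<rightarrow>\<^sub>M expo K r"
    by (simp add: measurable_cong_sets[OF sets_expo sets_expo])
  then show ?thesis
    by (simp add: site_map_def burke_step_def cong: measurable_cong)
qed

text \<open>
  Because the three slots are independent of the rest, the product law is invariant.  Invariance,
  as opposed to a statement about the two outgoing increments alone, makes iteration immediate: a
  composition of such maps again preserves the law.
\<close>
lemma site_map_preserves:
  assumes K: "finite K" "{k1, k2, k3} \<subseteq> K" and dist: "k1 \<noteq> k2" "k1 \<noteq> k3" "k2 \<noteq> k3"
    and r: "\<And>k. 0 < r k" "r k3 = r k1 + r k2"
  shows "distr (expo K r) (expo K r) (site_map k1 k2 k3) = expo K r"
proof -
  interpret product_sigma_finite "\<lambda>k. exp_dist (r k)"
    using prob_space_exponential_density[OF r(1)]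
    by (simp add: product_sigma_finite_def prob_space_imp_sigma_finite)
  define L where "L = K - {k1, k2, k3}"
  have KL: "K = insert k3 (insert k2 (insert k1 L))" and L: "finite L" "k1 \<notin> L" "k2 \<notin> L" "k3 \<notin> L"
    using K dist by (auto simp: L_def)
  have msite: "site_map k1 k2 k3 \<in> expo K r \<rightarrow>\<^sub>M expo K r"
    using K by (intro site_map_measurable) auto
  \<comment> \<open>The site weight is integrated innermost, in the order expected by \<open>burke_integral\<close>.\<close>
  have iter: "(\<integral>\<^sup>+x. f x \<partial>expo K r) =
      (\<integral>\<^sup>+x. \<integral>\<^sup>+h. \<integral>\<^sup>+v. \<integral>\<^sup>+w. f (x(k1 := h, k2 := v, k3 := w)) \<partial>exp_dist (r k3) \<partial>exp_dist (r k2) \<partial>exp_dist (r k1) \<partial>expo L r)"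
    if f: "f \<in> borel_measurable (expo K r)" for f :: "('a \<Rightarrow> real) \<Rightarrow> ennreal"
  proof -
    have f': "f \<in> borel_measurable (Pi\<^sub>M (insert k3 (insert k2 (insert k1 L))) (\<lambda>k. exp_dist (r k)))"
      using f unfolding KL expo_def .
    have s: "sigma_finite_measure (exp_dist (r k))" for k
      by (rule sigma_finite_measures)
    have m1: "(\<lambda>x. \<integral>\<^sup>+w. f (x(k3 := w)) \<partial>exp_dist (r k3)) \<in> borel_measurable (Pi\<^sub>M (insert k2 (insert k1 L)) (\<lambda>k. exp_dist (r k)))"
      using measurable_compose[OF measurable_add_dim f']
      by (intro sigma_finite_measure.borel_measurable_nn_integral[OF s]) (simp add: split_beta)
    have m2: "(\<lambda>x. \<integral>\<^sup>+v. \<integral>\<^sup>+w. f (x(k2 := v, k3 := w)) \<partial>exp_dist (r k3) \<partial>exp_dist (r k2)) \<in> borel_measurable (Pi\<^sub>M (insert k1 L) (\<lambda>k. exp_dist (r k)))"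
      using measurable_compose[OF measurable_add_dim m1]
      by (intro sigma_finite_measure.borel_measurable_nn_integral[OF s]) (simp add: split_beta)
    show ?thesis
      unfolding KL expo_def
      using L dist
      by (simp add: product_nn_integral_insert[OF _ _ f'] product_nn_integral_insert[OF _ _ m1] product_nn_integral_insert[OF _ _ m2])
  qed
  have int: "(\<integral>\<^sup>+x. f (site_map k1 k2 k3 x) \<partial>expo K r) = (\<integral>\<^sup>+x. f x \<partial>expo K r)"
    if f: "f \<in> borel_measurable (expo K r)" for f :: "('a \<Rightarrow> real) \<Rightarrow> ennreal"
  proof -
    have fs: "(\<lambda>x. f (site_map k1 k2 k3 x)) \<in> borel_measurable (expo K r)"
      by (rule measurable_compose[OF msite f])
    show ?thesis
      unfolding iter[OF f] iter[OF fs]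
    proof (rule nn_integral_cong)
      fix x assume x: "x \<in> space (expo L r)"
      define g where "g = (\<lambda>(h, v, w). f (x(k1 := h, k2 := v, k3 := w)))"
      have x': "x \<in> space (\<Pi>\<^sub>M k\<in>L. borel)" using x by (simp add: space_expo space_PiM)
      have "(\<lambda>(h, v, w). x(k1 := h, k2 := v, k3 := w)) \<in> borel \<Otimes>\<^sub>M borel \<Otimes>\<^sub>M borel \<rightarrow>\<^sub>M (\<Pi>\<^sub>M k\<in>K. borel :: real measure)"
        unfolding KL split_beta
        by (intro measurable_fun_upd[of _ "insert k2 (insert k1 L)"] measurable_fun_upd[of _ "insert k1 L"] measurable_fun_upd[of _ L])
          (use x' in auto)
      then have mx: "(\<lambda>(h, v, w). x(k1 := h, k2 := v, k3 := w)) \<in> borel \<Otimes>\<^sub>M borel \<Otimes>\<^sub>M borel \<rightarrow>\<^sub>M expo K r"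
        by (simp add: measurable_cong_sets[OF refl sets_expo])
      have g: "g \<in> borel_measurable (borel \<Otimes>\<^sub>M borel \<Otimes>\<^sub>M borel)"
        using measurable_compose[OF mx f] by (simp add: g_def split_beta)
      have site: "f (site_map k1 k2 k3 (x(k1 := h, k2 := v, k3 := w))) = g (burke_step h v w)"
          "f (x(k1 := h, k2 := v, k3 := w)) = g (h, v, w)" for h v w
        using dist by (auto simp: site_map_def burke_step_def g_def fun_upd_twist)
      show "(\<integral>\<^sup>+h. \<integral>\<^sup>+v. \<integral>\<^sup>+w. f (site_map k1 k2 k3 (x(k1 := h, k2 := v, k3 := w))) \<partial>exp_dist (r k3) \<partial>exp_dist (r k2) \<partial>exp_dist (r k1))
        = (\<integral>\<^sup>+h. \<integral>\<^sup>+v. \<integral>\<^sup>+w. f (x(k1 := h, k2 := v, k3 := w)) \<partial>exp_dist (r k3) \<partial>exp_dist (r k2) \<partial>exp_dist (r k1))"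
        using burke_integral[OF r(1)[of k1] r(1)[of k2] g] by (simp only: site r(2))
    qed
  qed
  show ?thesis
  proof (rule measure_eqI)
    fix A assume "A \<in> sets (distr (expo K r) (expo K r) (site_map k1 k2 k3))"
    then have A: "A \<in> sets (expo K r)" by simp
    have "emeasure (distr (expo K r) (expo K r) (site_map k1 k2 k3)) A
        = (\<integral>\<^sup>+x. indicator A x \<partial>distr (expo K r) (expo K r) (site_map k1 k2 k3))"
      using A by simp
    also have "\<dots> = (\<integral>\<^sup>+x. indicator A (site_map k1 k2 k3 x) \<partial>expo K r)"
      using A by (intro nn_integral_distr msite) auto
    also have "\<dots> = emeasure (expo K r) A"
      using int[of "indicator A"] A by simp
    finally show "emeasure (distr (expo K r) (expo K r) (site_map k1 k2 k3)) A = emeasure (expo K r) A" .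
  qed simp
qed

section \<open>Last-passage times with boundary weights\<close>

text \<open>
  The last-passage time from the origin over a configuration that also has weights on row 0 and
  column 0, where the weight of the origin itself is not counted.
\<close>
fun boundary_lpp :: "(nat \<times> nat \<Rightarrow> real) \<Rightarrow> nat \<Rightarrow> nat \<Rightarrow> real" where
  "boundary_lpp x 0 0 = 0"
| "boundary_lpp x (Suc i) 0 = boundary_lpp x i 0 + x (Suc i, 0)"
| "boundary_lpp x 0 (Suc j) = boundary_lpp x 0 j + x (0, Suc j)"
| "boundary_lpp x (Suc i) (Suc j) =
     max (boundary_lpp x i (Suc j)) (boundary_lpp x (Suc i) j) + x (Suc i, Suc j)"

lemma boundary_lpp_row: "boundary_lpp x i 0 = (\<Sum>k=1..i. x (k, 0))"
  by (induction i) simp_all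

lemma boundary_lpp_column: "boundary_lpp x 0 j = (\<Sum>k=1..j. x (0, k))"
  by (induction j) simp_all

text \<open>
  Sites are processed upwards in each column, column after column, so that both incoming increments
  of a site are available when its turn comes.
\<close>
primrec burke_column :: "nat \<Rightarrow> nat \<Rightarrow> (nat \<times> nat \<Rightarrow> real) \<Rightarrow> nat \<times> nat \<Rightarrow> real" where
  "burke_column i 0 x = x"
| "burke_column i (Suc j) x = site_map (i, 0) (0, Suc j) (i, Suc j) (burke_column i j x)"

primrec burke_columns :: "nat \<Rightarrow> nat \<Rightarrow> (nat \<times> nat \<Rightarrow> real) \<Rightarrow> nat \<times> nat \<Rightarrow> real" where
  "burke_columns n 0 x = x"
| "burke_columns n (Suc i) x = burke_column (Suc i) n (burke_columns n i x)"

text \<open>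
  The invariant while column \<open>Suc i\<close> is processed up to height \<open>j\<close>: the slot of the column holds the
  horizontal increment at height \<open>j\<close>, the slots of the rows hold vertical increments in the new
  column up to height \<open>j\<close> and in the old column above it, and the weights still to come are untouched.
\<close>
lemma burke_column_increments:
  assumes start: "\<And>l. l \<ge> 1 \<Longrightarrow> l \<le> n \<Longrightarrow> y (0, l) = boundary_lpp x i l - boundary_lpp x i (l - 1)"
    and right: "\<And>i' l. i' > i \<Longrightarrow> y (i', l) = x (i', l)"
    and j: "j \<le> n"
  shows "burke_column (Suc i) j y (Suc i, 0) = boundary_lpp x (Suc i) j - boundary_lpp x i j \<and>
     (\<forall>l. 1 \<le> l \<and> l \<le> j \<longrightarrow>
        burke_column (Suc i) j y (0, l) = boundary_lpp x (Suc i) l - boundary_lpp x (Suc i) (l - 1)) \<and>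
     (\<forall>l. j < l \<and> l \<le> n \<longrightarrow>
        burke_column (Suc i) j y (0, l) = boundary_lpp x i l - boundary_lpp x i (l - 1)) \<and>
     (\<forall>i' l. i' > Suc i \<or> i' = Suc i \<and> l > j \<longrightarrow> burke_column (Suc i) j y (i', l) = x (i', l))"
  using j
proof (induction j)
  case 0
  then show ?case using start right by auto
next
  case (Suc j)
  define u where "u = burke_column (Suc i) j y"
  have u: "u (Suc i, 0) = boundary_lpp x (Suc i) j - boundary_lpp x i j"
     "\<And>l. 1 \<le> l \<Longrightarrow> l \<le> j \<Longrightarrow> u (0, l) = boundary_lpp x (Suc i) l - boundary_lpp x (Suc i) (l - 1)"
     "\<And>l. j < l \<Longrightarrow> l \<le> n \<Longrightarrow> u (0, l) = boundary_lpp x i l - boundary_lpp x i (l - 1)"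
     "\<And>i' l. i' > Suc i \<or> i' = Suc i \<and> l > j \<Longrightarrow> u (i', l) = x (i', l)"
    using Suc by (auto simp: u_def)
  have v: "u (0, Suc j) = boundary_lpp x i (Suc j) - boundary_lpp x i j"
    using u(3)[of "Suc j"] Suc.prems by simp
  have w: "u (Suc i, Suc j) = x (Suc i, Suc j)"
    using u(4) by simp
  show ?case
    unfolding burke_column.simps u_def[symmetric]
    using u v w
    by (auto simp: site_map_def burke_step_def le_Suc_eq max_def)
qed

lemma burke_columns_increments:
  "(\<forall>l. 1 \<le> l \<and> l \<le> n \<longrightarrow>
      burke_columns n i x (0, l) = boundary_lpp x i l - boundary_lpp x i (l - 1)) \<and>
   (\<forall>i' l. i' > i \<longrightarrow> burke_columns n i x (i', l) = x (i', l))"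
proof (induction i)
  case 0
  have "x (0, l) = boundary_lpp x 0 l - boundary_lpp x 0 (l - 1)" if "1 \<le> l" for l
    using that by (cases l) auto
  then show ?case by auto
next
  case (Suc i)
  then show ?case
    using burke_column_increments[of n "burke_columns n i x" x i n] by auto
qed

lemma distr_comp_preserves:
  assumes "f \<in> M \<rightarrow>\<^sub>M M" "g \<in> M \<rightarrow>\<^sub>M M" "distr M M f = M" "distr M M g = M"
  shows "distr M M (\<lambda>x. g (f x)) = M"
  using distr_distr[OF assms(2,1)] assms(3,4) by (simp add: comp_def)

text \<open>
  With \<open>burke_columns_increments\<close> this is Burke's theorem: the vertical increments of
  \<^const>\<open>boundary_lpp\<close> in column \<open>i\<close> have the joint law of the weights of column 0.
\<close>
lemma burke_columns_preserves:
  assumes r: "\<And>k. 0 < r k" "\<And>i j. i \<in> {1..m} \<Longrightarrow> j \<in> {1..n} \<Longrightarrow> r (i, j) = r (i, 0) + r (0, j)"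
    and i: "i \<le> m"
  shows "burke_columns n i \<in> expo ({0..m} \<times> {0..n}) r \<rightarrow>\<^sub>M expo ({0..m} \<times> {0..n}) r \<and>
    distr (expo ({0..m} \<times> {0..n}) r) (expo ({0..m} \<times> {0..n}) r) (burke_columns n i) = expo ({0..m} \<times> {0..n}) r"
    (is "_ \<in> ?E \<rightarrow>\<^sub>M _ \<and> _")
proof -
  have col: "burke_column i j \<in> ?E \<rightarrow>\<^sub>M ?E \<and> distr ?E ?E (burke_column i j) = ?E"
    if i: "i \<in> {1..m}" and j: "j \<le> n" for i j
    using j
  proof (induction j)
    case 0
    then show ?case using distr_id[of ?E] by (simp add: id_def)
  next
    case (Suc j)
    have m: "site_map (i, 0) (0, Suc j) (i, Suc j) \<in> ?E \<rightarrow>\<^sub>M ?E"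
      using i Suc.prems by (intro site_map_measurable) auto
    have "distr ?E ?E (site_map (i, 0) (0, Suc j) (i, Suc j)) = ?E"
      using i Suc.prems by (intro site_map_preserves r) auto
    with m Suc show ?case
      using distr_comp_preserves[of "burke_column i j" ?E "site_map (i, 0) (0, Suc j) (i, Suc j)"]
        measurable_compose[of "burke_column i j" ?E ?E "site_map (i, 0) (0, Suc j) (i, Suc j)"]
      by auto
  qed
  show ?thesis
    using i
  proof (induction i)
    case 0
    then show ?case using distr_id[of ?E] by (simp add: id_def)
  next
    case (Suc i)
    then show ?case
      using distr_comp_preserves[of "burke_columns n i" ?E "burke_column (Suc i) n"]
        measurable_compose[of "burke_columns n i" ?E ?E "burke_column (Suc i) n"] col[of "Suc i" n]
      by auto
  qed
qed

section \<open>Up-right paths\<close>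
definition lattice_paths :: "nat \<times> nat \<Rightarrow> nat \<times> nat \<Rightarrow> (nat \<times> nat) list set" where
  "lattice_paths p q = {\<pi>. \<pi> \<noteq> [] \<and> hd \<pi> = p \<and> last \<pi> = q \<and> successively up_right_step \<pi>}"

lemma up_right_paths_eq: "up_right_paths m n = lattice_paths (1, 1) (m, n)"
  by (simp add: up_right_paths_def lattice_paths_def)

lemma lattice_paths_single: "[p] \<in> lattice_paths p p"
  by (simp add: lattice_paths_def)

lemma lattice_paths_append:
  assumes "\<pi> \<in> lattice_paths p q" "up_right_step q q'" "\<pi>' \<in> lattice_paths q' r"
  shows "\<pi> @ \<pi>' \<in> lattice_paths p r"
  using assms by (auto simp: lattice_paths_def successively_append_iff)

lemma lattice_paths_subset:
  assumes "\<pi> \<in> lattice_paths p q"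
  shows "set \<pi> \<subseteq> {fst p..fst q} \<times> {snd p..snd q}"
proof -
  have *: "successively up_right_step \<pi> \<Longrightarrow> \<pi> \<noteq> [] \<Longrightarrow>
     (\<forall>s\<in>set \<pi>. fst (hd \<pi>) \<le> fst s \<and> snd (hd \<pi>) \<le> snd s \<and>
        fst s \<le> fst (last \<pi>) \<and> snd s \<le> snd (last \<pi>))"
  proof (induction \<pi>)
    case (Cons s \<pi>)
    show ?case
    proof (cases \<pi>)
      case (Cons s' \<pi>')
      with Cons.prems have "up_right_step s s'" "successively up_right_step \<pi>" by auto
      with Cons.IH Cons show ?thesis by (fastforce simp: up_right_step_def)
    qed simp
  qed simp
  show ?thesis
  proof
    fix s assume "s \<in> set \<pi>"
    with * assms show "s \<in> {fst p..fst q} \<times> {snd p..snd q}"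
      by (auto simp: lattice_paths_def mem_Times_iff)
  qed
qed

lemma finite_lattice_paths [simp]: "finite (lattice_paths p q)"
proof (rule finite_subset)
  show "lattice_paths p q \<subseteq> {\<pi>. set \<pi> \<subseteq> {..fst q} \<times> {..snd q} \<and> length \<pi> \<le> fst q + snd q + 1}"
  proof
    fix \<pi> assume "\<pi> \<in> lattice_paths p q"
    then show "\<pi> \<in> {\<pi>. set \<pi> \<subseteq> {..fst q} \<times> {..snd q} \<and> length \<pi> \<le> fst q + snd q + 1}"
      using up_right_path_bounds[of \<pi>] by (auto simp: lattice_paths_def)
  qed
  show "finite {\<pi>. set \<pi> \<subseteq> {..fst q} \<times> {..snd q} \<and> length \<pi> \<le> fst q + snd q + 1}"
    by (rule finite_lists_length_le) auto
qed

abbreviation weight :: "('k \<Rightarrow> real) \<Rightarrow> 'k list \<Rightarrow> real" where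
  "weight x \<pi> \<equiv> (\<Sum>p\<leftarrow>\<pi>. x p)"

lemma last_passage_time_le_iff:
  assumes "m \<ge> 1" "n \<ge> 1"
  shows "last_passage_time x m n \<le> c \<longleftrightarrow> (\<forall>\<pi>\<in>lattice_paths (1, 1) (m, n). weight x \<pi> \<le> c)"
  using finite_up_right_paths up_right_paths_nonempty[OF assms]
  by (auto simp: last_passage_time_def up_right_paths_eq)

lemma last_passage_time_ge_iff:
  assumes "m \<ge> 1" "n \<ge> 1"
  shows "c \<le> last_passage_time x m n \<longleftrightarrow> (\<exists>\<pi>\<in>lattice_paths (1, 1) (m, n). c \<le> weight x \<pi>)"
  using finite_up_right_paths[of m n] up_right_paths_nonempty[OF assms]
  by (subst last_passage_time_def, subst Max_ge_iff) (auto simp: up_right_paths_eq)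

text \<open>
  Walking along row \<open>l - 1\<close> and then following the path is an admissible route to the corner.  The
  induction maintains the bound for both predecessors of the first site of the path.
\<close>
lemma boundary_lpp_path_le:
  assumes "\<pi> \<in> lattice_paths (k, l) (m, n)" "k \<ge> 1" "l \<ge> 1"
  shows "boundary_lpp x k (l - 1) + weight x \<pi> \<le> boundary_lpp x m n"
proof -
  have "successively up_right_step \<pi> \<Longrightarrow> \<pi> \<noteq> [] \<Longrightarrow> fst (hd \<pi>) \<ge> 1 \<Longrightarrow> snd (hd \<pi>) \<ge> 1 \<Longrightarrow>
     max (boundary_lpp x (fst (hd \<pi>)) (snd (hd \<pi>) - 1)) (boundary_lpp x (fst (hd \<pi>) - 1) (snd (hd \<pi>)))
       + weight x \<pi> \<le> boundary_lpp x (fst (last \<pi>)) (snd (last \<pi>))"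
  proof (induction \<pi>)
    case (Cons s \<pi>)
    obtain i j where s: "s = (Suc i, Suc j)"
      using Cons.prems by (cases s) (auto simp: not0_implies_Suc Suc_le_eq gr0_conv_Suc)
    show ?case
    proof (cases \<pi>)
      case Nil
      then show ?thesis using s by simp
    next
      case (Cons s' \<pi>')
      with Cons.prems have "up_right_step s s'" "successively up_right_step \<pi>" by auto
      then show ?thesis using Cons.IH Cons s by (auto simp: up_right_step_def max_def split: if_splits)
    qed
  qed simp
  from this assms show ?thesis by (auto simp: lattice_paths_def)
qed

text \<open>
  Tracing an optimal route backwards from the corner, one reaches a last site on the boundary.
\<close>
lemma boundary_lpp_exit:
  assumes "i \<ge> 1" "j \<ge> 1"
  shows "(\<exists>k\<in>{1..i}. \<exists>\<pi>\<in>lattice_paths (k, 1) (i, j). boundary_lpp x i j = boundary_lpp x k 0 + weight x \<pi>) \<or>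
         (\<exists>l\<in>{1..j}. \<exists>\<pi>\<in>lattice_paths (1, l) (i, j). boundary_lpp x i j = boundary_lpp x 0 l + weight x \<pi>)"
  using assms
proof (induction "i + j" arbitrary: i j rule: less_induct)
  case less
  obtain i' j' where ij: "i = Suc i'" "j = Suc j'"
    using less.prems by (cases i; cases j) auto
  have ext: "\<pi> @ [(i, j)] \<in> lattice_paths p (i, j)"
    if "\<pi> \<in> lattice_paths p q" "up_right_step q (i, j)" for \<pi> p q
    using lattice_paths_append[OF that lattice_paths_single] .
  have up: "up_right_step (i', j) (i, j)" "up_right_step (i, j') (i, j)"
    by (auto simp: up_right_step_def ij)
  consider "boundary_lpp x i j = boundary_lpp x i' j + x (i, j)" | "boundary_lpp x i j = boundary_lpp x i j' + x (i, j)"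
    unfolding ij by (cases "boundary_lpp x i' (Suc j') \<le> boundary_lpp x (Suc i') j'") (auto simp: max_def)
  then show ?case
  proof cases
    case 1
    show ?thesis
    proof (cases "i' = 0")
      case True
      then show ?thesis using 1 lattice_paths_single[of "(1, j)"] ij by fastforce
    next
      case False
      then have "(\<exists>k\<in>{1..i'}. \<exists>\<pi>\<in>lattice_paths (k, 1) (i', j). boundary_lpp x i' j = boundary_lpp x k 0 + weight x \<pi>) \<or>
         (\<exists>l\<in>{1..j}. \<exists>\<pi>\<in>lattice_paths (1, l) (i', j). boundary_lpp x i' j = boundary_lpp x 0 l + weight x \<pi>)"
        using less.hyps[of i' j] less.prems ij by auto
      then show ?thesis
      proof (elim disjE bexE)
        fix k \<pi> assume "k \<in> {1..i'}" "\<pi> \<in> lattice_paths (k, 1) (i', j)" "boundary_lpp x i' j = boundary_lpp x k 0 + weight x \<pi>"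
        then show ?thesis using ext[OF _ up(1)] 1 ij by (intro disjI1 bexI[of _ k] bexI[of _ "\<pi> @ [(i, j)]"]) auto
      next
        fix l \<pi> assume "l \<in> {1..j}" "\<pi> \<in> lattice_paths (1, l) (i', j)" "boundary_lpp x i' j = boundary_lpp x 0 l + weight x \<pi>"
        then show ?thesis using ext[OF _ up(1)] 1 ij by (intro disjI2 bexI[of _ l] bexI[of _ "\<pi> @ [(i, j)]"]) auto
      qed
    qed
  next
    case 2
    show ?thesis
    proof (cases "j' = 0")
      case True
      then show ?thesis using 2 lattice_paths_single[of "(i, 1)"] ij by fastforce
    next
      case False
      then have "(\<exists>k\<in>{1..i}. \<exists>\<pi>\<in>lattice_paths (k, 1) (i, j'). boundary_lpp x i j' = boundary_lpp x k 0 + weight x \<pi>) \<or>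
         (\<exists>l\<in>{1..j'}. \<exists>\<pi>\<in>lattice_paths (1, l) (i, j'). boundary_lpp x i j' = boundary_lpp x 0 l + weight x \<pi>)"
        using less.hyps[of i j'] less.prems ij by auto
      then show ?thesis
      proof (elim disjE bexE)
        fix k \<pi> assume "k \<in> {1..i}" "\<pi> \<in> lattice_paths (k, 1) (i, j')" "boundary_lpp x i j' = boundary_lpp x k 0 + weight x \<pi>"
        then show ?thesis using ext[OF _ up(2)] 2 ij by (intro disjI1 bexI[of _ k] bexI[of _ "\<pi> @ [(i, j)]"]) auto
      next
        fix l \<pi> assume "l \<in> {1..j'}" "\<pi> \<in> lattice_paths (1, l) (i, j')" "boundary_lpp x i j' = boundary_lpp x 0 l + weight x \<pi>"
        then show ?thesis using ext[OF _ up(2)] 2 ij by (intro disjI2 bexI[of _ l] bexI[of _ "\<pi> @ [(i, j)]"]) auto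
      qed
    qed
  qed
qed

lemma row_path_extend:
  assumes "k \<ge> 1" "\<pi> \<in> lattice_paths (k, l) q"
  shows "\<exists>\<pi>'\<in>lattice_paths (1, l) q. weight x \<pi>' = (\<Sum>i=1..<k. x (i, l)) + weight x \<pi>"
  using assms
proof (induction k arbitrary: \<pi> rule: dec_induct)
  case base
  then show ?case by auto
next
  case (step k)
  have "(k, l) # \<pi> \<in> lattice_paths (k, l) q"
    using lattice_paths_append[OF lattice_paths_single _ step.prems, of "(k, l)"] by (auto simp: up_right_step_def)
  from step.IH[OF this] obtain \<pi>' where "\<pi>' \<in> lattice_paths (1, l) q"
     "weight x \<pi>' = (\<Sum>i=1..<k. x (i, l)) + (x (k, l) + weight x \<pi>)" by auto
  then show ?case using step.hyps by (intro bexI[of _ \<pi>']) (auto simp: sum.atLeastLessThan_Suc)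
qed

lemma lattice_paths_swap:
  assumes "\<pi> \<in> lattice_paths p q"
  shows "map prod.swap \<pi> \<in> lattice_paths (prod.swap p) (prod.swap q)"
  using assms unfolding lattice_paths_def
  by (auto simp: hd_map last_map successively_map up_right_step_def elim!: successively_mono)

lemma lattice_paths_shift:
  assumes "\<pi> \<in> lattice_paths p q"
  shows "map (\<lambda>(i, j). (i + c, j + d)) \<pi> \<in> lattice_paths (fst p + c, snd p + d) (fst q + c, snd q + d)"
  using assms unfolding lattice_paths_def
  by (auto simp: hd_map last_map successively_map up_right_step_def split_beta elim!: successively_mono)

lemma lattice_paths_reflect:
  assumes "\<pi> \<in> lattice_paths (i, j) (k, l)" "k \<le> c" "l \<le> d"
  shows "rev (map (\<lambda>(i, j). (c - i, d - j)) \<pi>) \<in> lattice_paths (c - k, d - l) (c - i, d - j)"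
proof -
  have sub: "set \<pi> \<subseteq> {..c} \<times> {..d}"
    using lattice_paths_subset[OF assms(1)] assms(2,3) by force
  have "successively up_right_step \<pi>" using assms by (simp add: lattice_paths_def)
  then have "successively (\<lambda>p q. up_right_step (case q of (i, j) \<Rightarrow> (c - i, d - j)) (case p of (i, j) \<Rightarrow> (c - i, d - j))) \<pi>"
    by (rule successively_mono) (use sub in \<open>auto simp: up_right_step_def split_beta Suc_diff_Suc\<close>)
  then show ?thesis
    using assms unfolding lattice_paths_def
    by (auto simp: hd_rev last_rev hd_map last_map successively_map)
qed

lemma lattice_paths_join:
  assumes "\<pi> \<in> lattice_paths p q" "\<pi>' \<in> lattice_paths q r"
  shows "\<exists>\<rho>\<in>lattice_paths p r. weight x \<rho> = weight x \<pi> + weight x \<pi>' - x q"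
proof (cases \<pi>')
  case Nil
  then show ?thesis using assms by (simp add: lattice_paths_def)
next
  case (Cons s \<pi>'')
  then have s: "s = q" using assms by (simp add: lattice_paths_def)
  show ?thesis
  proof (cases "\<pi>'' = []")
    case True
    then show ?thesis using assms Cons s by (intro bexI[of _ \<pi>]) (auto simp: lattice_paths_def)
  next
    case False
    then have "up_right_step q (hd \<pi>'')" "\<pi>'' \<in> lattice_paths (hd \<pi>'') r"
      using assms Cons s by (auto simp: lattice_paths_def successively_Cons)
    from lattice_paths_append[OF assms(1) this] show ?thesis
      using Cons s by (intro bexI[of _ "\<pi> @ \<pi>''"]) auto
  qed
qed

section \<open>Events of high probability and exponential families\<close>

text \<open>
  Covering the bad outcomes by a measurable set means that no measurability has to be shown for the
  events themselves, which involve maxima over paths; only the transfer between probability spaces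
  below needs it.
\<close>
definition whp :: "'x measure \<Rightarrow> real \<Rightarrow> ('x \<Rightarrow> bool) \<Rightarrow> bool" where
  "whp M p P \<longleftrightarrow> (\<exists>E\<in>sets M. measure M E \<le> p \<and> (\<forall>x\<in>space M - E. P x))"

lemma whp_mono:
  assumes "whp M p P" "p \<le> q" "\<And>x. x \<in> space M \<Longrightarrow> P x \<Longrightarrow> Q x"
  shows "whp M q Q"
  using assms unfolding whp_def by (meson DiffD1 order_trans)

lemma whp_conj:
  assumes "prob_space M" "whp M p P" "whp M q Q"
  shows "whp M (p + q) (\<lambda>x. P x \<and> Q x)"
proof -
  interpret prob_space M by fact
  from assms obtain E E' where E: "E \<in> sets M" "measure M E \<le> p" "\<And>x. x \<in> space M - E \<Longrightarrow> P x"
    "E' \<in> sets M" "measure M E' \<le> q" "\<And>x. x \<in> space M - E' \<Longrightarrow> Q x"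
    unfolding whp_def by blast
  have "measure M (E \<union> E') \<le> p + q"
    using E measure_Un_le[of E M E'] by simp
  with E show ?thesis unfolding whp_def by (intro bexI[of _ "E \<union> E'"]) auto
qed

lemma whp_ball:
  fixes p :: real
  assumes M: "prob_space M" and F: "finite F" "\<And>k. k \<in> F \<Longrightarrow> whp M p (P k)"
  shows "whp M (real (card F) * p) (\<lambda>x. \<forall>k\<in>F. P k x)"
  using F
proof (induction F rule: finite_induct)
  case empty
  show ?case unfolding whp_def by (intro bexI[of _ "{}"]) auto
next
  case (insert k F)
  have "whp M (p + real (card F) * p) (\<lambda>x. P k x \<and> (\<forall>k\<in>F. P k x))"
    using insert by (intro whp_conj M) auto
  then show ?case using insert by (auto simp: algebra_simps elim: whp_mono)
qed

lemma whp_AE: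
  assumes "AE x in M. P x"
  shows "whp M 0 P"
proof -
  from AE_E[OF assms] obtain N where "{x \<in> space M. \<not> P x} \<subseteq> N" "emeasure M N = 0" "N \<in> sets M" .
  then show ?thesis unfolding whp_def by (intro bexI[of _ N]) (auto simp: measure_def)
qed

lemma whp_measure:
  assumes "prob_space M" "{x\<in>space M. \<not> P x} \<in> sets M"
  shows "whp M p P \<longleftrightarrow> measure M {x\<in>space M. \<not> P x} \<le> p"
proof
  interpret prob_space M by fact
  assume "whp M p P"
  then obtain E where E: "E \<in> sets M" "measure M E \<le> p" "\<forall>x\<in>space M - E. P x"
    unfolding whp_def by auto
  have "measure M {x\<in>space M. \<not> P x} \<le> measure M E"
    using E by (intro finite_measure_mono) auto
  with E show "measure M {x\<in>space M. \<not> P x} \<le> p" by simp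
next
  assume "measure M {x\<in>space M. \<not> P x} \<le> p"
  with assms show "whp M p P" unfolding whp_def by blast
qed

lemma whp_preserving:
  assumes "whp M p P" "f \<in> M \<rightarrow>\<^sub>M M" "distr M M f = M"
  shows "whp M p (\<lambda>x. P (f x))"
proof -
  from assms(1) obtain E where E: "E \<in> sets M" "measure M E \<le> p" "\<forall>x\<in>space M - E. P x"
    unfolding whp_def by auto
  have "measure M (f -` E \<inter> space M) = measure (distr M M f) E"
    using E assms(2) by (simp add: measure_distr)
  with E assms show ?thesis
    unfolding whp_def by (intro bexI[of _ "f -` E \<inter> space M"]) (auto simp: measurable_space)
qed

text \<open>
  A family of independent exponential random variables indexed by \<open>F\<close>, on an arbitrary probability
  space: statements in this form pass to subfamilies and to reflected, shifted or transposed rectangles.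
\<close>
definition exp_vars :: "'x measure \<Rightarrow> 'k set \<Rightarrow> ('k \<Rightarrow> 'x \<Rightarrow> real) \<Rightarrow> ('k \<Rightarrow> real) \<Rightarrow> bool" where
  "exp_vars M F X r \<longleftrightarrow> prob_space M \<and> prob_space.indep_vars M (\<lambda>_. borel) X F \<and>
     (\<forall>k\<in>F. 0 < r k \<and> distributed M lborel (X k) (exponential_density (r k)))"

lemma exp_vars_measurable:
  "exp_vars M F X r \<Longrightarrow> k \<in> F \<Longrightarrow> X k \<in> borel_measurable M"
  by (auto simp: exp_vars_def distributed_def)

lemma exp_vars_nonneg:
  assumes "exp_vars M F X r" "k \<in> F"
  shows "AE x in M. 0 \<le> X k x"
proof -
  have D: "distributed M lborel (X k) (exponential_density (r k))"
    using assms by (auto simp: exp_vars_def)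
  have "AE x in density lborel (\<lambda>x. ennreal (exponential_density (r k) x)). 0 \<le> x"
    by (subst AE_density) (auto simp: exponential_density_def)
  then have "AE x in distr M lborel (X k). 0 \<le> x"
    by (simp only: distributed_distr_eq_density[OF D])
  then show ?thesis
    using exp_vars_measurable[OF assms] by (subst (asm) AE_distr_iff) auto
qed

lemma exp_vars_cong:
  assumes "\<And>k. k \<in> F \<Longrightarrow> r k = r' k"
  shows "exp_vars M F X r \<longleftrightarrow> exp_vars M F X r'"
  using assms by (simp add: exp_vars_def)

lemma exp_vars_reindex:
  assumes X: "exp_vars M F X r" and f: "inj_on f G" "f ` G \<subseteq> F"
  shows "exp_vars M G (\<lambda>k. X (f k)) (\<lambda>k. r (f k))"
proof -
  interpret prob_space M using X by (simp add: exp_vars_def)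
  have "indep_vars (\<lambda>_. borel) (\<lambda>k. X (f k)) G"
    unfolding indep_vars_def2
  proof (intro conjI ballI indep_setsI)
    fix k assume "k \<in> G"
    then show "random_variable borel (X (f k))" using exp_vars_measurable[OF X] f by auto
    then show "{X (f k) -` A \<inter> space M |A. A \<in> sets borel} \<subseteq> events" by auto
  next
    fix A J assume J: "J \<noteq> {}" "J \<subseteq> G" "finite J"
       and A: "\<forall>j\<in>J. A j \<in> {X (f j) -` A \<inter> space M |A. A \<in> sets borel}"
    have inj: "inj_on f J" using f J inj_on_subset by blast
    define A' where "A' = (\<lambda>k. A (the_inv_into J f k))"
    have A': "A' (f j) = A j" if "j \<in> J" for j
      using the_inv_into_f_f[OF inj that] by (simp add: A'_def)
    have "indep_sets (\<lambda>k. {X k -` A \<inter> space M |A. A \<in> sets borel}) F"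
      using X by (simp add: exp_vars_def indep_vars_def2)
    then have "prob (\<Inter>k\<in>f ` J. A' k) = (\<Prod>k\<in>f ` J. prob (A' k))"
      using J f A A' by (intro indep_setsD[where I = F]) auto
    then show "prob (\<Inter>j\<in>J. A j) = (\<Prod>j\<in>J. prob (A j))"
      using A' by (simp add: prod.reindex[OF inj])
  qed
  with X f show ?thesis by (auto simp: exp_vars_def)
qed

lemma exp_vars_subset:
  assumes "exp_vars M F X r" "G \<subseteq> F"
  shows "exp_vars M G X r"
  using exp_vars_reindex[OF assms(1), of id G] assms(2) by (simp add: image_subset_iff subset_iff)

lemma distr_exp_var:
  assumes "exp_vars M F X r" "k \<in> F"
  shows "distr M borel (X k) = density lborel (\<lambda>x. ennreal (exponential_density (r k) x))"
proof -
  have "distr M lborel (X k) = density lborel (\<lambda>x. ennreal (exponential_density (r k) x))"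
    using assms by (auto simp: exp_vars_def distributed_def)
  moreover have "distr M lborel (X k) = distr M borel (X k)"
    by (rule distr_cong) auto
  ultimately show ?thesis by simp
qed

lemma exp_vars_law:
  assumes X: "exp_vars M F X r" and F: "F \<noteq> {}"
  shows "distr M (\<Pi>\<^sub>M k\<in>F. borel) (\<lambda>x. \<lambda>k\<in>F. X k x) = expo F r"
proof -
  interpret prob_space M using X by (simp add: exp_vars_def)
  have "distr M (\<Pi>\<^sub>M k\<in>F. borel) (\<lambda>x. \<lambda>k\<in>F. X k x) = (\<Pi>\<^sub>M k\<in>F. distr M borel (X k))"
    using X F exp_vars_measurable[OF X]
    by (subst indep_vars_iff_distr_eq_PiM'[symmetric]) (auto simp: exp_vars_def)
  also have "\<dots> = expo F r"
    unfolding expo_def by (intro PiM_cong refl distr_exp_var[OF X])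
  finally show ?thesis .
qed

lemma exp_vars_expo:
  assumes r: "\<And>k. k \<in> K \<Longrightarrow> 0 < r k" and K: "K \<noteq> {}"
  shows "exp_vars (expo K r) K (\<lambda>k x. x k) r"
proof -
  interpret prob_space "expo K r" using r by (rule prob_space_expo)
  have comp: "distr (expo K r) borel (\<lambda>x. x k) = exp_dist (r k)" if "k \<in> K" for k
  proof -
    have "distr (expo K r) (exp_dist (r k)) (\<lambda>x. x k) = exp_dist (r k)"
      unfolding expo_def using that by (intro distr_PiM_component prob_space_exponential_density r)
    moreover have "distr (expo K r) (exp_dist (r k)) (\<lambda>x. x k) = distr (expo K r) borel (\<lambda>x. x k)"
      by (rule distr_cong) auto
    ultimately show ?thesis by simp
  qed
  have rv: "(\<lambda>x. x k) \<in> borel_measurable (expo K r)" if "k \<in> K" for k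
    using that by (simp add: measurable_cong_sets[OF sets_expo refl])
  have "distr (expo K r) (\<Pi>\<^sub>M k\<in>K. borel) (\<lambda>x. \<lambda>k\<in>K. x k) = distr (expo K r) (expo K r) (\<lambda>x. x)"
    by (rule distr_cong) (auto simp: sets_expo space_expo)
  also have "\<dots> = expo K r"
    using distr_id[of "expo K r"] by (simp add: id_def)
  also have "\<dots> = (\<Pi>\<^sub>M k\<in>K. distr (expo K r) borel (\<lambda>x. x k))"
    unfolding expo_def by (intro PiM_cong refl comp[unfolded expo_def, symmetric])
  finally have "indep_vars (\<lambda>_. borel) (\<lambda>k x. x k) K"
    using K rv by (subst indep_vars_iff_distr_eq_PiM') auto
  moreover have "distributed (expo K r) lborel (\<lambda>x. x k) (exponential_density (r k))" if "k \<in> K" for k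
  proof -
    have "distr (expo K r) lborel (\<lambda>x. x k) = distr (expo K r) borel (\<lambda>x. x k)"
      by (rule distr_cong) auto
    then show ?thesis using comp[OF that] rv[OF that] by (simp add: distributed_def)
  qed
  ultimately show ?thesis using r prob_space_axioms by (auto simp: exp_vars_def)
qed

text \<open>
  The law of the family determines the probability of any event that depends on the family alone.
  This replaces the given weights by coordinates of a product space that carries boundary weights too.
\<close>
lemma whp_transfer:
  assumes X: "exp_vars M F X r" and X': "exp_vars M' F X' r" and F: "F \<noteq> {}"
    and Q: "{y \<in> space (\<Pi>\<^sub>M k\<in>F. borel). \<not> Q y} \<in> sets (\<Pi>\<^sub>M k\<in>F. borel)"
    and local: "\<And>y. Q (\<lambda>k\<in>F. y k) \<longleftrightarrow> Q y"
    and whp: "whp M' p (\<lambda>x. Q (\<lambda>k. X' k x))"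
  shows "whp M p (\<lambda>x. Q (\<lambda>k. X k x))"
proof -
  let ?B = "{y \<in> space (\<Pi>\<^sub>M k\<in>F. borel :: real measure). \<not> Q y}"
  have *: "whp N p (\<lambda>x. Q (\<lambda>k. Y k x)) \<longleftrightarrow> measure (expo F r) ?B \<le> p" if Y: "exp_vars N F Y r" for N Y
  proof -
    have m: "(\<lambda>x. \<lambda>k\<in>F. Y k x) \<in> N \<rightarrow>\<^sub>M (\<Pi>\<^sub>M k\<in>F. borel)"
      using exp_vars_measurable[OF Y] by (intro measurable_restrict)
    have set: "(\<lambda>x. \<lambda>k\<in>F. Y k x) -` ?B \<inter> space N = {x \<in> space N. \<not> Q (\<lambda>k. Y k x)}"
      using local by (auto simp: space_PiM)
    have "{x \<in> space N. \<not> Q (\<lambda>k. Y k x)} \<in> sets N"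
      using measurable_sets[OF m Q] unfolding set .
    moreover have "measure (expo F r) ?B = measure N {x \<in> space N. \<not> Q (\<lambda>k. Y k x)}"
      unfolding exp_vars_law[OF Y F, symmetric] measure_distr[OF m Q] set ..
    ultimately show ?thesis using Y by (subst whp_measure) (auto simp: exp_vars_def)
  qed
  show ?thesis using whp *[OF X] *[OF X'] by simp
qed

lemma exponential_mgf:
  assumes D: "distributed M lborel X (exponential_density r)" and r: "0 < r" "s < r"
  shows "(\<integral>\<^sup>+x. ennreal (exp (s * X x)) \<partial>M) = ennreal (r / (r - s))"
proof -
  have "(\<integral>\<^sup>+x. ennreal (exp (s * X x)) \<partial>M) = (\<integral>\<^sup>+x. ennreal (exponential_density r x) * ennreal (exp (s * x)) \<partial>lborel)"
    by (rule distributed_nn_integral[OF D, symmetric]) simp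
  also have "\<dots> = (\<integral>\<^sup>+x. ennreal (r / (r - s)) * ennreal (exponential_density (r - s) x) \<partial>lborel)"
  proof (intro nn_integral_cong)
    fix x :: real
    have "exponential_density r x * exp (s * x) = r / (r - s) * exponential_density (r - s) x"
      using r by (simp add: exponential_density_def exp_add[symmetric] algebra_simps diff_divide_distrib[symmetric]
        del: right_diff_distrib)
        (simp add: field_simps)
    then show "ennreal (exponential_density r x) * ennreal (exp (s * x)) =
        ennreal (r / (r - s)) * ennreal (exponential_density (r - s) x)"
      using r by (simp add: ennreal_mult'[symmetric] ennreal_mult''[symmetric])
  qed
  also have "\<dots> = ennreal (r / (r - s)) * (\<integral>\<^sup>+x. ennreal (exponential_density (r - s) x) \<partial>lborel)"
    by (rule nn_integral_cmult) simp
  also have "(\<integral>\<^sup>+x. ennreal (exponential_density (r - s) x) \<partial>lborel) = 1"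
    using prob_space.emeasure_space_1[OF prob_space_exponential_density[of "r - s"]] r
    by (simp add: emeasure_density)
  finally show ?thesis by simp
qed

text \<open>
  Chernoff's bound with exponent \<open>s = \<sigma> / (2 \<tau>)\<close>.  Each \<open>1 / r k\<close> is at most \<open>\<tau>\<close>, so \<open>\<bar>s / r k\<bar> \<le> 1 / 2\<close>
  and the logarithm of each moment generating function is within \<open>2 (s / r k)\<^sup>2\<close> of its linear part;
  these errors add up to at most \<open>1 / 2\<close>.  The sign \<open>\<sigma>\<close> treats both tails at once.
\<close>
lemma exp_vars_chernoff:
  assumes X: "exp_vars M F X r" and F: "finite F" and tau: "0 < \<tau>" "(\<Sum>k\<in>F. 1 / (r k)\<^sup>2) \<le> \<tau>\<^sup>2"
    and \<sigma>: "\<bar>\<sigma>\<bar> = 1"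
  shows "whp M (2 * exp (- t / (2 * \<tau>))) (\<lambda>x. \<sigma> * ((\<Sum>k\<in>F. X k x) - (\<Sum>k\<in>F. 1 / r k)) \<le> t)"
proof -
  interpret prob_space M using X by (simp add: exp_vars_def)
  have rv[measurable]: "X k \<in> borel_measurable M" if "k \<in> F" for k
    using exp_vars_measurable[OF X that] .
  have rpos: "0 < r k" if "k \<in> F" for k using X that by (auto simp: exp_vars_def)
  define s where "s = \<sigma> / (2 * \<tau>)"
  define S where "S = (\<lambda>x. \<Sum>k\<in>F. X k x)"
  define \<mu> where "\<mu> = (\<Sum>k\<in>F. 1 / r k)"
  have [measurable]: "S \<in> borel_measurable M" unfolding S_def by measurable
  have s: "\<bar>s / r k\<bar> \<le> 1 / 2" if "k \<in> F" for k
  proof -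
    have "(1 / r k)\<^sup>2 \<le> \<tau>\<^sup>2"
      using member_le_sum[of k F "\<lambda>k. 1 / (r k)\<^sup>2"] that F tau by (auto simp: power_divide)
    then have "1 / r k \<le> \<tau>" by (rule power2_le_imp_le) (use tau(1) in simp)
    moreover have "\<bar>s\<bar> = 1 / (2 * \<tau>)" using \<sigma> tau by (simp add: s_def abs_mult)
    ultimately have "\<bar>s\<bar> * (1 / r k) \<le> 1 / (2 * \<tau>) * \<tau>"
      using tau rpos[OF that] by (intro mult_mono) auto
    then show ?thesis using rpos[OF that] tau by simp
  qed
  have factor: "r k / (r k - s) \<le> exp (s / r k + 2 * s\<^sup>2 / (r k)\<^sup>2)" and lt: "s < r k" if "k \<in> F" for k
  proof -
    define u where "u = s / r k"
    have u: "\<bar>- u\<bar> \<le> 1 / 2" using s[OF that] by (simp add: u_def)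
    have su: "s = u * r k" using rpos[OF that] by (simp add: u_def)
    have "u < 1" using u by linarith
    then show "s < r k" unfolding su using rpos[OF that] by simp
    have "- ln (1 + - u) \<le> u + 2 * u\<^sup>2"
      using abs_ln_one_plus_x_minus_x_bound[OF u] by simp
    then have bound: "exp (- ln (1 - u)) \<le> exp (u + 2 * u\<^sup>2)" by simp
    have "exp (- ln (1 - u)) = r k / (r k - s)"
      using \<open>u < 1\<close> rpos[OF that] by (simp add: exp_minus su field_simps)
    with bound show "r k / (r k - s) \<le> exp (s / r k + 2 * s\<^sup>2 / (r k)\<^sup>2)"
      by (simp only:) (simp add: u_def power_divide)
  qed
  have ge: "0 \<le> r k / (r k - s)" if "k \<in> F" for k
    using lt[OF that] rpos[OF that] by simp
  have mgf: "(\<integral>\<^sup>+x. ennreal (exp (s * S x)) \<partial>M) \<le> ennreal (exp (s * \<mu> + 1 / 2))"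
  proof -
    have "(\<integral>\<^sup>+x. ennreal (exp (s * S x)) \<partial>M) = (\<integral>\<^sup>+x. (\<Prod>k\<in>F. ennreal (exp (s * X k x))) \<partial>M)"
      using F by (simp add: S_def sum_distrib_left exp_sum prod_ennreal)
    also have "\<dots> = (\<Prod>k\<in>F. \<integral>\<^sup>+x. ennreal (exp (s * X k x)) \<partial>M)"
      using X F by (intro indep_vars_nn_integral indep_vars_compose2[where Y = "\<lambda>_ x. ennreal (exp (s * x))" and M' = "\<lambda>_. borel"])
        (auto simp: exp_vars_def)
    also have "\<dots> = (\<Prod>k\<in>F. ennreal (r k / (r k - s)))"
      using X lt by (intro prod.cong refl exponential_mgf) (auto simp: exp_vars_def)
    also have "\<dots> = ennreal (\<Prod>k\<in>F. r k / (r k - s))"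
      by (intro prod_ennreal ge)
    also have "\<dots> \<le> ennreal (\<Prod>k\<in>F. exp (s / r k + 2 * s\<^sup>2 / (r k)\<^sup>2))"
      by (intro ennreal_leI prod_mono conjI ge factor)
    also have "(\<Prod>k\<in>F. exp (s / r k + 2 * s\<^sup>2 / (r k)\<^sup>2)) = exp (s * \<mu> + 2 * s\<^sup>2 * (\<Sum>k\<in>F. 1 / (r k)\<^sup>2))"
      using F by (simp add: exp_sum[symmetric] \<mu>_def sum.distrib sum_distrib_left)
    also have "\<dots> \<le> exp (s * \<mu> + 1 / 2)"
    proof -
      have "2 * s\<^sup>2 * (\<Sum>k\<in>F. 1 / (r k)\<^sup>2) \<le> 2 * s\<^sup>2 * \<tau>\<^sup>2"
        using tau by (intro mult_left_mono) auto
      also have "\<dots> = 1 / 2"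
        using tau \<sigma> power2_abs[of \<sigma>] by (simp add: s_def power_divide power_mult_distrib)
      finally show ?thesis by simp
    qed
    finally show ?thesis by (simp add: ennreal_leI)
  qed
  define A where "A = {x \<in> space M. 1 \<le> ennreal (exp (- s * \<mu> - t / (2 * \<tau>))) * ennreal (exp (s * S x))}"
  have A: "A \<in> sets M" unfolding A_def by measurable
  have "emeasure M A \<le> ennreal (exp (- s * \<mu> - t / (2 * \<tau>))) * (\<integral>\<^sup>+x. ennreal (exp (s * S x)) * indicator (space M) x \<partial>M)"
    unfolding A_def by (rule nn_integral_Markov_inequality) auto
  also have "(\<integral>\<^sup>+x. ennreal (exp (s * S x)) * indicator (space M) x \<partial>M) = (\<integral>\<^sup>+x. ennreal (exp (s * S x)) \<partial>M)"
    by (intro nn_integral_cong) auto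
  also have "ennreal (exp (- s * \<mu> - t / (2 * \<tau>))) * \<dots> \<le> ennreal (exp (- s * \<mu> - t / (2 * \<tau>))) * ennreal (exp (s * \<mu> + 1 / 2))"
    by (intro mult_left_mono mgf) simp
  also have "\<dots> = ennreal (exp (1 / 2) * exp (- t / (2 * \<tau>)))"
    by (simp add: ennreal_mult[symmetric] exp_add[symmetric] algebra_simps del: times_divide_eq_left times_divide_eq_right)
  also have "\<dots> \<le> ennreal (2 * exp (- t / (2 * \<tau>)))"
    using exp_bound_half[of "1/2 :: real"] by (intro ennreal_leI mult_right_mono) auto
  finally have le: "emeasure M A \<le> ennreal (2 * exp (- t / (2 * \<tau>)))" .
  have "\<sigma> * (S x - \<mu>) \<le> t" if "x \<in> space M - A" for x
  proof -
    have "\<not> 1 \<le> ennreal (exp (- s * \<mu> - t / (2 * \<tau>)) * exp (s * S x))"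
      using that by (simp add: A_def ennreal_mult)
    then have "exp (- s * \<mu> - t / (2 * \<tau>) + s * S x) < 1"
      by (simp add: exp_add[symmetric] ennreal_ge_1)
    then have "s * (S x - \<mu>) < t / (2 * \<tau>)" by (simp add: algebra_simps)
    then have "\<sigma> * (S x - \<mu>) / (2 * \<tau>) < t / (2 * \<tau>)" by (simp add: s_def)
    then show ?thesis using tau(1) by (simp only: divide_less_cancel) auto
  qed
  moreover have "measure M A \<le> 2 * exp (- t / (2 * \<tau>))"
    using le by (simp add: emeasure_eq_measure)
  ultimately show ?thesis
    unfolding whp_def S_def \<mu>_def using A by blast
qed

definition tail :: "real \<Rightarrow> real \<Rightarrow> real" where
  "tail \<tau> t = 4 * exp (- t / (2 * \<tau>))"

lemma tail_nonneg: "0 \<le> tail \<tau> t"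
  by (simp add: tail_def)

lemma exp_vars_concentration:
  assumes X: "exp_vars M F X r" and F: "finite F" and tau: "0 < \<tau>" "(\<Sum>k\<in>F. 1 / (r k)\<^sup>2) \<le> \<tau>\<^sup>2"
  shows "whp M (tail \<tau> t) (\<lambda>x. \<bar>(\<Sum>k\<in>F. X k x) - (\<Sum>k\<in>F. 1 / r k)\<bar> \<le> t)"
proof -
  have "prob_space M" using X by (simp add: exp_vars_def)
  from whp_conj[OF this exp_vars_chernoff[OF X F tau, of 1 t] exp_vars_chernoff[OF X F tau, of "-1" t]]
  show ?thesis by (rule whp_mono) (auto simp: tail_def abs_le_iff)
qed

section \<open>The stationary model\<close>
definition inv_sum :: "(nat \<Rightarrow> real) \<Rightarrow> real \<Rightarrow> nat \<Rightarrow> real" where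
  "inv_sum a z k = (\<Sum>i=1..k. 1 / (a i + z))"

definition inv_sq_sum :: "(nat \<Rightarrow> real) \<Rightarrow> real \<Rightarrow> nat \<Rightarrow> real" where
  "inv_sq_sum a z k = (\<Sum>i=1..k. 1 / (a i + z)\<^sup>2)"

text \<open>
  The function whose infimum is the centering.  Using \<open>- z\<close> in the second sum makes every statement
  symmetric under exchanging \<open>(a, m, z)\<close> with \<open>(b, n, - z)\<close>.
\<close>
definition centering :: "(nat \<Rightarrow> real) \<Rightarrow> (nat \<Rightarrow> real) \<Rightarrow> nat \<Rightarrow> nat \<Rightarrow> real \<Rightarrow> real" where
  "centering a b m n z = inv_sum a z m + inv_sum b (- z) n"

text \<open>
  The parameter \<open>z\<close> lies in the interval on which all boundary rates are positive, and the boundary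
  sums fluctuate on the scale \<open>\<tau>\<close>.
\<close>
definition admissible :: "(nat \<Rightarrow> real) \<Rightarrow> (nat \<Rightarrow> real) \<Rightarrow> nat \<Rightarrow> nat \<Rightarrow> real \<Rightarrow> real \<Rightarrow> bool" where
  "admissible a b m n \<tau> z \<longleftrightarrow> 0 < \<tau> \<and> (\<forall>i\<in>{1..m}. 0 < a i + z) \<and> (\<forall>j\<in>{1..n}. 0 < b j - z) \<and>
     inv_sq_sum a z m \<le> \<tau>\<^sup>2 \<and> inv_sq_sum b (- z) n \<le> \<tau>\<^sup>2"

lemma centering_swap: "centering b a n m (- z) = centering a b m n z"
  by (simp add: centering_def)

lemma admissible_swap: "admissible b a n m \<tau> (- z) \<longleftrightarrow> admissible a b m n \<tau> z"
  by (auto simp: admissible_def)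

text \<open>
  The value 1 at the origin and outside the rectangle is arbitrary; it makes all rates positive.
\<close>
definition boundary_rate :: "nat \<Rightarrow> nat \<Rightarrow> (nat \<Rightarrow> real) \<Rightarrow> (nat \<Rightarrow> real) \<Rightarrow> real \<Rightarrow> nat \<times> nat \<Rightarrow> real" where
  "boundary_rate m n a b z = (\<lambda>(i, j).
     if i \<in> {1..m} \<and> j \<in> {1..n} then a i + b j
     else if i \<in> {1..m} \<and> j = 0 then a i + z
     else if i = 0 \<and> j \<in> {1..n} then b j - z else 1)"

definition stationary :: "nat \<Rightarrow> nat \<Rightarrow> (nat \<Rightarrow> real) \<Rightarrow> (nat \<Rightarrow> real) \<Rightarrow> real \<Rightarrow> (nat \<times> nat \<Rightarrow> real) measure" where
  "stationary m n a b z = expo ({0..m} \<times> {0..n}) (boundary_rate m n a b z)"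

lemma boundary_rate_pos:
  assumes "admissible a b m n \<tau> z"
  shows "0 < boundary_rate m n a b z p"
proof -
  have a: "0 < a i + z" if "i \<in> {1..m}" for i using assms that by (simp add: admissible_def)
  have b: "0 < b j - z" if "j \<in> {1..n}" for j using assms that by (simp add: admissible_def)
  have "0 < a i + b j" if "i \<in> {1..m}" "j \<in> {1..n}" for i j
    using a[OF that(1)] b[OF that(2)] by linarith
  with a b show ?thesis by (cases p) (auto simp: boundary_rate_def)
qed

lemma exp_vars_stationary:
  assumes "admissible a b m n \<tau> z"
  shows "exp_vars (stationary m n a b z) ({0..m} \<times> {0..n}) (\<lambda>p x. x p) (boundary_rate m n a b z)"
  unfolding stationary_def by (intro exp_vars_expo boundary_rate_pos[OF assms]) auto

lemma exp_vars_stationary_bulk: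
  assumes "admissible a b m n \<tau> z"
  shows "exp_vars (stationary m n a b z) ({1..m} \<times> {1..n}) (\<lambda>p x. x p) (\<lambda>(i, j). a i + b j)"
proof -
  have "exp_vars (stationary m n a b z) ({1..m} \<times> {1..n}) (\<lambda>p x. x p) (boundary_rate m n a b z)"
    by (rule exp_vars_subset[OF exp_vars_stationary[OF assms]]) auto
  then show ?thesis
    by (subst exp_vars_cong) (auto simp: boundary_rate_def)
qed

lemma inv_sq_sum_mono:
  assumes "k \<le> m" shows "inv_sq_sum a z k \<le> inv_sq_sum a z m"
  unfolding inv_sq_sum_def using assms by (intro sum_mono2) auto

lemma exp_vars_stationary_row:
  assumes "admissible a b m n \<tau> z"
  shows "exp_vars (stationary m n a b z) {1..m} (\<lambda>i x. x (i, 0)) (\<lambda>i. a i + z)"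
proof -
  have "exp_vars (stationary m n a b z) {1..m} (\<lambda>i x. x (i, 0)) (\<lambda>i. boundary_rate m n a b z (i, 0))"
    by (rule exp_vars_reindex[OF exp_vars_stationary[OF assms]]) (auto intro: inj_onI)
  then show ?thesis
    by (subst exp_vars_cong) (auto simp: boundary_rate_def)
qed

lemma exp_vars_stationary_column:
  assumes "admissible a b m n \<tau> z"
  shows "exp_vars (stationary m n a b z) {1..n} (\<lambda>j x. x (0, j)) (\<lambda>j. b j + - z)"
proof -
  have "exp_vars (stationary m n a b z) {1..n} (\<lambda>j x. x (0, j)) (\<lambda>j. boundary_rate m n a b z (0, j))"
    by (rule exp_vars_reindex[OF exp_vars_stationary[OF assms]]) (auto intro: inj_onI)
  then show ?thesis
    by (subst exp_vars_cong) (auto simp: boundary_rate_def)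
qed

lemma exp_vars_partial_sum:
  assumes X: "exp_vars M {1..m} X (\<lambda>i. a i + z)" and "0 < \<tau>" "inv_sq_sum a z m \<le> \<tau>\<^sup>2" "k \<le> m"
  shows "whp M (tail \<tau> t) (\<lambda>x. \<bar>(\<Sum>i=1..k. X i x) - inv_sum a z k\<bar> \<le> t)"
proof -
  have "whp M (tail \<tau> t) (\<lambda>x. \<bar>(\<Sum>i\<in>{1..k}. X i x) - (\<Sum>i\<in>{1..k}. 1 / (a i + z))\<bar> \<le> t)"
    using assms inv_sq_sum_mono[OF \<open>k \<le> m\<close>, of a z]
    by (intro exp_vars_concentration exp_vars_subset[OF X]) (auto simp: inv_sq_sum_def)
  then show ?thesis by (simp add: inv_sum_def)
qed

lemma stationary_row_concentration:
  assumes "admissible a b m n \<tau> z" "k \<le> m"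
  shows "whp (stationary m n a b z) (tail \<tau> t) (\<lambda>x. \<bar>boundary_lpp x k 0 - inv_sum a z k\<bar> \<le> t)"
  using exp_vars_partial_sum[OF exp_vars_stationary_row[OF assms(1)], of \<tau> k t] assms
  by (simp add: boundary_lpp_row admissible_def)

lemma stationary_column_concentration:
  assumes "admissible a b m n \<tau> z" "l \<le> n"
  shows "whp (stationary m n a b z) (tail \<tau> t) (\<lambda>x. \<bar>boundary_lpp x 0 l - inv_sum b (- z) l\<bar> \<le> t)"
  using exp_vars_partial_sum[OF exp_vars_stationary_column[OF assms(1)], of \<tau> l t] assms
  by (simp add: boundary_lpp_column admissible_def)

lemma prob_space_stationary:
  "admissible a b m n \<tau> z \<Longrightarrow> prob_space (stationary m n a b z)"
  using exp_vars_stationary by (simp add: exp_vars_def)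

text \<open>
  The corner value is the sum over row 0 plus the sum of the vertical increments in the last column.
  The two sums are not independent of each other, but each is a sum of independent exponential
  variables, the second one by Burke's theorem, and a union bound suffices.
\<close>
lemma stationary_corner_concentration:
  assumes adm: "admissible a b m n \<tau> z"
  shows "whp (stationary m n a b z) (2 * tail \<tau> t) (\<lambda>x. \<bar>boundary_lpp x m n - centering a b m n z\<bar> \<le> 2 * t)"
proof -
  let ?P = "stationary m n a b z"
  have T: "burke_columns n m \<in> ?P \<rightarrow>\<^sub>M ?P" "distr ?P ?P (burke_columns n m) = ?P"
    using burke_columns_preserves[of "boundary_rate m n a b z" m n m] boundary_rate_pos[OF adm]
    unfolding stationary_def by (auto simp: boundary_rate_def)
  have incr: "(\<Sum>j=1..l. burke_columns n m x (0, j)) = boundary_lpp x m l - boundary_lpp x m 0" if "l \<le> n" for x l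
    using that
  proof (induction l)
    case (Suc l)
    have "burke_columns n m x (0, Suc l) = boundary_lpp x m (Suc l) - boundary_lpp x m l"
      using Suc.prems burke_columns_increments[of n m x] by (auto dest!: spec[of _ "Suc l"])
    then show ?case using Suc by simp
  qed simp
  have "whp ?P (tail \<tau> t) (\<lambda>x. \<bar>boundary_lpp (burke_columns n m x) 0 n - inv_sum b (- z) n\<bar> \<le> t)"
    using T by (intro whp_preserving[OF stationary_column_concentration[OF adm]]) auto
  then have "whp ?P (tail \<tau> t) (\<lambda>x. \<bar>boundary_lpp x m n - boundary_lpp x m 0 - inv_sum b (- z) n\<bar> \<le> t)"
    by (simp only: boundary_lpp_column incr[OF order_refl])
  from whp_conj[OF prob_space_stationary[OF adm] stationary_row_concentration[OF adm order_refl, of t] this]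
  show ?thesis
    by (rule whp_mono) (auto simp: centering_def)
qed

lemma weight_measurable:
  assumes "set \<pi> \<subseteq> F"
  shows "(\<lambda>y. weight y \<pi>) \<in> borel_measurable (\<Pi>\<^sub>M k\<in>F. borel)"
  using assms by (induction \<pi>) auto

lemma weight_restrict:
  assumes "set \<pi> \<subseteq> F"
  shows "weight (\<lambda>k\<in>F. y k) \<pi> = weight y \<pi>"
  using assms by (induction \<pi>) auto

text \<open>
  In the stationary model with parameter \<open>w\<close>, row 0 up to column \<open>k\<close> followed by the path competes
  for the corner value, and row 0 contributes about \<open>inv_sum a w k\<close>.  The conclusion does not mention
  the boundary weights and so holds for the given weights.
\<close>
lemma path_upper_bound:
  assumes X: "exp_vars M ({1..m} \<times> {1..n}) X (\<lambda>(i, j). a i + b j)" and mn: "m \<ge> 1" "n \<ge> 1"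
    and adm: "admissible a b m n \<tau> w"
  shows "whp M ((real m + 2) * tail \<tau> t) (\<lambda>x. \<forall>k\<in>{1..m}. \<forall>\<pi>\<in>lattice_paths (k, 1) (m, n).
      inv_sum a w k + weight (\<lambda>p. X p x) \<pi> \<le> centering a b m n w + 3 * t)"
proof (rule whp_transfer[where F = "{1..m} \<times> {1..n}" and M' = "stationary m n a b w" and X' = "\<lambda>p x. x p"
      and Q = "\<lambda>y. \<forall>k\<in>{1..m}. \<forall>\<pi>\<in>lattice_paths (k, 1) (m, n). inv_sum a w k + weight y \<pi> \<le> centering a b m n w + 3 * t"])
  let ?F = "{1..m} \<times> {1..n}"
  let ?P = "stationary m n a b w"
  show "exp_vars M ?F X (\<lambda>(i, j). a i + b j)" by (rule X)
  show "exp_vars ?P ?F (\<lambda>p x. x p) (\<lambda>(i, j). a i + b j)"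
    by (rule exp_vars_stationary_bulk[OF adm])
  show "?F \<noteq> {}" using mn by auto
  have sub: "set \<pi> \<subseteq> ?F" if "\<pi> \<in> lattice_paths (k, 1) (m, n)" "k \<in> {1..m}" for \<pi> k
    using lattice_paths_subset[OF that(1)] that(2) by force
  have "{y \<in> space (\<Pi>\<^sub>M k\<in>?F. borel). \<not> (\<forall>k\<in>{1..m}. \<forall>\<pi>\<in>lattice_paths (k, 1) (m, n). inv_sum a w k + weight y \<pi> \<le> centering a b m n w + 3 * t)}
      = (\<Union>k\<in>{1..m}. \<Union>\<pi>\<in>lattice_paths (k, 1) (m, n). {y \<in> space (\<Pi>\<^sub>M k\<in>?F. borel). \<not> inv_sum a w k + weight y \<pi> \<le> centering a b m n w + 3 * t})"
    by auto
  also have "\<dots> \<in> sets (\<Pi>\<^sub>M k\<in>?F. borel)"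
  proof (intro sets.finite_UN finite_atLeastAtMost finite_lattice_paths)
    fix k \<pi> assume "k \<in> {1..m}" "\<pi> \<in> lattice_paths (k, 1) (m, n)"
    note [measurable] = weight_measurable[OF sub[OF this(2,1)]]
    show "{y \<in> space (\<Pi>\<^sub>M k\<in>?F. borel). \<not> inv_sum a w k + weight y \<pi> \<le> centering a b m n w + 3 * t} \<in> sets (\<Pi>\<^sub>M k\<in>?F. borel)"
      by measurable
  qed
  finally show "{y \<in> space (\<Pi>\<^sub>M k\<in>?F. borel). \<not> (\<forall>k\<in>{1..m}. \<forall>\<pi>\<in>lattice_paths (k, 1) (m, n). inv_sum a w k + weight y \<pi> \<le> centering a b m n w + 3 * t)}
      \<in> sets (\<Pi>\<^sub>M k\<in>?F. borel)" .
  show "(\<forall>k\<in>{1..m}. \<forall>\<pi>\<in>lattice_paths (k, 1) (m, n). inv_sum a w k + weight (restrict y ?F) \<pi> \<le> centering a b m n w + 3 * t) \<longleftrightarrow>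
     (\<forall>k\<in>{1..m}. \<forall>\<pi>\<in>lattice_paths (k, 1) (m, n). inv_sum a w k + weight y \<pi> \<le> centering a b m n w + 3 * t)" for y
    by (intro ball_cong refl) (simp only: weight_restrict[OF sub])
  have "whp ?P (card {1..m} * tail \<tau> t) (\<lambda>x. \<forall>k\<in>{1..m}. \<bar>boundary_lpp x k 0 - inv_sum a w k\<bar> \<le> t)"
    by (intro whp_ball prob_space_stationary[OF adm] stationary_row_concentration[OF adm]) auto
  from whp_conj[OF prob_space_stationary[OF adm] this stationary_corner_concentration[OF adm, of t]]
  show "whp ?P ((real m + 2) * tail \<tau> t) (\<lambda>x. \<forall>k\<in>{1..m}. \<forall>\<pi>\<in>lattice_paths (k, 1) (m, n). inv_sum a w k + weight (\<lambda>k. x k) \<pi> \<le> centering a b m n w + 3 * t)"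
  proof (rule whp_mono)
    fix x assume x: "(\<forall>k\<in>{1..m}. \<bar>boundary_lpp x k 0 - inv_sum a w k\<bar> \<le> t) \<and> \<bar>boundary_lpp x m n - centering a b m n w\<bar> \<le> 2 * t"
    show "\<forall>k\<in>{1..m}. \<forall>\<pi>\<in>lattice_paths (k, 1) (m, n). inv_sum a w k + weight (\<lambda>k. x k) \<pi> \<le> centering a b m n w + 3 * t"
    proof (intro ballI)
      fix k \<pi> assume k: "k \<in> {1..m}" "\<pi> \<in> lattice_paths (k, 1) (m, n)"
      then have "boundary_lpp x k 0 + weight x \<pi> \<le> boundary_lpp x m n"
        using boundary_lpp_path_le[OF k(2), of x] by simp
      with x k(1) show "inv_sum a w k + weight (\<lambda>k. x k) \<pi> \<le> centering a b m n w + 3 * t"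
        by (auto simp: abs_le_iff dest!: bspec)
    qed
  qed (simp add: algebra_simps)
qed

text \<open>
  Here \<open>y k\<close> is the weight of row 0 up to column \<open>k\<close>.  Whenever a route through row 0 reaches the
  level \<open>c\<close>, some path that avoids the boundary reaches the slightly lower level \<open>d\<close>.
\<close>
definition cheap_exits :: "nat \<Rightarrow> nat \<Rightarrow> real \<Rightarrow> real \<Rightarrow> (nat \<times> nat \<Rightarrow> real) \<Rightarrow> (nat \<Rightarrow> real) \<Rightarrow> bool" where
  "cheap_exits m n c d x y \<longleftrightarrow>
     (\<forall>k\<in>{1..m}. \<forall>\<pi>\<in>lattice_paths (k, 1) (m, n). c \<le> y k + weight x \<pi> \<longrightarrow>
        (\<exists>\<pi>'\<in>lattice_paths (1, 1) (m, n). d \<le> weight x \<pi>'))"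

text \<open>
  If \<open>A k \<le> e\<close>, dropping the boundary part of the route loses at most \<open>e\<close> up to fluctuations; the
  missing sites of row 1 only add weight.  If \<open>A k > e\<close>, the upper bound at the parameter \<open>w\<close> shows
  that the route does not reach the level \<open>c\<close> at all.
\<close>
lemma cheap_exits_gap:
  assumes X: "exp_vars M ({1..m} \<times> {1..n}) X (\<lambda>(i, j). a i + b j)" and mn: "m \<ge> 1" "n \<ge> 1"
    and adm: "admissible a b m n \<tau> w"
    and Y: "\<And>k. k \<in> {1..m} \<Longrightarrow> whp M (tail \<tau> t) (\<lambda>x. \<bar>Y k x - A k\<bar> \<le> t)"
    and gap: "\<And>k. k \<in> {1..m} \<Longrightarrow> A k > e \<Longrightarrow> A k - inv_sum a w k + centering a b m n w + 4 * t < c"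
    and t: "0 \<le> t"
  shows "whp M ((2 * real m + 2) * tail \<tau> t) (\<lambda>x. cheap_exits m n c (c - 2 * t - e) (\<lambda>p. X p x) (\<lambda>k. Y k x))"
proof -
  have M: "prob_space M" using X by (simp add: exp_vars_def)
  have nonneg: "whp M 0 (\<lambda>x. \<forall>p\<in>{1..m} \<times> {1..n}. 0 \<le> X p x)"
    by (intro whp_AE) (simp add: AE_ball_countable exp_vars_nonneg[OF X])
  have "whp M (card {1..m} * tail \<tau> t) (\<lambda>x. \<forall>k\<in>{1..m}. \<bar>Y k x - A k\<bar> \<le> t)"
    by (intro whp_ball M Y) auto
  from whp_conj[OF M nonneg whp_conj[OF M this path_upper_bound[OF X mn adm, of t]]]
  show ?thesis
  proof (rule whp_mono)
    fix x
    assume "(\<forall>p\<in>{1..m} \<times> {1..n}. 0 \<le> X p x) \<and> (\<forall>k\<in>{1..m}. \<bar>Y k x - A k\<bar> \<le> t) \<and>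
      (\<forall>k\<in>{1..m}. \<forall>\<pi>\<in>lattice_paths (k, 1) (m, n).
         inv_sum a w k + weight (\<lambda>p. X p x) \<pi> \<le> centering a b m n w + 3 * t)"
    then have x: "\<And>p. p \<in> {1..m} \<times> {1..n} \<Longrightarrow> 0 \<le> X p x" "\<And>k. k \<in> {1..m} \<Longrightarrow> \<bar>Y k x - A k\<bar> \<le> t"
      "\<And>k \<pi>. k \<in> {1..m} \<Longrightarrow> \<pi> \<in> lattice_paths (k, 1) (m, n) \<Longrightarrow>
         inv_sum a w k + weight (\<lambda>p. X p x) \<pi> \<le> centering a b m n w + 3 * t"
      by blast+
    show "cheap_exits m n c (c - 2 * t - e) (\<lambda>p. X p x) (\<lambda>k. Y k x)"
      unfolding cheap_exits_def
    proof (intro ballI impI)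
      fix k \<pi> assume k: "k \<in> {1..m}" and \<pi>: "\<pi> \<in> lattice_paths (k, 1) (m, n)"
        and c: "c \<le> Y k x + weight (\<lambda>p. X p x) \<pi>"
      have "A k \<le> e"
      proof (rule ccontr)
        assume "\<not> A k \<le> e"
        with gap[OF k] x(2)[OF k] x(3)[OF k \<pi>] c show False by (simp add: abs_le_iff)
      qed
      moreover obtain \<pi>' where "\<pi>' \<in> lattice_paths (1, 1) (m, n)"
         "weight (\<lambda>p. X p x) \<pi>' = (\<Sum>i=1..<k. X (i, 1) x) + weight (\<lambda>p. X p x) \<pi>"
        using row_path_extend[OF _ \<pi>, of "\<lambda>p. X p x"] k by auto
      moreover have "0 \<le> (\<Sum>i=1..<k. X (i, 1) x)"
        using k mn by (intro sum_nonneg x) auto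
      ultimately show "\<exists>\<pi>'\<in>lattice_paths (1, 1) (m, n). c - 2 * t - e \<le> weight (\<lambda>p. X p x) \<pi>'"
        using x(2)[OF k] c t by (intro bexI[of _ \<pi>']) (auto simp: abs_le_iff)
    qed
  qed (simp add: algebra_simps)
qed

text \<open>
  The initial segment of row 1 is a substitute for the boundary part of the route, at total cost at
  most \<open>e\<close> in the mean.  The site \<open>(k, 1)\<close> belongs to the path already, hence the sum up to \<open>k - 1\<close>.
\<close>
lemma cheap_exits_row:
  assumes X: "exp_vars M ({1..m} \<times> {1..n}) X (\<lambda>(i, j). a i + b j)" and mn: "m \<ge> 1" "n \<ge> 1"
    and tau: "0 < \<tau>" "inv_sq_sum a (b 1) m \<le> \<tau>\<^sup>2"
    and Y: "\<And>k. k \<in> {1..m} \<Longrightarrow> whp M (tail \<tau> t) (\<lambda>x. \<bar>Y k x - A k\<bar> \<le> t)"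
    and cost: "\<And>k. k \<in> {1..m} \<Longrightarrow> A k \<le> inv_sum a (b 1) (k - 1) + e"
  shows "whp M (2 * real m * tail \<tau> t) (\<lambda>x. cheap_exits m n c (c - 2 * t - e) (\<lambda>p. X p x) (\<lambda>k. Y k x))"
proof -
  have M: "prob_space M" using X by (simp add: exp_vars_def)
  have row: "exp_vars M {1..m} (\<lambda>i. X (i, 1)) (\<lambda>i. a i + b 1)"
  proof -
    have "exp_vars M {1..m} (\<lambda>i. X (i, 1)) (\<lambda>i. case (i, 1) of (i, j) \<Rightarrow> a i + b j)"
      using mn by (intro exp_vars_reindex[OF X]) (auto simp: inj_on_def)
    then show ?thesis by simp
  qed
  have "whp M (card {1..m} * tail \<tau> t) (\<lambda>x. \<forall>k\<in>{1..m}. \<bar>Y k x - A k\<bar> \<le> t)"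
    by (intro whp_ball M Y) auto
  moreover have "whp M (card {1..m} * tail \<tau> t)
      (\<lambda>x. \<forall>k\<in>{1..m}. \<bar>(\<Sum>i=1..k-1. X (i, 1) x) - inv_sum a (b 1) (k - 1)\<bar> \<le> t)"
    by (intro whp_ball M exp_vars_partial_sum[OF row tau]) auto
  ultimately have "whp M (card {1..m} * tail \<tau> t + card {1..m} * tail \<tau> t)
      (\<lambda>x. (\<forall>k\<in>{1..m}. \<bar>Y k x - A k\<bar> \<le> t) \<and> (\<forall>k\<in>{1..m}. \<bar>(\<Sum>i=1..k-1. X (i, 1) x) - inv_sum a (b 1) (k - 1)\<bar> \<le> t))"
    by (rule whp_conj[OF M])
  then show ?thesis
  proof (rule whp_mono)
    fix x
    assume x: "(\<forall>k\<in>{1..m}. \<bar>Y k x - A k\<bar> \<le> t) \<and> (\<forall>k\<in>{1..m}. \<bar>(\<Sum>i=1..k-1. X (i, 1) x) - inv_sum a (b 1) (k - 1)\<bar> \<le> t)"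
    show "cheap_exits m n c (c - 2 * t - e) (\<lambda>p. X p x) (\<lambda>k. Y k x)"
      unfolding cheap_exits_def
    proof (intro ballI impI)
      fix k \<pi> assume k: "k \<in> {1..m}" and \<pi>: "\<pi> \<in> lattice_paths (k, 1) (m, n)"
        and c: "c \<le> Y k x + weight (\<lambda>p. X p x) \<pi>"
      obtain \<pi>' where \<pi>': "\<pi>' \<in> lattice_paths (1, 1) (m, n)"
         "weight (\<lambda>p. X p x) \<pi>' = (\<Sum>i=1..<k. X (i, 1) x) + weight (\<lambda>p. X p x) \<pi>"
        using row_path_extend[OF _ \<pi>, of "\<lambda>p. X p x"] k by auto
      have "{1..<k} = {1..k-1}" using k by auto
      with \<pi>' x k c cost[OF k] show "\<exists>\<pi>'\<in>lattice_paths (1, 1) (m, n). c - 2 * t - e \<le> weight (\<lambda>p. X p x) \<pi>'"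
        by (intro bexI[of _ \<pi>']) (auto simp: abs_le_iff dest!: bspec[of _ _ k])
    qed
  qed (simp add: algebra_simps)
qed

lemma exp_vars_swap:
  assumes X: "exp_vars M ({1..m} \<times> {1..n}) X (\<lambda>(i, j). a i + b j)"
  shows "exp_vars M ({1..n} \<times> {1..m}) (\<lambda>p. X (prod.swap p)) (\<lambda>(i, j). b i + a j)"
proof -
  have "exp_vars M ({1..n} \<times> {1..m}) (\<lambda>p. X (prod.swap p)) (\<lambda>p. case prod.swap p of (i, j) \<Rightarrow> a i + b j)"
    by (rule exp_vars_reindex[OF X]) auto
  then show ?thesis by (subst exp_vars_cong) (auto simp: add.commute)
qed

text \<open>
  The optimal route to the corner has weight about \<open>centering a b m n z\<close> and leaves the boundary
  through row 0 or through column 0.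
\<close>
lemma path_lower_bound_of_cheap_exits:
  assumes X: "exp_vars M ({1..m} \<times> {1..n}) X (\<lambda>(i, j). a i + b j)" and mn: "m \<ge> 1" "n \<ge> 1"
    and adm: "admissible a b m n \<tau> z"
    and h: "whp (stationary m n a b z) p (\<lambda>x. cheap_exits m n (centering a b m n z - 2 * t) d x (\<lambda>k. boundary_lpp x k 0))"
    and v: "whp (stationary m n a b z) q (\<lambda>x. cheap_exits n m (centering a b m n z - 2 * t) d (\<lambda>p. x (prod.swap p)) (\<lambda>l. boundary_lpp x 0 l))"
  shows "whp M (2 * tail \<tau> t + p + q) (\<lambda>x. \<exists>\<pi>\<in>lattice_paths (1, 1) (m, n). d \<le> weight (\<lambda>p. X p x) \<pi>)"
proof (rule whp_transfer[where F = "{1..m} \<times> {1..n}" and M' = "stationary m n a b z" and X' = "\<lambda>p x. x p"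
      and Q = "\<lambda>y. \<exists>\<pi>\<in>lattice_paths (1, 1) (m, n). d \<le> weight y \<pi>"])
  let ?F = "{1..m} \<times> {1..n}"
  let ?P = "stationary m n a b z"
  show "exp_vars M ?F X (\<lambda>(i, j). a i + b j)" by (rule X)
  show "exp_vars ?P ?F (\<lambda>p x. x p) (\<lambda>(i, j). a i + b j)"
    by (rule exp_vars_stationary_bulk[OF adm])
  show "?F \<noteq> {}" using mn by auto
  have sub: "set \<pi> \<subseteq> ?F" if "\<pi> \<in> lattice_paths (1, 1) (m, n)" for \<pi>
    using lattice_paths_subset[OF that] by force
  have [measurable]: "{y \<in> space (\<Pi>\<^sub>M k\<in>?F. borel). d \<le> weight y \<pi>} \<in> sets (\<Pi>\<^sub>M k\<in>?F. borel)"
    if "\<pi> \<in> lattice_paths (1, 1) (m, n)" for \<pi>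
    using weight_measurable[OF sub[OF that]] by measurable
  have "{y \<in> space (\<Pi>\<^sub>M k\<in>?F. borel). \<not> (\<exists>\<pi>\<in>lattice_paths (1, 1) (m, n). d \<le> weight y \<pi>)}
      = space (\<Pi>\<^sub>M k\<in>?F. borel) - (\<Union>\<pi>\<in>lattice_paths (1, 1) (m, n). {y \<in> space (\<Pi>\<^sub>M k\<in>?F. borel). d \<le> weight y \<pi>})"
    by auto
  also have "\<dots> \<in> sets (\<Pi>\<^sub>M k\<in>?F. borel)"
    by (intro sets.Diff sets.top sets.finite_UN finite_lattice_paths) measurable
  finally show "{y \<in> space (\<Pi>\<^sub>M k\<in>?F. borel). \<not> (\<exists>\<pi>\<in>lattice_paths (1, 1) (m, n). d \<le> weight y \<pi>)}
      \<in> sets (\<Pi>\<^sub>M k\<in>?F. borel)" .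
  show "(\<exists>\<pi>\<in>lattice_paths (1, 1) (m, n). d \<le> weight (restrict y ?F) \<pi>) \<longleftrightarrow>
     (\<exists>\<pi>\<in>lattice_paths (1, 1) (m, n). d \<le> weight y \<pi>)" for y
    by (intro bex_cong refl) (simp only: weight_restrict[OF sub])
  have P: "prob_space ?P" by (rule prob_space_stationary[OF adm])
  from whp_conj[OF P whp_conj[OF P stationary_corner_concentration[OF adm, of t] h] v]
  show "whp ?P (2 * tail \<tau> t + p + q) (\<lambda>x. \<exists>\<pi>\<in>lattice_paths (1, 1) (m, n). d \<le> weight (\<lambda>k. x k) \<pi>)"
  proof (rule whp_mono)
    let ?c = "centering a b m n z - 2 * t"
    fix x
    assume x: "(\<bar>boundary_lpp x m n - centering a b m n z\<bar> \<le> 2 * t \<and>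
       cheap_exits m n ?c d x (\<lambda>k. boundary_lpp x k 0)) \<and>
       cheap_exits n m ?c d (\<lambda>p. x (prod.swap p)) (\<lambda>l. boundary_lpp x 0 l)"
    then have c: "?c \<le> boundary_lpp x m n" by (auto simp: abs_le_iff)
    from boundary_lpp_exit[OF mn, of x]
    show "\<exists>\<pi>\<in>lattice_paths (1, 1) (m, n). d \<le> weight (\<lambda>k. x k) \<pi>"
    proof (elim disjE bexE)
      fix k \<pi> assume "k \<in> {1..m}" "\<pi> \<in> lattice_paths (k, 1) (m, n)"
        "boundary_lpp x m n = boundary_lpp x k 0 + weight x \<pi>"
      with x c show ?thesis by (auto simp: cheap_exits_def)
    next
      fix l \<pi> assume l: "l \<in> {1..n}" "\<pi> \<in> lattice_paths (1, l) (m, n)"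
        "boundary_lpp x m n = boundary_lpp x 0 l + weight x \<pi>"
      have "map prod.swap \<pi> \<in> lattice_paths (l, 1) (n, m)"
        using lattice_paths_swap[OF l(2)] by simp
      moreover have "weight (\<lambda>p. x (prod.swap p)) (map prod.swap \<pi>) = weight x \<pi>"
        by (simp add: comp_def)
      ultimately obtain \<pi>' where "\<pi>' \<in> lattice_paths (1, 1) (n, m)" "d \<le> weight (\<lambda>p. x (prod.swap p)) \<pi>'"
        using x c l unfolding cheap_exits_def by metis
      then show ?thesis
        using lattice_paths_swap[of \<pi>' "(1, 1)" "(n, m)"]
        by (intro bexI[of _ "map prod.swap \<pi>'"]) (auto simp: comp_def)
    qed
  qed simp
qed

text \<open>
  Exits from both boundaries are excluded by a gap: \<open>w\<close> serves for row 0 and \<open>w'\<close> for column 0.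
\<close>
lemma path_lower_bound_gaps:
  assumes X: "exp_vars M ({1..m} \<times> {1..n}) X (\<lambda>(i, j). a i + b j)" and mn: "m \<ge> 1" "n \<ge> 1"
    and adm: "admissible a b m n \<tau> z" "admissible a b m n \<tau> w" "admissible a b m n \<tau> w'"
    and gap: "\<And>k. k \<in> {1..m} \<Longrightarrow> inv_sum a z k > e \<Longrightarrow>
        inv_sum a z k - inv_sum a w k + centering a b m n w + 6 * t < centering a b m n z"
    and gap': "\<And>l. l \<in> {1..n} \<Longrightarrow> inv_sum b (- z) l > e \<Longrightarrow>
        inv_sum b (- z) l - inv_sum b (- w') l + centering a b m n w' + 6 * t < centering a b m n z"
    and t: "0 \<le> t"
  shows "whp M (5 * (real m + real n) * tail \<tau> t)
     (\<lambda>x. \<exists>\<pi>\<in>lattice_paths (1, 1) (m, n). centering a b m n z - 4 * t - e \<le> weight (\<lambda>p. X p x) \<pi>)"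
proof -
  let ?c = "centering a b m n z - 2 * t" and ?P = "stationary m n a b z"
  have h: "whp ?P ((2 * real m + 2) * tail \<tau> t) (\<lambda>x. cheap_exits m n ?c (?c - 2 * t - e) x (\<lambda>k. boundary_lpp x k 0))"
    using gap t
    by (intro cheap_exits_gap[OF exp_vars_stationary_bulk[OF adm(1)] mn adm(2), where A = "inv_sum a z"]
          stationary_row_concentration[OF adm(1)]) force+
  have v: "whp ?P ((2 * real n + 2) * tail \<tau> t) (\<lambda>x. cheap_exits n m ?c (?c - 2 * t - e) (\<lambda>p. x (prod.swap p)) (\<lambda>l. boundary_lpp x 0 l))"
    using gap' t adm(3) mn
    by (intro cheap_exits_gap[OF exp_vars_swap[OF exp_vars_stationary_bulk[OF adm(1)]], where A = "inv_sum b (- z)" and w = "- w'"]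
          stationary_column_concentration[OF adm(1)])
       (force simp: admissible_swap centering_swap)+
  have "2 * tail \<tau> t + (2 * real m + 2) * tail \<tau> t + (2 * real n + 2) * tail \<tau> t = (2 * (real m + real n) + 6) * tail \<tau> t"
    by (simp add: algebra_simps)
  also have "\<dots> \<le> 5 * (real m + real n) * tail \<tau> t"
    using mn by (intro mult_right_mono tail_nonneg) auto
  finally show ?thesis
    using path_lower_bound_of_cheap_exits[OF X mn adm(1) h v] by (rule_tac whp_mono) auto
qed

text \<open>
  Exits from row 0 are imitated in row 1, and exits from column 0 are excluded by a gap.
\<close>
lemma path_lower_bound_row:
  assumes X: "exp_vars M ({1..m} \<times> {1..n}) X (\<lambda>(i, j). a i + b j)" and mn: "m \<ge> 1" "n \<ge> 1"
    and adm: "admissible a b m n \<tau> z" "admissible a b m n \<tau> w'"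
    and row: "inv_sq_sum a (b 1) m \<le> \<tau>\<^sup>2"
      "\<And>k. k \<in> {1..m} \<Longrightarrow> inv_sum a z k \<le> inv_sum a (b 1) (k - 1) + e"
    and gap': "\<And>l. l \<in> {1..n} \<Longrightarrow> inv_sum b (- z) l > e \<Longrightarrow>
        inv_sum b (- z) l - inv_sum b (- w') l + centering a b m n w' + 6 * t < centering a b m n z"
    and t: "0 \<le> t"
  shows "whp M (5 * (real m + real n) * tail \<tau> t)
     (\<lambda>x. \<exists>\<pi>\<in>lattice_paths (1, 1) (m, n). centering a b m n z - 4 * t - e \<le> weight (\<lambda>p. X p x) \<pi>)"
proof -
  let ?c = "centering a b m n z - 2 * t" and ?P = "stationary m n a b z"
  have h: "whp ?P (2 * real m * tail \<tau> t) (\<lambda>x. cheap_exits m n ?c (?c - 2 * t - e) x (\<lambda>k. boundary_lpp x k 0))"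
    using row adm(1)
    by (intro cheap_exits_row[OF exp_vars_stationary_bulk[OF adm(1)] mn, where A = "inv_sum a z"]
          stationary_row_concentration[OF adm(1)]) (auto simp: admissible_def)
  have v: "whp ?P ((2 * real n + 2) * tail \<tau> t) (\<lambda>x. cheap_exits n m ?c (?c - 2 * t - e) (\<lambda>p. x (prod.swap p)) (\<lambda>l. boundary_lpp x 0 l))"
    using gap' t adm(2) mn
    by (intro cheap_exits_gap[OF exp_vars_swap[OF exp_vars_stationary_bulk[OF adm(1)]], where A = "inv_sum b (- z)" and w = "- w'"]
          stationary_column_concentration[OF adm(1)])
       (force simp: admissible_swap centering_swap)+
  have "2 * tail \<tau> t + 2 * real m * tail \<tau> t + (2 * real n + 2) * tail \<tau> t = (2 * (real m + real n) + 4) * tail \<tau> t"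
    by (simp add: algebra_simps)
  also have "\<dots> \<le> 5 * (real m + real n) * tail \<tau> t"
    using mn by (intro mult_right_mono tail_nonneg) auto
  finally show ?thesis
    using path_lower_bound_of_cheap_exits[OF X mn adm(1) h v] by (rule_tac whp_mono) auto
qed

section \<open>The minimiser of the centering function\<close>
lemma inverse_tangent:
  fixes x y :: real
  assumes "0 < x" "0 < y"
  shows "1 / x - (y - x) / x\<^sup>2 \<le> 1 / y"
proof -
  have "1 / y - (1 / x - (y - x) / x\<^sup>2) = (y - x)\<^sup>2 / (x\<^sup>2 * y)"
    using assms by (simp add: field_simps power2_eq_square)
  also have "\<dots> \<ge> 0" using assms by simp
  finally show ?thesis by simp
qed

lemma inverse_taylor_upper:
  fixes x \<rho> h :: real
  assumes "0 < \<rho>" "\<rho> \<le> x" "\<rho> / 2 \<le> x + h"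
  shows "1 / (x + h) \<le> 1 / x - h / x\<^sup>2 + 2 * h\<^sup>2 / \<rho> * (1 / x\<^sup>2)"
proof -
  have "0 < x" "0 < x + h" using assms by auto
  then have "1 / (x + h) - (1 / x - h / x\<^sup>2) = h\<^sup>2 / x\<^sup>2 * (1 / (x + h))"
    by (simp add: field_simps power2_eq_square)
  also have "\<dots> \<le> h\<^sup>2 / x\<^sup>2 * (2 / \<rho>)"
    using assms by (intro mult_left_mono) (auto simp: field_simps)
  finally show ?thesis by (simp add: field_simps)
qed

lemma inv_sum_tangent:
  assumes "\<And>i. i \<in> {1..m} \<Longrightarrow> 0 < a i + z" "\<And>i. i \<in> {1..m} \<Longrightarrow> 0 < a i + w"
  shows "inv_sum a w m - (z - w) * inv_sq_sum a w m \<le> inv_sum a z m"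
proof -
  have "inv_sum a w m - (z - w) * inv_sq_sum a w m = (\<Sum>i=1..m. 1 / (a i + w) - ((a i + z) - (a i + w)) / (a i + w)\<^sup>2)"
    by (simp add: inv_sum_def inv_sq_sum_def sum_subtractf sum_distrib_left)
  also have "\<dots> \<le> inv_sum a z m"
    unfolding inv_sum_def using assms by (intro sum_mono inverse_tangent) auto
  finally show ?thesis .
qed

lemma inv_sum_taylor_upper:
  assumes "0 < \<rho>" "\<And>i. i \<in> {1..m} \<Longrightarrow> \<rho> \<le> a i + z" "- \<rho> / 2 \<le> h"
  shows "inv_sum a (z + h) m \<le> inv_sum a z m - h * inv_sq_sum a z m + 2 * h\<^sup>2 / \<rho> * inv_sq_sum a z m"
proof -
  have "inv_sum a (z + h) m \<le> (\<Sum>i=1..m. 1 / (a i + z) - h / (a i + z)\<^sup>2 + 2 * h\<^sup>2 / \<rho> * (1 / (a i + z)\<^sup>2))"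
    unfolding inv_sum_def
  proof (rule sum_mono)
    fix i assume i: "i \<in> {1..m}"
    have "\<rho> \<le> a i + z" using assms(2)[OF i] .
    then show "1 / (a i + (z + h)) \<le> 1 / (a i + z) - h / (a i + z)\<^sup>2 + 2 * h\<^sup>2 / \<rho> * (1 / (a i + z)\<^sup>2)"
      using inverse_taylor_upper[of \<rho> "a i + z" h] assms(1,3) by (simp add: add.assoc)
  qed
  also have "\<dots> = inv_sum a z m - h * inv_sq_sum a z m + 2 * h\<^sup>2 / \<rho> * inv_sq_sum a z m"
    by (simp add: inv_sum_def inv_sq_sum_def sum_subtractf sum.distrib sum_distrib_left)
  finally show ?thesis .
qed

lemma inv_sq_sum_nonneg: "0 \<le> inv_sq_sum a z m"
  unfolding inv_sq_sum_def by (intro sum_nonneg) simp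

lemma inv_sum_squared_le: "(inv_sum a z m)\<^sup>2 \<le> m * inv_sq_sum a z m"
  using sum_squared_le_sum_of_squares[of "\<lambda>i. 1 / (a i + z)" "{1..m}"]
  by (simp add: inv_sum_def inv_sq_sum_def power_divide mult.commute)

lemma inv_sq_sum_antimono:
  assumes "z \<le> w" "\<And>i. i \<in> {1..m} \<Longrightarrow> 0 < a i + z"
  shows "inv_sq_sum a w m \<le> inv_sq_sum a z m"
  unfolding inv_sq_sum_def
proof (rule sum_mono)
  fix i assume "i \<in> {1..m}"
  with assms(2) have "0 < a i + z" by blast
  then show "1 / (a i + w)\<^sup>2 \<le> 1 / (a i + z)\<^sup>2"
    using assms(1) by (intro divide_left_mono power_mono) auto
qed

lemma inv_sq_sum_le:
  assumes "0 < \<rho>" "\<And>i. i \<in> {1..m} \<Longrightarrow> \<rho> \<le> a i + z"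
  shows "inv_sq_sum a z m \<le> m / \<rho>\<^sup>2"
proof -
  have "inv_sq_sum a z m \<le> (\<Sum>i=1..m. 1 / \<rho>\<^sup>2)"
    unfolding inv_sq_sum_def
  proof (rule sum_mono)
    fix i assume "i \<in> {1..m}"
    with assms(2) have "\<rho> \<le> a i + z" by blast
    then show "1 / (a i + z)\<^sup>2 \<le> 1 / \<rho>\<^sup>2"
      using assms(1) by (intro divide_left_mono power_mono) auto
  qed
  then show ?thesis by simp
qed

lemma centering_tangent:
  assumes "\<And>i. i \<in> {1..m} \<Longrightarrow> 0 < a i + z" "\<And>i. i \<in> {1..m} \<Longrightarrow> 0 < a i + w"
    "\<And>j. j \<in> {1..n} \<Longrightarrow> 0 < b j - z" "\<And>j. j \<in> {1..n} \<Longrightarrow> 0 < b j - w"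
  shows "centering a b m n w + (z - w) * (inv_sq_sum b (- w) n - inv_sq_sum a w m) \<le> centering a b m n z"
  using inv_sum_tangent[of m a z w] inv_sum_tangent[of n b "- z" "- w"] assms
  by (simp add: centering_def algebra_simps)

text \<open>
  By the Cauchy--Schwarz inequality, a boundary segment of mean weight more than \<open>e\<close> has sum of squares
  at least \<open>e\<^sup>2 / N\<close>.  By convexity of \<open>inv_sum\<close>, moving the parameter from \<open>z\<close> to \<open>w\<close> then raises
  this mean by at least \<open>(z - w) e\<^sup>2 / N\<close>.
\<close>
lemma exit_gap:
  assumes "w \<le> z" "\<And>i. i \<in> {1..m} \<Longrightarrow> 0 < a i + w" "k \<in> {1..m}" "0 \<le> e" "e < inv_sum a z k" "real m \<le> N"
    and c: "centering a b m n w \<le> centering a b m n z + g" and g: "s + g < (z - w) * e\<^sup>2 / N"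
  shows "inv_sum a z k - inv_sum a w k + centering a b m n w + s < centering a b m n z"
proof -
  have N: "0 < N" using assms(3,6) by auto
  have pos: "0 < a i + w" "0 < a i + z" if "i \<in> {1..k}" for i
    using assms(2)[of i] assms(1,3) that by auto
  have "e\<^sup>2 \<le> (inv_sum a z k)\<^sup>2" using assms by (intro power_mono) auto
  also have "\<dots> \<le> k * inv_sq_sum a z k" by (rule inv_sum_squared_le)
  also have "\<dots> \<le> N * inv_sq_sum a z k"
    using assms(3,6) by (intro mult_right_mono inv_sq_sum_nonneg) auto
  finally have "e\<^sup>2 / N \<le> inv_sq_sum a z k" using N by (simp add: field_simps)
  then have "(z - w) * (e\<^sup>2 / N) \<le> (z - w) * inv_sq_sum a z k"
    using assms(1) by (intro mult_left_mono) auto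
  moreover have "inv_sum a z k - (w - z) * inv_sq_sum a z k \<le> inv_sum a w k"
    using pos by (intro inv_sum_tangent)
  ultimately show ?thesis using c g by (simp add: algebra_simps)
qed

text \<open>
  The last condition says that the derivative of \<^const>\<open>centering\<close> vanishes at \<open>\<zeta>\<close>.
\<close>
definition critical :: "(nat \<Rightarrow> real) \<Rightarrow> (nat \<Rightarrow> real) \<Rightarrow> nat \<Rightarrow> nat \<Rightarrow> real \<Rightarrow> bool" where
  "critical a b m n \<zeta> \<longleftrightarrow> (\<forall>i\<in>{1..m}. 0 < a i + \<zeta>) \<and> (\<forall>j\<in>{1..n}. 0 < b j - \<zeta>) \<and>
     inv_sq_sum a \<zeta> m = inv_sq_sum b (- \<zeta>) n"

text \<open>
  At distance \<open>l / (2 n)\<close> from the left end of the interval, of length \<open>l\<close>, the smallest \<open>a i + u\<close>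
  alone outweighs all \<open>n\<close> terms with \<open>b\<close>, which are at distance at least \<open>l / 2\<close> from their
  singularity; similarly at the right end.  In between the intermediate value theorem applies.
\<close>
lemma critical_point_exists:
  assumes mn: "m \<ge> 1" "n \<ge> 1" and pos: "\<And>i j. i \<in> {1..m} \<Longrightarrow> j \<in> {1..n} \<Longrightarrow> 0 < a i + b j"
  shows "\<exists>\<zeta>. critical a b m n \<zeta>"
proof -
  obtain i0 where i0: "i0 \<in> {1..m}" "\<And>i. i \<in> {1..m} \<Longrightarrow> a i0 \<le> a i"
    using ex_is_arg_min_if_finite[of "{1..m}" a] mn by (auto simp: is_arg_min_linorder)
  obtain j0 where j0: "j0 \<in> {1..n}" "\<And>j. j \<in> {1..n} \<Longrightarrow> b j0 \<le> b j"
    using ex_is_arg_min_if_finite[of "{1..n}" b] mn by (auto simp: is_arg_min_linorder)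
  define l where "l = a i0 + b j0"
  have l: "0 < l" using pos i0 j0 by (simp add: l_def)
  define u where "u = - a i0 + l / (2 * n)"
  define v where "v = b j0 - l / (2 * m)"
  have nn: "l / (2 * real n) \<le> l / 2" "l / (2 * real m) \<le> l / 2"
    using l mn by (auto simp: field_simps)
  have pp: "0 < l / (2 * real n)" "0 < l / (2 * real m)" using l mn by auto
  have "u \<le> v" using nn l_def unfolding u_def v_def by linarith
  have ipos: "0 < a i + x" "0 < b j - x" if "u \<le> x" "x \<le> v" "i \<in> {1..m}" "j \<in> {1..n}" for x i j
    using i0(2)[OF that(3)] j0(2)[OF that(4)] pp that(1,2) by (auto simp: u_def v_def)
  define D where "D = (\<lambda>x. inv_sq_sum b (- x) n - inv_sq_sum a x m)"
  have "continuous_on {u..v} D"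
    unfolding D_def inv_sq_sum_def
    by (intro continuous_intros) (use ipos mn in fastforce)+
  moreover have "D u \<le> 0"
  proof -
    have "l / 2 \<le> b j + - u" if "j \<in> {1..n}" for j
      using j0(2)[OF that] nn by (simp add: u_def l_def)
    then have "inv_sq_sum b (- u) n \<le> n / (l / 2)\<^sup>2"
      using l by (intro inv_sq_sum_le) auto
    also have "\<dots> \<le> n * n / (l / 2)\<^sup>2"
      using mn by (intro divide_right_mono) auto
    also have "\<dots> = 1 / (a i0 + u)\<^sup>2"
      using l mn by (simp add: u_def power2_eq_square field_simps)
    also have "\<dots> \<le> inv_sq_sum a u m"
      unfolding inv_sq_sum_def using i0 by (intro member_le_sum[of i0 _ "\<lambda>i. 1 / (a i + u)\<^sup>2"]) auto
    finally show ?thesis by (simp add: D_def)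
  qed
  moreover have "0 \<le> D v"
  proof -
    have "l / 2 \<le> a i + v" if "i \<in> {1..m}" for i
      using i0(2)[OF that] nn by (simp add: v_def l_def)
    then have "inv_sq_sum a v m \<le> m / (l / 2)\<^sup>2"
      using l by (intro inv_sq_sum_le) auto
    also have "\<dots> \<le> m * m / (l / 2)\<^sup>2"
      using mn by (intro divide_right_mono) auto
    also have "\<dots> = 1 / (b j0 + - v)\<^sup>2"
      using l mn by (simp add: v_def power2_eq_square field_simps)
    also have "\<dots> \<le> inv_sq_sum b (- v) n"
      unfolding inv_sq_sum_def using j0 by (intro member_le_sum[of j0 _ "\<lambda>j. 1 / (b j + - v)\<^sup>2"]) auto
    finally show ?thesis by (simp add: D_def)
  qed
  ultimately obtain \<zeta> where "u \<le> \<zeta>" "\<zeta> \<le> v" "D \<zeta> = 0"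
    using IVT'[of D u 0 v] \<open>u \<le> v\<close> by auto
  then show ?thesis using ipos(1)[of \<zeta> _ 1] ipos(2)[of \<zeta> 1] mn
    by (intro exI[of _ \<zeta>]) (auto simp: critical_def D_def)
qed

lemma critical_swap: "critical b a n m (- \<zeta>) \<longleftrightarrow> critical a b m n \<zeta>"
  by (auto simp: critical_def)

lemma critical_minimizes:
  assumes "critical a b m n \<zeta>" "\<And>i. i \<in> {1..m} \<Longrightarrow> 0 < a i + z" "\<And>j. j \<in> {1..n} \<Longrightarrow> 0 < b j - z"
  shows "centering a b m n \<zeta> \<le> centering a b m n z"
  using centering_tangent[of m a z \<zeta> n b] assms by (auto simp: critical_def)

text \<open>
  The point \<open>\<zeta>\<close> has distance at least \<open>\<kappa> / 2\<close> from one of the two ends of the interval.  The sum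
  belonging to that end is bounded termwise, and at a critical point the two sums agree.
\<close>
lemma critical_inv_sq_sum_le:
  assumes crit: "critical a b m n \<zeta>" and \<kappa>: "0 < \<kappa>"
    and gap: "\<And>i j. i \<in> {1..m} \<Longrightarrow> j \<in> {1..n} \<Longrightarrow> \<kappa> \<le> a i + b j"
  shows "inv_sq_sum a \<zeta> m \<le> 4 * (real m + real n) / \<kappa>\<^sup>2"
proof (cases "\<forall>i\<in>{1..m}. \<kappa> / 2 \<le> a i + \<zeta>")
  case True
  then have "inv_sq_sum a \<zeta> m \<le> m / (\<kappa> / 2)\<^sup>2" using \<kappa> by (intro inv_sq_sum_le) auto
  also have "\<dots> \<le> (real m + real n) / (\<kappa> / 2)\<^sup>2" by (intro divide_right_mono) auto
  finally show ?thesis using \<kappa> by (simp add: power_divide mult.commute)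
next
  case False
  then obtain i where i: "i \<in> {1..m}" "a i + \<zeta> < \<kappa> / 2" by force
  have "\<kappa> / 2 \<le> b j + - \<zeta>" if "j \<in> {1..n}" for j
    using gap[OF i(1) that] i(2) by simp
  then have "inv_sq_sum b (- \<zeta>) n \<le> n / (\<kappa> / 2)\<^sup>2" using \<kappa> by (intro inv_sq_sum_le) auto
  also have "\<dots> \<le> (real m + real n) / (\<kappa> / 2)\<^sup>2" by (intro divide_right_mono) auto
  finally show ?thesis using \<kappa> crit by (simp add: critical_def power_divide mult.commute)
qed

lemma inv_sq_sum_half:
  assumes "\<And>i. i \<in> {1..m} \<Longrightarrow> 0 < a i + z" "\<And>i. i \<in> {1..m} \<Longrightarrow> (a i + z) / 2 \<le> a i + w"
  shows "inv_sq_sum a w m \<le> 4 * inv_sq_sum a z m"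
  unfolding inv_sq_sum_def sum_distrib_left
proof (rule sum_mono)
  fix i assume i: "i \<in> {1..m}"
  have "1 / (a i + w)\<^sup>2 \<le> 1 / ((a i + z) / 2)\<^sup>2"
    using assms[OF i] by (intro divide_left_mono power_mono) auto
  then show "1 / (a i + w)\<^sup>2 \<le> 4 * (1 / (a i + z)\<^sup>2)" by (simp add: power_divide)
qed

text \<open>
  The first-order terms of the two sums cancel at a critical point, which leaves an increase of
  second order in \<open>h\<close>.
\<close>
lemma interior_shift:
  assumes crit: "critical a b m n \<zeta>" and \<rho>: "0 < \<rho>" "0 \<le> h" "h \<le> \<rho> / 2"
    and far: "\<And>i. i \<in> {1..m} \<Longrightarrow> \<rho> \<le> a i + \<zeta>" "\<And>j. j \<in> {1..n} \<Longrightarrow> \<rho> \<le> b j - \<zeta>"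
    and V: "0 < \<tau>" "4 * inv_sq_sum a \<zeta> m \<le> \<tau>\<^sup>2"
  shows "admissible a b m n \<tau> (\<zeta> - h)"
    and "centering a b m n (\<zeta> - h) \<le> centering a b m n \<zeta> + 4 * h\<^sup>2 / \<rho> * inv_sq_sum a \<zeta> m"
proof -
  have Vb: "inv_sq_sum b (- \<zeta>) n = inv_sq_sum a \<zeta> m" using crit by (simp add: critical_def)
  have "inv_sq_sum a (\<zeta> - h) m \<le> 4 * inv_sq_sum a \<zeta> m"
  proof (rule inv_sq_sum_half)
    fix i assume "i \<in> {1..m}"
    with far(1) have "\<rho> \<le> a i + \<zeta>" by blast
    then show "0 < a i + \<zeta>" "(a i + \<zeta>) / 2 \<le> a i + (\<zeta> - h)" using \<rho> by auto
  qed
  moreover have "inv_sq_sum b (- (\<zeta> - h)) n \<le> inv_sq_sum b (- \<zeta>) n"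
    using \<rho> far by (intro inv_sq_sum_antimono) force+
  ultimately show "admissible a b m n \<tau> (\<zeta> - h)"
    using V \<rho> far inv_sq_sum_nonneg[of a \<zeta> m] unfolding admissible_def Vb
    by (force simp del: atLeastAtMost_iff)
  have "inv_sum a (\<zeta> - h) m \<le> inv_sum a \<zeta> m + h * inv_sq_sum a \<zeta> m + 2 * h\<^sup>2 / \<rho> * inv_sq_sum a \<zeta> m"
    using inv_sum_taylor_upper[of \<rho> m a \<zeta> "- h"] \<rho> far(1) by simp
  moreover have "inv_sum b (- \<zeta> + h) n \<le> inv_sum b (- \<zeta>) n - h * inv_sq_sum b (- \<zeta>) n + 2 * h\<^sup>2 / \<rho> * inv_sq_sum b (- \<zeta>) n"
    using \<rho> far(2) by (intro inv_sum_taylor_upper) auto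
  ultimately show "centering a b m n (\<zeta> - h) \<le> centering a b m n \<zeta> + 4 * h\<^sup>2 / \<rho> * inv_sq_sum a \<zeta> m"
    by (simp add: centering_def Vb)
qed

section \<open>Lower bounds for the best path\<close>
lemma path_lower_bound_interior:
  assumes X: "exp_vars M ({1..m} \<times> {1..n}) X (\<lambda>(i, j). a i + b j)" and mn: "m \<ge> 1" "n \<ge> 1"
    and crit: "critical a b m n \<zeta>" and \<rho>: "0 < \<rho>" "0 < h" "h \<le> \<rho> / 2"
    and far: "\<And>i. i \<in> {1..m} \<Longrightarrow> \<rho> \<le> a i + \<zeta>" "\<And>j. j \<in> {1..n} \<Longrightarrow> \<rho> \<le> b j - \<zeta>"
    and V: "0 < \<tau>" "4 * inv_sq_sum a \<zeta> m \<le> \<tau>\<^sup>2"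
    and t: "0 \<le> t" and e: "0 \<le> e"
    and gap: "6 * t + 4 * h\<^sup>2 / \<rho> * inv_sq_sum a \<zeta> m < h * e\<^sup>2 / (real m + real n)"
  shows "whp M (5 * (real m + real n) * tail \<tau> t)
     (\<lambda>x. \<exists>\<pi>\<in>lattice_paths (1, 1) (m, n). centering a b m n \<zeta> - 4 * t - e \<le> weight (\<lambda>p. X p x) \<pi>)"
proof -
  have Vb: "inv_sq_sum b (- \<zeta>) n = inv_sq_sum a \<zeta> m" using crit by (simp add: critical_def)
  have crit': "critical b a n m (- \<zeta>)" using crit by (simp add: critical_swap)
  have far': "\<rho> \<le> b j + - \<zeta>" if "j \<in> {1..n}" for j using far(2)[OF that] by simp
  have far'': "\<rho> \<le> a i - - \<zeta>" if "i \<in> {1..m}" for i using far(1)[OF that] by simp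
  note 1 = interior_shift[OF crit \<rho>(1) less_imp_le[OF \<rho>(2)] \<rho>(3) far V]
  note 2 = interior_shift[OF crit' \<rho>(1) less_imp_le[OF \<rho>(2)] \<rho>(3) far' far'' V[folded Vb]]
  have adm0: "admissible a b m n \<tau> \<zeta>"
    using V inv_sq_sum_nonneg[of a \<zeta> m] crit by (auto simp: admissible_def critical_def)
  have w: "- \<zeta> - h = - (\<zeta> + h)" by simp
  note 2 = 2[unfolded w admissible_swap centering_swap Vb]
  show ?thesis
  proof (rule path_lower_bound_gaps[OF X mn adm0 1(1) 2(1) _ _ t])
    fix k assume "k \<in> {1..m}" "e < inv_sum a \<zeta> k"
    then show "inv_sum a \<zeta> k - inv_sum a (\<zeta> - h) k + centering a b m n (\<zeta> - h) + 6 * t < centering a b m n \<zeta>"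
      using \<rho> e gap 1 by (intro exit_gap[where N = "real m + real n" and m = m]) (auto simp: admissible_def)
  next
    fix l assume l: "l \<in> {1..n}" "e < inv_sum b (- \<zeta>) l"
    have pos: "0 < b j + - (\<zeta> + h)" if "j \<in> {1..n}" for j
      using 2(1) that unfolding admissible_def by (metis diff_conv_add_uminus)
    have "centering b a n m (- (\<zeta> + h)) \<le> centering b a n m (- \<zeta>) + 4 * h\<^sup>2 / \<rho> * inv_sq_sum a \<zeta> m"
      using 2(2) by (simp only: centering_swap)
    then have "inv_sum b (- \<zeta>) l - inv_sum b (- (\<zeta> + h)) l + centering b a n m (- (\<zeta> + h)) + 6 * t < centering b a n m (- \<zeta>)"
      using \<rho> e gap l pos by (intro exit_gap[where N = "real m + real n" and m = n]) auto
    then show "inv_sum b (- \<zeta>) l - inv_sum b (- (\<zeta> + h)) l + centering a b m n (\<zeta> + h) + 6 * t < centering a b m n \<zeta>"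
      by (simp only: centering_swap)
  qed
qed

text \<open>
  The parameter is \<open>z = b 1 - 2 \<rho>\<close>, just left of the end of the interval, so that row 0 has rates
  \<open>a i + b 1 - 2 \<rho>\<close>, which are close to the rates \<open>a i + b 1\<close> of row 1; replacing one row by the
  other costs at most \<open>2 / \<kappa> + 4 \<rho> N / \<kappa>\<^sup>2\<close>.  The comparison parameter for column 0 is
  \<open>w = b 1 - \<rho>\<close>, which still lies inside the interval.
\<close>
lemma path_lower_bound_minimal_row:
  assumes X: "exp_vars M ({1..m} \<times> {1..n}) X (\<lambda>(i, j). a i + b j)" and mn: "m \<ge> 1" "n \<ge> 1"
    and gap: "\<And>i j. i \<in> {1..m} \<Longrightarrow> j \<in> {1..n} \<Longrightarrow> \<kappa> \<le> a i + b j"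
    and \<rho>: "0 < \<rho>" "\<rho> \<le> \<kappa> / 4" and min: "\<And>j. j \<in> {1..n} \<Longrightarrow> b 1 \<le> b j"
    and N: "real m + real n \<le> N"
    and \<tau>: "0 < \<tau>" "4 * N / \<kappa>\<^sup>2 \<le> \<tau>\<^sup>2" "inv_sq_sum b (- (b 1 - \<rho>)) n \<le> \<tau>\<^sup>2"
    and cen: "centering a b m n (b 1 - \<rho>) \<le> centering a b m n (b 1 - 2 * \<rho>) + g"
    and t: "0 \<le> t" and e: "0 \<le> e"
    and margin: "6 * t + g < \<rho> * e\<^sup>2 / N" and cost: "2 / \<kappa> + 4 * \<rho> * N / \<kappa>\<^sup>2 \<le> e"
  shows "whp M (5 * (real m + real n) * tail \<tau> t)
     (\<lambda>x. \<exists>\<pi>\<in>lattice_paths (1, 1) (m, n). centering a b m n (b 1 - 2 * \<rho>) - 4 * t - e \<le> weight (\<lambda>p. X p x) \<pi>)"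
proof -
  define z where "z = b 1 - 2 * \<rho>"
  define w where "w = b 1 - \<rho>"
  have \<kappa>: "0 < \<kappa>" using \<rho> by simp
  have a1: "\<kappa> \<le> a i + b 1" if "i \<in> {1..m}" for i
    using gap[OF that, of 1] mn by simp
  have az: "\<kappa> / 2 \<le> a i + z" if "i \<in> {1..m}" for i
    using a1[OF that] \<rho> by (simp add: z_def)
  have bw: "0 < b j + - w" if "j \<in> {1..n}" for j
    using min[OF that] \<rho> by (simp add: w_def)
  have zw: "z \<le> w" "w - z = \<rho>" using \<rho> by (auto simp: z_def w_def)
  have apos: "0 < a i + x" if "i \<in> {1..m}" "z \<le> x" for i x
    using az[OF that(1)] \<kappa> that(2) by linarith
  have "inv_sq_sum a z m \<le> m / (\<kappa> / 2)\<^sup>2"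
    using \<kappa> az by (intro inv_sq_sum_le) auto
  also have "\<dots> \<le> N / (\<kappa> / 2)\<^sup>2" using N by (intro divide_right_mono) auto
  also have "\<dots> \<le> \<tau>\<^sup>2" using \<tau>(2) by (simp add: power_divide mult.commute)
  finally have Va: "inv_sq_sum a z m \<le> \<tau>\<^sup>2" .
  have Vax: "inv_sq_sum a x m \<le> \<tau>\<^sup>2" if "z \<le> x" for x
    using inv_sq_sum_antimono[OF that, of m a] apos Va by force
  have Vb: "inv_sq_sum b (- z) n \<le> \<tau>\<^sup>2"
    using inv_sq_sum_antimono[of "- w" "- z" n b] bw zw \<tau>(3)[folded w_def] by force
  have bz: "0 < b j + - z" if "j \<in> {1..n}" for j using bw[OF that] zw by linarith
  have adm_z: "admissible a b m n \<tau> z"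
    using apos[of _ z] bz \<tau>(1) Va Vb by (auto simp: admissible_def)
  have adm_w: "admissible a b m n \<tau> w"
    using apos[of _ w] zw bw \<tau>(1) Vax[OF zw(1)] \<tau>(3)[folded w_def] by (auto simp: admissible_def)
  show ?thesis
    unfolding z_def[symmetric]
  proof (rule path_lower_bound_row[OF X mn adm_z adm_w _ _ _ t])
    show "inv_sq_sum a (b 1) m \<le> \<tau>\<^sup>2" using \<rho> by (intro Vax) (simp add: z_def)
  next
    fix k assume k: "k \<in> {1..m}"
    then obtain k' where k': "k = Suc k'" by (cases k) auto
    have "inv_sum a z k' - inv_sum a (b 1) k' = (\<Sum>i=1..k'. 1 / (a i + z) - 1 / (a i + b 1))"
      by (simp add: inv_sum_def sum_subtractf)
    also have "\<dots> \<le> (\<Sum>i=1..k'. 4 * \<rho> / \<kappa>\<^sup>2)"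
    proof (rule sum_mono)
      fix i assume "i \<in> {1..k'}"
      then have i: "i \<in> {1..m}" using k k' by auto
      have "1 / (a i + z) - 1 / (a i + b 1) = 2 * \<rho> * (1 / (a i + z) * (1 / (a i + b 1)))"
        using apos[OF i, of z] a1[OF i] \<kappa> by (simp add: z_def field_simps)
      also have "\<dots> \<le> 2 * \<rho> * (1 / (\<kappa> / 2) * (1 / \<kappa>))"
        using az[OF i] a1[OF i] \<kappa> \<rho> apos[OF i, of z]
        by (intro mult_left_mono mult_mono divide_left_mono) auto
      also have "\<dots> = 4 * \<rho> / \<kappa>\<^sup>2" by (simp add: power2_eq_square)
      finally show "1 / (a i + z) - 1 / (a i + b 1) \<le> 4 * \<rho> / \<kappa>\<^sup>2" .
    qed
    also have "\<dots> = real k' * (4 * \<rho> / \<kappa>\<^sup>2)" by simp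
    also have "\<dots> \<le> N * (4 * \<rho> / \<kappa>\<^sup>2)"
      using k k' N \<rho> by (intro mult_right_mono) auto
    finally have "inv_sum a z k' - inv_sum a (b 1) k' \<le> 4 * \<rho> * N / \<kappa>\<^sup>2" by (simp add: mult.commute mult.left_commute)
    moreover have "1 / (a k + z) \<le> 1 / (\<kappa> / 2)"
      using az[OF k] \<kappa> by (intro divide_left_mono) auto
    moreover have "inv_sum a z k = inv_sum a z k' + 1 / (a k + z)" by (simp add: inv_sum_def k')
    ultimately show "inv_sum a z k \<le> inv_sum a (b 1) (k - 1) + e"
      using cost by (simp add: k')
  next
    fix l assume l: "l \<in> {1..n}" "e < inv_sum b (- z) l"
    have "centering b a n m (- w) \<le> centering b a n m (- z) + g"
      using cen unfolding centering_swap z_def w_def .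
    then have "inv_sum b (- z) l - inv_sum b (- w) l + centering b a n m (- w) + 6 * t < centering b a n m (- z)"
      using l bw zw e margin N by (intro exit_gap[where N = N and m = n and g = g]) auto
    then show "inv_sum b (- z) l - inv_sum b (- w) l + centering a b m n w + 6 * t < centering a b m n z"
      by (simp only: centering_swap)
  qed
qed

lemma inv_sum_reverse: "inv_sum (\<lambda>k. a (p + 2 - k)) x (Suc p) = inv_sum a x (Suc p)"
  unfolding inv_sum_def by (subst sum.atLeastAtMost_rev) (rule sum.cong, auto)

lemma inv_sq_sum_reverse: "inv_sq_sum (\<lambda>k. a (p + 2 - k)) x (Suc p) = inv_sq_sum a x (Suc p)"
  unfolding inv_sq_sum_def by (subst sum.atLeastAtMost_rev) (rule sum.cong, auto)

lemma sum_split_at: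
  fixes f :: "nat \<Rightarrow> real"
  assumes "p < m"
  shows "(\<Sum>k=1..m-p. f (k + p)) = (\<Sum>k=1..m. f k) - (\<Sum>k=1..p. f k)"
proof -
  have "(\<Sum>k=1..m-p. f (k + p)) = (\<Sum>k=1+p..m-p+p. f k)"
    by (rule sum.shift_bounds_cl_nat_ivl[symmetric])
  moreover have "(\<Sum>k=1..m. f k) = (\<Sum>k=1..p. f k) + (\<Sum>k=Suc p..m. f k)"
    using sum.ub_add_nat[of 1 p f "m - p"] assms by simp
  ultimately show ?thesis using assms by simp
qed

lemma inv_sum_shift:
  assumes "p < m"
  shows "inv_sum (\<lambda>k. a (k + p)) x (m - p) = inv_sum a x m - inv_sum a x p"
  unfolding inv_sum_def using sum_split_at[OF assms, of "\<lambda>k. 1 / (a k + x)"] by simp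

lemma inv_sq_sum_shift:
  assumes "p < m"
  shows "inv_sq_sum (\<lambda>k. a (k + p)) x (m - p) = inv_sq_sum a x m - inv_sq_sum a x p"
  unfolding inv_sq_sum_def using sum_split_at[OF assms, of "\<lambda>k. 1 / (a k + x)\<^sup>2"] by simp

lemma inv_sum_Suc: "inv_sum a x (Suc k) = inv_sum a x k + 1 / (a (Suc k) + x)"
  by (simp add: inv_sum_def)

text \<open>
  Cut the rectangle at a site of the row \<open>Suc q\<close> into a lower left and an upper right part sharing
  that site.  The decrease \<open>S\<close> of the column sum from \<open>z\<close> to \<open>w\<close> dominates the increase \<open>T\<close> of the
  row sum in the whole rectangle, and the cut is the first column at which this holds for the lower
  left part.  What is left for the upper right part is then also enough, up to the contribution of
  row \<open>Suc q\<close>, which is counted in both parts.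
\<close>
lemma balanced_column:
  assumes m: "m \<ge> 1" and q: "q < n" and zw: "z \<le> w"
    and a: "\<And>i. i \<in> {1..m} \<Longrightarrow> 0 < a i + z" and b: "\<And>j. j \<in> {1..n} \<Longrightarrow> 0 < b j - w"
    and cen: "centering a b m n w \<le> centering a b m n z"
  shows "\<exists>p<m. centering a b (Suc p) (Suc q) w \<le> centering a b (Suc p) (Suc q) z \<and>
     centering (\<lambda>k. a (k + p)) (\<lambda>k. b (k + q)) (m - p) (n - q) w
       \<le> centering (\<lambda>k. a (k + p)) (\<lambda>k. b (k + q)) (m - p) (n - q) z + (1 / (b (Suc q) - w) - 1 / (b (Suc q) - z))"
proof -
  define S where "S = (\<lambda>k. inv_sum a z k - inv_sum a w k)"
  define T where "T = (\<lambda>k. inv_sum b (- w) k - inv_sum b (- z) k)"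
  have T: "T k \<le> T l" "0 \<le> T k" if "k \<le> l" "l \<le> n" for k l
  proof -
    have *: "0 \<le> 1 / (b j + - w) - 1 / (b j + - z)" if "j \<in> {1..n}" for j
      using divide_left_mono[of "b j + - w" "b j + - z" 1] b[OF that] zw by simp
    have Teq: "T k = (\<Sum>j=1..k. 1 / (b j + - w) - 1 / (b j + - z))" for k
      by (simp add: T_def inv_sum_def sum_subtractf)
    show "T k \<le> T l" unfolding Teq using that * by (intro sum_mono2) auto
    show "0 \<le> T k" unfolding Teq using that * by (intro sum_nonneg) auto
  qed
  have "T n \<le> S m" using cen by (simp add: centering_def S_def T_def)
  with T(1)[of "Suc q" n] q have ex: "T (Suc q) \<le> S m" by simp
  define i where "i = (LEAST i. 1 \<le> i \<and> T (Suc q) \<le> S i)"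
  have i: "1 \<le> i" "T (Suc q) \<le> S i" "i \<le> m"
    using LeastI[of "\<lambda>i. 1 \<le> i \<and> T (Suc q) \<le> S i" m] Least_le[of "\<lambda>i. 1 \<le> i \<and> T (Suc q) \<le> S i" m] ex m
    unfolding i_def by auto
  then obtain p where p: "i = Suc p" by (cases i) auto
  have "S p \<le> T (Suc q)"
  proof (cases p)
    case 0
    then show ?thesis using T(2)[of "Suc q" n] q by (simp add: S_def inv_sum_def)
  next
    case (Suc p')
    have "\<not> (1 \<le> p \<and> T (Suc q) \<le> S p)"
      using not_less_Least[of p "\<lambda>i. 1 \<le> i \<and> T (Suc q) \<le> S i"] p unfolding i_def[symmetric] by auto
    then show ?thesis using Suc by auto
  qed
  moreover have "T (Suc q) = T q + (1 / (b (Suc q) - w) - 1 / (b (Suc q) - z))"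
    by (simp add: T_def inv_sum_Suc)
  ultimately show ?thesis
    using i p q \<open>T n \<le> S m\<close>
    by (intro exI[of _ p]) (auto simp: centering_def inv_sum_shift S_def T_def)
qed

text \<open>
  The row \<open>j0\<close> with the smallest \<open>b\<close> becomes the first row of two rectangles: of the part of the
  grid below and to the left of the cut, after a point reflection, and of the part above and to the
  right of it.  The two paths are joined at the common site, whose weight has then been counted twice.
  On the interval from \<open>z\<close> to \<open>\<zeta>\<close> the function \<^const>\<open>centering\<close> decreases, so moving left of the
  minimiser only raises the level that is reached, and \<open>w\<close> is a better parameter than \<open>z\<close>, as
  \<open>balanced_column\<close> requires.
\<close>
lemma path_lower_bound_edge:
  assumes X: "exp_vars M ({1..m} \<times> {1..n}) X (\<lambda>(i, j). a i + b j)" and mn: "m \<ge> 1" "n \<ge> 1"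
    and crit: "critical a b m n \<zeta>"
    and gap: "\<And>i j. i \<in> {1..m} \<Longrightarrow> j \<in> {1..n} \<Longrightarrow> \<kappa> \<le> a i + b j"
    and \<rho>: "0 < \<rho>" "\<rho> \<le> \<kappa> / 4"
    and near: "j0 \<in> {1..n}" "b j0 - \<zeta> < \<rho>" "\<And>j. j \<in> {1..n} \<Longrightarrow> b j0 \<le> b j"
    and N: "N = real m + real n"
    and \<tau>: "0 < \<tau>" "4 * N / \<kappa>\<^sup>2 \<le> \<tau>\<^sup>2"
    and t: "0 \<le> t" and e: "0 \<le> e"
    and margin: "6 * t + 1 / (2 * \<rho>) < \<rho> * e\<^sup>2 / N" and cost: "2 / \<kappa> + 4 * \<rho> * N / \<kappa>\<^sup>2 \<le> e"
  shows "whp M (11 * N * tail \<tau> t)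
     (\<lambda>x. \<exists>\<pi>\<in>lattice_paths (1, 1) (m, n). centering a b m n \<zeta> - 9 * t - 2 * e - 1 / \<kappa> \<le> weight (\<lambda>p. X p x) \<pi>)"
proof -
  have M: "prob_space M" using X by (simp add: exp_vars_def)
  have \<kappa>: "0 < \<kappa>" using \<rho> by simp
  have N2: "2 \<le> N" using mn N by simp
  define z where "z = b j0 - 2 * \<rho>"
  define w where "w = b j0 - \<rho>"
  have az: "0 < a i + z" if "i \<in> {1..m}" for i
    using gap[OF that near(1)] \<rho> by (simp add: z_def)
  have bw: "0 < b j - w" if "j \<in> {1..n}" for j
    using near(3)[OF that] \<rho> by (simp add: w_def)
  have zw: "z \<le> w" "w \<le> \<zeta>" "w - z = \<rho>" using \<rho> near(2) by (auto simp: z_def w_def)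
  have apos: "0 < a i + x" if "i \<in> {1..m}" "z \<le> x" for i x using az[OF that(1)] that(2) by linarith
  have bpos: "0 < b j - x" if "j \<in> {1..n}" "x \<le> w" for j x using bw[OF that(1)] that(2) by linarith
  have crit_pos: "0 < b j + - \<zeta>" if "j \<in> {1..n}" for j
    using crit that by (auto simp: critical_def)
  have V: "inv_sq_sum b (- \<zeta>) n \<le> 4 * N / \<kappa>\<^sup>2"
    using critical_inv_sq_sum_le[OF crit \<kappa> gap] crit by (simp add: critical_def N)
  have Vbw: "inv_sq_sum b (- w) n \<le> inv_sq_sum b (- \<zeta>) n"
    using zw crit_pos by (intro inv_sq_sum_antimono) auto
  have "inv_sq_sum a \<zeta> m \<le> inv_sq_sum a w m"
    using zw apos by (intro inv_sq_sum_antimono) auto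
  then have "0 \<le> (z - w) * (inv_sq_sum b (- w) n - inv_sq_sum a w m)"
    using zw Vbw crit by (intro mult_nonpos_nonpos) (auto simp: critical_def)
  moreover have "centering a b m n w + (z - w) * (inv_sq_sum b (- w) n - inv_sq_sum a w m) \<le> centering a b m n z"
    using zw apos bpos by (intro centering_tangent) auto
  ultimately have cen: "centering a b m n w \<le> centering a b m n z" by simp
  obtain q where q: "j0 = Suc q" "q < n" using near(1) by (cases j0) auto
  have step: "1 / (b (Suc q) - w) - 1 / (b (Suc q) - z) = 1 / (2 * \<rho>)"
    using \<rho> by (simp add: w_def z_def q field_simps)
  obtain p where p: "p < m" and cen1: "centering a b (Suc p) (Suc q) w \<le> centering a b (Suc p) (Suc q) z"
     and cen2: "centering (\<lambda>k. a (k + p)) (\<lambda>k. b (k + q)) (m - p) (n - q) w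
       \<le> centering (\<lambda>k. a (k + p)) (\<lambda>k. b (k + q)) (m - p) (n - q) z + 1 / (2 * \<rho>)"
    using balanced_column[OF mn(1) q(2) zw(1) az bw cen] unfolding step by blast

  \<comment> \<open>The lower left part, reflected so that the row \<open>j0\<close> becomes the first row.\<close>
  define a1 where "a1 = (\<lambda>k. a (p + 2 - k))"
  define b1 where "b1 = (\<lambda>k. b (q + 2 - k))"
  define X1 where "X1 = (\<lambda>r. X (case r of (i, j) \<Rightarrow> (p + 2 - i, q + 2 - j)))"
  have cen_1: "centering a1 b1 (Suc p) (Suc q) x = centering a b (Suc p) (Suc q) x" for x
    by (simp add: centering_def a1_def b1_def inv_sum_reverse del: add_2_eq_Suc')
  have X1: "exp_vars M ({1..Suc p} \<times> {1..Suc q}) X1 (\<lambda>(i, j). a1 i + b1 j)"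
  proof -
    have "exp_vars M ({1..Suc p} \<times> {1..Suc q}) X1 (\<lambda>r. case (case r of (i, j) \<Rightarrow> (p + 2 - i, q + 2 - j)) of (i, j) \<Rightarrow> a i + b j)"
      unfolding X1_def using p q by (intro exp_vars_reindex[OF X]) (auto simp: inj_on_def)
    then show ?thesis by (subst exp_vars_cong) (auto simp: a1_def b1_def)
  qed
  have b11: "b1 1 = b j0" by (simp add: b1_def q)
  have L1: "whp M (5 * (real (Suc p) + real (Suc q)) * tail \<tau> t)
     (\<lambda>x. \<exists>\<pi>\<in>lattice_paths (1, 1) (Suc p, Suc q). centering a1 b1 (Suc p) (Suc q) (b1 1 - 2 * \<rho>) - 4 * t - e \<le> weight (\<lambda>r. X1 r x) \<pi>)"
  proof (rule path_lower_bound_minimal_row[OF X1 _ _ _ \<rho> _ _ \<tau> _ _ t e margin cost])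
    fix i j assume "i \<in> {1..Suc p}" "j \<in> {1..Suc q}"
    then show "\<kappa> \<le> a1 i + b1 j" unfolding a1_def b1_def using p q by (intro gap) auto
  next
    fix j assume "j \<in> {1..Suc q}"
    then show "b1 1 \<le> b1 j" unfolding b11 unfolding b1_def using q by (intro near(3)) auto
  next
    have "inv_sq_sum b1 (- w) (Suc q) \<le> inv_sq_sum b (- w) n"
      unfolding b1_def inv_sq_sum_reverse using q by (intro inv_sq_sum_mono) simp
    then show "inv_sq_sum b1 (- (b1 1 - \<rho>)) (Suc q) \<le> \<tau>\<^sup>2"
      using Vbw V \<tau>(2) unfolding b11 w_def[symmetric] by linarith
  next
    show "centering a1 b1 (Suc p) (Suc q) (b1 1 - \<rho>) \<le> centering a1 b1 (Suc p) (Suc q) (b1 1 - 2 * \<rho>) + 1 / (2 * \<rho>)"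
      unfolding b11 w_def[symmetric] z_def[symmetric] cen_1 using cen1 \<rho> by (simp add: add_increasing2)
  next
    show "real (Suc p) + real (Suc q) \<le> N" using p q unfolding N by linarith
  qed auto

  \<comment> \<open>The upper right part.\<close>
  define a2 where "a2 = (\<lambda>k. a (k + p))"
  define b2 where "b2 = (\<lambda>k. b (k + q))"
  define X2 where "X2 = (\<lambda>r. X (case r of (i, j) \<Rightarrow> (i + p, j + q)))"
  have X2: "exp_vars M ({1..m-p} \<times> {1..n-q}) X2 (\<lambda>(i, j). a2 i + b2 j)"
  proof -
    have "exp_vars M ({1..m-p} \<times> {1..n-q}) X2 (\<lambda>r. case (case r of (i, j) \<Rightarrow> (i + p, j + q)) of (i, j) \<Rightarrow> a i + b j)"
      unfolding X2_def by (intro exp_vars_reindex[OF X]) (auto simp: inj_on_def)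
    then show ?thesis by (subst exp_vars_cong) (auto simp: a2_def b2_def)
  qed
  have b21: "b2 1 = b j0" by (simp add: b2_def q)
  have L2: "whp M (5 * (real (m - p) + real (n - q)) * tail \<tau> t)
     (\<lambda>x. \<exists>\<pi>\<in>lattice_paths (1, 1) (m - p, n - q). centering a2 b2 (m - p) (n - q) (b2 1 - 2 * \<rho>) - 4 * t - e \<le> weight (\<lambda>r. X2 r x) \<pi>)"
  proof (rule path_lower_bound_minimal_row[OF X2 _ _ _ \<rho> _ _ \<tau> _ _ t e margin cost])
    show "1 \<le> m - p" "1 \<le> n - q" using p q by auto
    fix i j assume "i \<in> {1..m-p}" "j \<in> {1..n-q}"
    then show "\<kappa> \<le> a2 i + b2 j" unfolding a2_def b2_def by (intro gap) auto
  next
    fix j assume "j \<in> {1..n-q}"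
    then show "b2 1 \<le> b2 j" unfolding b21 by (auto simp: b2_def intro!: near(3))
  next
    have "inv_sq_sum b2 (- w) (n - q) \<le> inv_sq_sum b (- w) n"
      unfolding b2_def inv_sq_sum_shift[OF q(2)] by (simp add: inv_sq_sum_nonneg)
    then show "inv_sq_sum b2 (- (b2 1 - \<rho>)) (n - q) \<le> \<tau>\<^sup>2"
      using Vbw V \<tau>(2) unfolding b21 w_def[symmetric] by linarith
  next
    show "centering a2 b2 (m - p) (n - q) (b2 1 - \<rho>) \<le> centering a2 b2 (m - p) (n - q) (b2 1 - 2 * \<rho>) + 1 / (2 * \<rho>)"
      unfolding b21 w_def[symmetric] z_def[symmetric] using cen2 by (simp add: a2_def b2_def)
  next
    show "real (m - p) + real (n - q) \<le> N" unfolding N by linarith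
  qed

  have corner: "whp M (tail \<tau> t) (\<lambda>x. X (Suc p, Suc q) x \<le> 1 / \<kappa> + t)"
  proof -
    have rate: "\<kappa> \<le> a (Suc p) + b (Suc q)" using p q by (intro gap) auto
    have "1 / (a (Suc p) + b (Suc q))\<^sup>2 \<le> 1 / \<kappa>\<^sup>2"
      using rate \<kappa> by (intro divide_left_mono power_mono) auto
    also have "\<dots> \<le> 4 * N / \<kappa>\<^sup>2" using N2 by (intro divide_right_mono) auto
    finally have "whp M (tail \<tau> t) (\<lambda>x. \<bar>(\<Sum>r\<in>{(Suc p, Suc q)}. X r x) - (\<Sum>r\<in>{(Suc p, Suc q)}. 1 / (case r of (i, j) \<Rightarrow> a i + b j))\<bar> \<le> t)"
      using p q \<tau> by (intro exp_vars_concentration exp_vars_subset[OF X]) auto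
    then show ?thesis
    proof (rule whp_mono)
      fix x assume "\<bar>(\<Sum>r\<in>{(Suc p, Suc q)}. X r x) - (\<Sum>r\<in>{(Suc p, Suc q)}. 1 / (case r of (i, j) \<Rightarrow> a i + b j))\<bar> \<le> t"
      moreover have "1 / (a (Suc p) + b (Suc q)) \<le> 1 / \<kappa>"
        using rate \<kappa> by (intro divide_left_mono) auto
      ultimately show "X (Suc p, Suc q) x \<le> 1 / \<kappa> + t" by (simp add: abs_le_iff)
    qed simp
  qed

  have total: "centering a b m n \<zeta> \<le> centering a1 b1 (Suc p) (Suc q) (b1 1 - 2 * \<rho>) + centering a2 b2 (m - p) (n - q) (b2 1 - 2 * \<rho>)"
  proof -
    have "0 < 1 / (a (Suc p) + z)" using az[of "Suc p"] p by simp
    moreover have "0 < 1 / (b (Suc q) + - z)" using bpos[of "Suc q" z] q zw by simp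
    moreover have "centering a b m n \<zeta> \<le> centering a b m n z"
      using apos bpos zw by (intro critical_minimizes[OF crit]) auto
    ultimately show ?thesis
      unfolding b11 b21 z_def[symmetric] cen_1
      unfolding centering_def a2_def b2_def inv_sum_shift[OF p] inv_sum_shift[OF q(2)] inv_sum_Suc
      by linarith
  qed

  from whp_conj[OF M whp_conj[OF M L1 L2] corner] show ?thesis
  proof (rule whp_mono)
    have "5 * (real (Suc p) + real (Suc q)) + 5 * (real (m - p) + real (n - q)) + 1 = 5 * N + 11"
      using p q N by (simp add: of_nat_diff)
    also have "\<dots> \<le> 11 * N" using N2 by simp
    finally have "(5 * (real (Suc p) + real (Suc q)) + 5 * (real (m - p) + real (n - q)) + 1) * tail \<tau> t \<le> 11 * N * tail \<tau> t"
      by (intro mult_right_mono tail_nonneg)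
    then show "5 * (real (Suc p) + real (Suc q)) * tail \<tau> t + 5 * (real (m - p) + real (n - q)) * tail \<tau> t + tail \<tau> t \<le> 11 * N * tail \<tau> t"
      by (simp only: distrib_right mult_1)
  next
    fix x assume x: "((\<exists>\<pi>\<in>lattice_paths (1, 1) (Suc p, Suc q). centering a1 b1 (Suc p) (Suc q) (b1 1 - 2 * \<rho>) - 4 * t - e \<le> weight (\<lambda>r. X1 r x) \<pi>) \<and>
       (\<exists>\<pi>\<in>lattice_paths (1, 1) (m - p, n - q). centering a2 b2 (m - p) (n - q) (b2 1 - 2 * \<rho>) - 4 * t - e \<le> weight (\<lambda>r. X2 r x) \<pi>)) \<and>
       X (Suc p, Suc q) x \<le> 1 / \<kappa> + t"
    then obtain \<pi>1 \<pi>2 where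
       1: "\<pi>1 \<in> lattice_paths (1, 1) (Suc p, Suc q)" "centering a1 b1 (Suc p) (Suc q) (b1 1 - 2 * \<rho>) - 4 * t - e \<le> weight (\<lambda>r. X1 r x) \<pi>1" and
       2: "\<pi>2 \<in> lattice_paths (1, 1) (m - p, n - q)" "centering a2 b2 (m - p) (n - q) (b2 1 - 2 * \<rho>) - 4 * t - e \<le> weight (\<lambda>r. X2 r x) \<pi>2"
      by blast
    have "rev (map (\<lambda>(i, j). (p + 2 - i, q + 2 - j)) \<pi>1) \<in> lattice_paths (1, 1) (Suc p, Suc q)"
      using lattice_paths_reflect[OF 1(1), of "p + 2" "q + 2"] by simp
    note left = this
    have "map (\<lambda>(i, j). (i + p, j + q)) \<pi>2 \<in> lattice_paths (Suc p, Suc q) (m, n)"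
      using lattice_paths_shift[OF 2(1), of p q] p q by simp
    from lattice_paths_join[OF left this, of "\<lambda>r. X r x"]
    obtain \<pi> where \<pi>: "\<pi> \<in> lattice_paths (1, 1) (m, n)"
      "weight (\<lambda>r. X r x) \<pi> = weight (\<lambda>r. X r x) (rev (map (\<lambda>(i, j). (p + 2 - i, q + 2 - j)) \<pi>1))
         + weight (\<lambda>r. X r x) (map (\<lambda>(i, j). (i + p, j + q)) \<pi>2) - X (Suc p, Suc q) x"
      by blast
    have "weight (\<lambda>r. X r x) (rev (map (\<lambda>(i, j). (p + 2 - i, q + 2 - j)) \<pi>1)) = weight (\<lambda>r. X1 r x) \<pi>1"
      unfolding rev_map[symmetric] map_map sum_list_rev X1_def comp_def ..
    moreover have "weight (\<lambda>r. X r x) (map (\<lambda>(i, j). (i + p, j + q)) \<pi>2) = weight (\<lambda>r. X2 r x) \<pi>2"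
      by (simp add: X2_def comp_def)
    ultimately have "weight (\<lambda>r. X r x) \<pi> = weight (\<lambda>r. X1 r x) \<pi>1 + weight (\<lambda>r. X2 r x) \<pi>2 - X (Suc p, Suc q) x"
      using \<pi>(2) by (simp only:)
    then have "centering a b m n \<zeta> - 9 * t - 2 * e - 1 / \<kappa> \<le> weight (\<lambda>p. X p x) \<pi>"
      using 1(2) 2(2) conjunct2[OF x] total by linarith
    with \<pi>(1) show "\<exists>\<pi>\<in>lattice_paths (1, 1) (m, n). centering a b m n \<zeta> - 9 * t - 2 * e - 1 / \<kappa> \<le> weight (\<lambda>p. X p x) \<pi>"
      by blast
  qed
qed

text \<open>
  The three cases are \<open>\<zeta>\<close> far from both ends of the interval, close to the right end, and close to
  the left end; the last one is reduced to the second by transposition.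
\<close>
lemma path_lower_bound:
  assumes X: "exp_vars M ({1..m} \<times> {1..n}) X (\<lambda>(i, j). a i + b j)" and mn: "m \<ge> 1" "n \<ge> 1"
    and crit: "critical a b m n \<zeta>"
    and gap: "\<And>i j. i \<in> {1..m} \<Longrightarrow> j \<in> {1..n} \<Longrightarrow> \<kappa> \<le> a i + b j"
    and \<rho>: "0 < \<rho>" "\<rho> \<le> \<kappa> / 4" and h: "0 < h" "h \<le> \<rho> / 2"
    and N: "N = real m + real n"
    and \<tau>: "0 < \<tau>" "16 * N / \<kappa>\<^sup>2 \<le> \<tau>\<^sup>2"
    and t: "0 \<le> t" and e: "0 \<le> e"
    and margin: "6 * t + 1 / (2 * \<rho>) < \<rho> * e\<^sup>2 / N" "6 * t + 16 * h\<^sup>2 * N / (\<rho> * \<kappa>\<^sup>2) < h * e\<^sup>2 / N"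
    and cost: "2 / \<kappa> + 4 * \<rho> * N / \<kappa>\<^sup>2 \<le> e"
  shows "whp M (11 * N * tail \<tau> t)
     (\<lambda>x. \<exists>\<pi>\<in>lattice_paths (1, 1) (m, n). centering a b m n \<zeta> - 9 * t - 2 * e - 1 / \<kappa> \<le> weight (\<lambda>p. X p x) \<pi>)"
proof -
  have \<kappa>: "0 < \<kappa>" using \<rho> by simp
  have N0: "0 < N" using mn N by simp
  have \<tau>': "4 * N / \<kappa>\<^sup>2 \<le> \<tau>\<^sup>2"
  proof -
    have "4 * N / \<kappa>\<^sup>2 \<le> 16 * N / \<kappa>\<^sup>2" using N0 by (intro divide_right_mono) auto
    with \<tau> show ?thesis by simp
  qed
  consider (interior) "\<And>i. i \<in> {1..m} \<Longrightarrow> \<rho> \<le> a i + \<zeta>" "\<And>j. j \<in> {1..n} \<Longrightarrow> \<rho> \<le> b j - \<zeta>"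
    | (right) j where "j \<in> {1..n}" "b j - \<zeta> < \<rho>"
    | (left) i where "i \<in> {1..m}" "a i + \<zeta> < \<rho>"
    by (meson not_less)
  then show ?thesis
  proof cases
    case interior
    have V: "inv_sq_sum a \<zeta> m \<le> 4 * N / \<kappa>\<^sup>2"
      using critical_inv_sq_sum_le[OF crit \<kappa> gap] by (simp add: N)
    have "4 * h\<^sup>2 / \<rho> * inv_sq_sum a \<zeta> m \<le> 4 * h\<^sup>2 / \<rho> * (4 * N / \<kappa>\<^sup>2)"
      using \<rho> V by (intro mult_left_mono) auto
    also have "\<dots> = 16 * h\<^sup>2 * N / (\<rho> * \<kappa>\<^sup>2)" by simp
    finally have margin': "6 * t + 4 * h\<^sup>2 / \<rho> * inv_sq_sum a \<zeta> m < h * e\<^sup>2 / (real m + real n)"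
      using margin(2) N by simp
    have "4 * inv_sq_sum a \<zeta> m \<le> \<tau>\<^sup>2" using V \<tau> by simp
    from path_lower_bound_interior[OF X mn crit \<rho>(1) h interior \<tau>(1) this t e margin']
    show ?thesis
    proof (rule whp_mono)
      show "5 * (real m + real n) * tail \<tau> t \<le> 11 * N * tail \<tau> t"
        using N N0 by (intro mult_right_mono tail_nonneg) auto
      fix x assume "\<exists>\<pi>\<in>lattice_paths (1, 1) (m, n). centering a b m n \<zeta> - 4 * t - e \<le> weight (\<lambda>p. X p x) \<pi>"
      moreover have "0 \<le> 1 / \<kappa>" using \<kappa> by simp
      ultimately show "\<exists>\<pi>\<in>lattice_paths (1, 1) (m, n). centering a b m n \<zeta> - 9 * t - 2 * e - 1 / \<kappa> \<le> weight (\<lambda>p. X p x) \<pi>"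
        using t e by (smt (verit, best))
    qed
  next
    case right
    obtain j0 where j0: "j0 \<in> {1..n}" "\<And>j. j \<in> {1..n} \<Longrightarrow> b j0 \<le> b j"
      using ex_is_arg_min_if_finite[of "{1..n}" b] mn by (auto simp: is_arg_min_linorder)
    have "b j0 - \<zeta> < \<rho>" using j0(2)[OF right(1)] right(2) by simp
    from path_lower_bound_edge[OF X mn crit gap \<rho> j0(1) this j0(2) N \<tau>(1) \<tau>' t e margin(1) cost]
    show ?thesis .
  next
    case left
    obtain i0 where i0: "i0 \<in> {1..m}" "\<And>i. i \<in> {1..m} \<Longrightarrow> a i0 \<le> a i"
      using ex_is_arg_min_if_finite[of "{1..m}" a] mn by (auto simp: is_arg_min_linorder)
    have near: "a i0 - (- \<zeta>) < \<rho>" using i0(2)[OF left(1)] left(2) by simp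
    have crit': "critical b a n m (- \<zeta>)" using crit by (simp add: critical_swap)
    have gap': "\<kappa> \<le> b i + a j" if "i \<in> {1..n}" "j \<in> {1..m}" for i j
      using gap[OF that(2,1)] by (simp add: add.commute)
    have N': "N = real n + real m" using N by simp
    from path_lower_bound_edge[OF exp_vars_swap[OF X] mn(2,1) crit' gap' \<rho> i0(1) near i0(2) N' \<tau>(1) \<tau>' t e margin(1) cost]
    show ?thesis
    proof (rule whp_mono)
      fix x assume "\<exists>\<pi>\<in>lattice_paths (1, 1) (n, m). centering b a n m (- \<zeta>) - 9 * t - 2 * e - 1 / \<kappa> \<le> weight (\<lambda>p. X (prod.swap p) x) \<pi>"
      then obtain \<pi> where "\<pi> \<in> lattice_paths (1, 1) (n, m)"
        "centering a b m n \<zeta> - 9 * t - 2 * e - 1 / \<kappa> \<le> weight (\<lambda>p. X (prod.swap p) x) \<pi>"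
        by (auto simp: centering_swap)
      then show "\<exists>\<pi>\<in>lattice_paths (1, 1) (m, n). centering a b m n \<zeta> - 9 * t - 2 * e - 1 / \<kappa> \<le> weight (\<lambda>p. X p x) \<pi>"
        using lattice_paths_swap[of \<pi> "(1, 1)" "(n, m)"]
        by (intro bexI[of _ "map prod.swap \<pi>"]) (auto simp: comp_def)
    qed (assumption | rule order_refl)+
  qed
qed

section \<open>The last-passage time is close to its centering\<close>
lemma less_min_param_iff:
  assumes "m \<ge> 1"
  shows "x < min_param a m \<longleftrightarrow> (\<forall>i\<in>{1..m}. x < a m i)"
  using assms unfolding min_param_def by (subst Min_gr_iff) auto

lemma shape_centering_eq:
  assumes mn: "m \<ge> 1" "n \<ge> 1" and crit: "critical (a m) (b n) m n \<zeta>"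
  shows "shape_centering a b m n = centering (a m) (b n) m n \<zeta>"
proof -
  have I: "z \<in> param_interval a b m n \<longleftrightarrow> (\<forall>i\<in>{1..m}. 0 < a m i + z) \<and> (\<forall>j\<in>{1..n}. 0 < b n j - z)" for z
  proof -
    have "- min_param a m < z \<longleftrightarrow> - z < min_param a m" by auto
    then show ?thesis
      by (simp add: param_interval_def less_min_param_iff[OF mn(1)] less_min_param_iff[OF mn(2)] minus_less_iff)
        (auto simp: neg_less_iff_less minus_less_iff add.commute less_diff_eq)
  qed
  have c: "(\<Sum>i=1..m. 1 / (a m i + z)) + (\<Sum>j=1..n. 1 / (b n j - z)) = centering (a m) (b n) m n z" for z
    by (simp add: centering_def inv_sum_def)
  show ?thesis
    unfolding shape_centering_def c
  proof (rule cInf_eq_minimum)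
    show "centering (a m) (b n) m n \<zeta> \<in> (\<lambda>z. centering (a m) (b n) m n z) ` param_interval a b m n"
      using crit I by (auto simp: critical_def)
    fix y assume "y \<in> (\<lambda>z. centering (a m) (b n) m n z) ` param_interval a b m n"
    then show "centering (a m) (b n) m n \<zeta> \<le> y"
      using I by (auto intro!: critical_minimizes[OF crit])
  qed
qed

lemma last_passage_estimate:
  assumes X: "exp_vars M ({1..m} \<times> {1..n}) X (\<lambda>(i, j). a m i + b n j)" and mn: "m \<ge> 1" "n \<ge> 1"
    and gap: "\<And>i j. i \<in> {1..m} \<Longrightarrow> j \<in> {1..n} \<Longrightarrow> \<kappa> \<le> a m i + b n j"
    and \<rho>: "0 < \<rho>" "\<rho> \<le> \<kappa> / 4" and h: "0 < h" "h \<le> \<rho> / 2"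
    and N: "N = real m + real n"
    and \<tau>: "0 < \<tau>" "16 * N / \<kappa>\<^sup>2 \<le> \<tau>\<^sup>2"
    and t: "0 \<le> t" and e: "0 \<le> e"
    and margin: "6 * t + 1 / (2 * \<rho>) < \<rho> * e\<^sup>2 / N" "6 * t + 16 * h\<^sup>2 * N / (\<rho> * \<kappa>\<^sup>2) < h * e\<^sup>2 / N"
    and cost: "2 / \<kappa> + 4 * \<rho> * N / \<kappa>\<^sup>2 \<le> e"
  shows "whp M (13 * N * tail \<tau> t)
     (\<lambda>x. \<bar>last_passage_time (\<lambda>p. X p x) m n - shape_centering a b m n\<bar> \<le> 9 * t + 2 * e + 1 / \<kappa>)"
proof -
  have M: "prob_space M" using X by (simp add: exp_vars_def)
  have \<kappa>: "0 < \<kappa>" using \<rho> by simp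
  have N2: "2 \<le> N" using mn N by simp
  have "0 < a m i + b n j" if "i \<in> {1..m}" "j \<in> {1..n}" for i j
    using gap[OF that] \<kappa> by linarith
  then obtain \<zeta> where crit: "critical (a m) (b n) m n \<zeta>"
    using critical_point_exists[OF mn, of "a m" "b n"] by auto
  have "inv_sq_sum (a m) \<zeta> m \<le> 4 * N / \<kappa>\<^sup>2"
    using critical_inv_sq_sum_le[OF crit \<kappa> gap] by (simp add: N)
  also have "\<dots> \<le> 16 * N / \<kappa>\<^sup>2" using N2 by (intro divide_right_mono) auto
  finally have adm: "admissible (a m) (b n) m n \<tau> \<zeta>"
    using \<tau> crit by (auto simp: admissible_def critical_def)
  from whp_conj[OF M path_upper_bound[OF X mn adm, of t]
     path_lower_bound[OF X mn crit gap \<rho> h N \<tau> t e margin cost]]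
  show ?thesis
  proof (rule whp_mono)
    have "(real m + 2) + 11 * N \<le> 13 * N" using mn N by simp
    then have "((real m + 2) + 11 * N) * tail \<tau> t \<le> 13 * N * tail \<tau> t"
      by (intro mult_right_mono tail_nonneg)
    then show "(real m + 2) * tail \<tau> t + 11 * N * tail \<tau> t \<le> 13 * N * tail \<tau> t"
      by (simp only: distrib_right)
  next
    fix x assume x: "(\<forall>k\<in>{1..m}. \<forall>\<pi>\<in>lattice_paths (k, 1) (m, n).
        inv_sum (a m) \<zeta> k + weight (\<lambda>p. X p x) \<pi> \<le> centering (a m) (b n) m n \<zeta> + 3 * t) \<and>
      (\<exists>\<pi>\<in>lattice_paths (1, 1) (m, n). centering (a m) (b n) m n \<zeta> - 9 * t - 2 * e - 1 / \<kappa> \<le> weight (\<lambda>p. X p x) \<pi>)"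
    have k1: "0 \<le> 1 / \<kappa>" using \<kappa> by simp
    have "0 < a m 1 + \<zeta>" using crit mn by (auto simp: critical_def)
    then have "0 \<le> inv_sum (a m) \<zeta> 1" by (simp add: inv_sum_def)
    moreover have "inv_sum (a m) \<zeta> 1 + weight (\<lambda>p. X p x) \<pi> \<le> centering (a m) (b n) m n \<zeta> + 3 * t"
      if "\<pi> \<in> lattice_paths (1, 1) (m, n)" for \<pi>
      by (rule bspec[OF bspec[OF conjunct1[OF x]]]) (use that mn in auto)
    ultimately have up: "weight (\<lambda>p. X p x) \<pi> \<le> centering (a m) (b n) m n \<zeta> + 3 * t"
      if "\<pi> \<in> lattice_paths (1, 1) (m, n)" for \<pi>
      using that by fastforce
    have "last_passage_time (\<lambda>p. X p x) m n \<le> centering (a m) (b n) m n \<zeta> + 3 * t"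
      using up by (auto simp: last_passage_time_le_iff[OF mn])
    moreover have "centering (a m) (b n) m n \<zeta> - 9 * t - 2 * e - 1 / \<kappa> \<le> last_passage_time (\<lambda>p. X p x) m n"
      using x unfolding last_passage_time_ge_iff[OF mn] by blast
    ultimately show "\<bar>last_passage_time (\<lambda>p. X p x) m n - shape_centering a b m n\<bar> \<le> 9 * t + 2 * e + 1 / \<kappa>"
      unfolding shape_centering_eq[where a = a and b = b, OF mn crit] abs_le_iff using t e k1 by linarith
  qed
qed

text \<open>
  The choice of scales.  The value of \<open>\<rho>\<close> makes the cost of imitating the boundary a small multiple
  of \<open>N\<close>; the value of \<open>h\<close> makes the second-order loss \<open>16 h\<^sup>2 N / (\<rho> \<kappa>\<^sup>2)\<close> half of the first-order
  gain \<open>h e\<^sup>2 / N\<close>; and \<open>t\<close> is a small part of that gain.  The resulting ratio \<open>t / \<tau>\<close> is a multiple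
  of \<open>N powr (5 * \<eta>)\<close>.
\<close>
lemma eventually_scales:
  fixes c \<eta> \<epsilon> :: real
  assumes c: "0 < c" and \<eta>: "0 < \<eta>" "\<eta> \<le> 1 / 20" and \<epsilon>: "0 < \<epsilon>"
  defines "\<kappa> \<equiv> \<lambda>N::real. c * N powr (- 1 / 10 + \<eta>)"
  shows "\<forall>\<^sub>F N in at_top. \<exists>\<rho> h t \<tau> e.
     0 < \<rho> \<and> \<rho> \<le> \<kappa> N / 4 \<and> 0 < h \<and> h \<le> \<rho> / 2 \<and> 0 < \<tau> \<and> 16 * N / (\<kappa> N)\<^sup>2 \<le> \<tau>\<^sup>2 \<and> 0 \<le> t \<and> 0 \<le> e \<and>
     6 * t + 1 / (2 * \<rho>) < \<rho> * e\<^sup>2 / N \<and> 6 * t + 16 * h\<^sup>2 * N / (\<rho> * (\<kappa> N)\<^sup>2) < h * e\<^sup>2 / N \<and>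
     2 / \<kappa> N + 4 * \<rho> * N / (\<kappa> N)\<^sup>2 \<le> e \<and> 9 * t + 2 * e + 1 / \<kappa> N \<le> \<epsilon> * N \<and>
     13 * N * tail \<tau> t \<le> 1 / N ^ 3"
proof -
  define r where "r = \<epsilon> / 48"
  define s where "s = \<epsilon>\<^sup>2 / 1152"
  define u where "u = \<epsilon>\<^sup>2 / 864"
  define \<gamma> where "\<gamma> = 1 / 10 - \<eta>"
  have pos: "0 < r" "0 < s" "0 < u" using \<epsilon> by (auto simp: r_def s_def u_def)
  have \<gamma>: "0 < \<gamma>" "\<gamma> < 1 / 10" using \<eta> by (auto simp: \<gamma>_def)
  have \<kappa>: "\<kappa> N = c * N powr (- \<gamma>)" for N by (simp add: \<kappa>_def \<gamma>_def)
  have pw: "(\<kappa> N) ^ k = c ^ k * N powr (- real k * \<gamma>)" if "0 < N" for k N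
    using that by (simp add: \<kappa> power_mult_distrib powr_power mult.commute)
  have "((\<lambda>N. N powr (- \<gamma>)) \<longlongrightarrow> 0) at_top"
    using \<gamma> by real_asymp
  then have "(\<kappa> \<longlongrightarrow> 0) at_top" unfolding \<kappa>[abs_def] by (auto intro: tendsto_eq_intros)
  then have small: "\<forall>\<^sub>F N in at_top. \<kappa> N < \<delta>" if "0 < \<delta>" for \<delta>
    using order_tendstoD(2) that by blast
  have "filterlim (\<lambda>N. c * N powr (1 - \<gamma>)) at_top at_top" using c \<gamma> by real_asymp
  then have A4: "\<forall>\<^sub>F N in at_top. 24 / \<epsilon> \<le> c * N powr (1 - \<gamma>)"
    by (simp add: filterlim_at_top)
  have "filterlim (\<lambda>N. c ^ 4 * N powr (1 - 4 * \<gamma>)) at_top at_top" using c \<gamma> by real_asymp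
  then have A3: "\<forall>\<^sub>F N in at_top. 36 / (\<epsilon>\<^sup>2 * r\<^sup>2) + 1 \<le> c ^ 4 * N powr (1 - 4 * \<gamma>)"
    by (simp add: filterlim_at_top)
  define D where "D = s * r * u * c ^ 5 / 8"
  have D: "0 < D" using pos c by (simp add: D_def)
  define \<delta> where "\<delta> = 5 * \<eta>"
  have \<delta>: "0 < \<delta>" using \<eta> by (simp add: \<delta>_def)
  have "((\<lambda>N. 52 * N ^ 4 * exp (- (D * N powr \<delta>))) \<longlongrightarrow> 0) at_top"
    using D \<delta> by real_asymp
  then have A7: "\<forall>\<^sub>F N in at_top. 52 * N ^ 4 * exp (- (D * N powr \<delta>)) < 1"
    by (rule order_tendstoD) simp
  have "0 < min 1 (min (1 / (4 * r)) (min (1 / (2 * s)) (\<epsilon> / (27 * (s * r * u)))))"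
    using pos \<epsilon> by simp
  from small[OF this] A3 A4 A7 eventually_gt_at_top[of 0] show ?thesis
  proof eventually_elim
    case (elim N)
    then have N: "0 < N" and k: "\<kappa> N \<le> 1" "\<kappa> N \<le> 1 / (4 * r)" "\<kappa> N \<le> 1 / (2 * s)" "\<kappa> N \<le> \<epsilon> / (27 * (s * r * u))"
      by auto
    define K where "K = \<kappa> N"
    have K: "0 < K" "K \<le> 1" using N c k by (auto simp: K_def \<kappa>)
    have KN: "24 / \<epsilon> \<le> K * N"
    proof -
      have "K * N = c * N powr (1 - \<gamma>)" using N by (simp add: K_def \<kappa> powr_diff powr_minus_divide)
      with elim show ?thesis by simp
    qed
    have K4N: "36 / (\<epsilon>\<^sup>2 * r\<^sup>2) < K ^ 4 * N"
    proof -
      have "K ^ 4 * N = c ^ 4 * N powr (1 - 4 * \<gamma>)"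
        using N pw[of N 4] by (simp add: K_def powr_diff powr_minus_divide)
      with elim show ?thesis by simp
    qed
    have K5: "K ^ 5 * sqrt N = c ^ 5 * N powr \<delta>"
    proof -
      have "K ^ 5 * sqrt N = c ^ 5 * (N powr (- 5 * \<gamma>) * N powr (1 / 2))"
        using N pw[of N 5] by (simp add: K_def powr_half_sqrt)
      also have "N powr (- 5 * \<gamma>) * N powr (1 / 2) = N powr \<delta>"
        by (simp add: powr_add[symmetric] \<delta>_def \<gamma>_def algebra_simps)
      finally show ?thesis .
    qed
    define \<rho> where "\<rho> = r * K\<^sup>2"
    define h where "h = s * \<rho> * K\<^sup>2"
    define t where "t = u * h * N"
    define \<tau> where "\<tau> = 4 * sqrt N / K"
    define e where "e = \<epsilon> * N / 6"
    have p: "0 < \<rho>" "0 < h" "0 < t" "0 < \<tau>" "0 < e"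
      using pos K N \<epsilon> by (auto simp: \<rho>_def h_def t_def \<tau>_def e_def)
    have sq: "K\<^sup>2 \<le> K" "K ^ 4 \<le> K" using K power_decreasing[of 1 _ K] by auto
    have e2: "e\<^sup>2 / N = \<epsilon>\<^sup>2 * N / 36" using N by (simp add: e_def power2_eq_square field_simps)
    have t6: "6 * t = h * \<epsilon>\<^sup>2 * N / 144" by (simp add: t_def u_def)
    have 1: "\<rho> \<le> K / 4"
    proof -
      have "r * K * K \<le> 1 / 4 * K" using k(2) pos K by (intro mult_right_mono) (auto simp: K_def field_simps)
      then show ?thesis by (simp add: \<rho>_def power2_eq_square mult.assoc)
    qed
    have 2: "h \<le> \<rho> / 2"
    proof -
      have "s * K\<^sup>2 \<le> s * K" using sq pos by simp
      also have "\<dots> \<le> 1 / 2" using k(3) pos by (simp add: K_def field_simps)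
      finally have "\<rho> * (s * K\<^sup>2) \<le> \<rho> * (1 / 2)" using p by (intro mult_left_mono) auto
      then show ?thesis by (simp add: h_def mult.commute mult.left_commute)
    qed
    have 3: "16 * N / K\<^sup>2 \<le> \<tau>\<^sup>2"
      using N by (simp add: \<tau>_def power_divide power_mult_distrib)
    have 4: "6 * t + 1 / (2 * \<rho>) < \<rho> * e\<^sup>2 / N"
    proof -
      have "36 < \<epsilon>\<^sup>2 * r\<^sup>2 * (K ^ 4 * N)"
        using K4N pos \<epsilon> by (simp add: field_simps)
      also have "\<dots> = \<rho> * \<rho> * \<epsilon>\<^sup>2 * N" by (simp add: \<rho>_def power2_eq_square power4_eq_xxxx)
      finally have "1 / (2 * \<rho>) < \<rho> * \<epsilon>\<^sup>2 * N / 72" using p by (simp add: field_simps)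
      moreover have "h * (\<epsilon>\<^sup>2 * N) \<le> \<rho> * (\<epsilon>\<^sup>2 * N)" using 2 p N by (intro mult_right_mono) auto
      moreover have "0 < \<rho> * \<epsilon>\<^sup>2 * N" using p N \<epsilon> by simp
      moreover have "\<rho> * e\<^sup>2 / N = \<rho> * \<epsilon>\<^sup>2 * N / 36" using e2 by (simp add: mult.assoc flip: times_divide_eq_right)
      ultimately show ?thesis unfolding t6 by (simp add: mult.assoc)
    qed
    have 5: "6 * t + 16 * h\<^sup>2 * N / (\<rho> * K\<^sup>2) < h * e\<^sup>2 / N"
    proof -
      have "16 * h\<^sup>2 * N / (\<rho> * K\<^sup>2) = 16 * s * h * N"
      proof -
        have "16 * h\<^sup>2 * N / (\<rho> * K\<^sup>2) = 16 * h * N * (h / (\<rho> * K\<^sup>2))" by (simp add: power2_eq_square)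
        also have "h / (\<rho> * K\<^sup>2) = s" using p K by (simp add: h_def)
        finally show ?thesis by simp
      qed
      then have A: "16 * h\<^sup>2 * N / (\<rho> * K\<^sup>2) = h * \<epsilon>\<^sup>2 * N / 72" by (simp only: s_def) simp
      have B: "h * e\<^sup>2 / N = h * \<epsilon>\<^sup>2 * N / 36" using e2 by (simp add: mult.assoc flip: times_divide_eq_right)
      have "0 < h * \<epsilon>\<^sup>2 * N" using p N \<epsilon> by simp
      then show ?thesis unfolding t6 A B by linarith
    qed
    have inv: "1 / K \<le> \<epsilon> * N / 24"
      using KN K \<epsilon> by (simp add: field_simps)
    have 6: "2 / K + 4 * \<rho> * N / K\<^sup>2 \<le> e"
    proof -
      have A: "4 * \<rho> * N / K\<^sup>2 = \<epsilon> * N / 12" using K by (simp add: \<rho>_def r_def)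
      have "2 / K = 2 * (1 / K)" by simp
      with inv show ?thesis unfolding A e_def by linarith
    qed
    have 7: "9 * t + 2 * e + 1 / K \<le> \<epsilon> * N"
    proof -
      have "s * r * u * K ^ 4 \<le> s * r * u * K" using sq pos by simp
      also have "\<dots> \<le> \<epsilon> / 27" using k(4) pos by (simp add: K_def field_simps)
      finally have "s * r * u * K ^ 4 * N \<le> \<epsilon> / 27 * N" using N by (intro mult_right_mono) auto
      moreover have "t = s * r * u * K ^ 4 * N"
        by (simp add: t_def h_def \<rho>_def power2_eq_square power4_eq_xxxx)
      ultimately have "t \<le> \<epsilon> * N / 27" by simp
      moreover have "0 < \<epsilon> * N" using \<epsilon> N by simp
      ultimately show ?thesis using inv unfolding e_def by linarith
    qed
    have 8: "13 * N * tail \<tau> t \<le> 1 / N ^ 3"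
    proof -
      have "t / (2 * \<tau>) = s * r * u * (K ^ 5 * (N / sqrt N)) / 8"
        by (simp add: t_def h_def \<rho>_def \<tau>_def power2_eq_square eval_nat_numeral mult_ac)
      also have "N / sqrt N = sqrt N" using N by (simp add: real_div_sqrt)
      also have "s * r * u * (K ^ 5 * sqrt N) / 8 = D * N powr \<delta>" unfolding K5 by (simp add: D_def)
      finally have "tail \<tau> t = 4 * exp (- (D * N powr \<delta>))" by (simp add: tail_def)
      moreover have "52 * N ^ 4 * exp (- (D * N powr \<delta>)) < 1" using elim by simp
      ultimately show ?thesis using N by (simp add: field_simps eval_nat_numeral)
    qed
    show ?case
      unfolding K_def[symmetric]
      using p 1 2 3 4 5 6 7 8 by (intro exI[of _ \<rho>] exI[of _ h] exI[of _ t] exI[of _ \<tau>] exI[of _ e]) auto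
  qed
qed

lemma min_param_le:
  assumes "i \<in> {1..m}"
  shows "min_param a m \<le> a m i"
  unfolding min_param_def using assms by (intro Min_le) auto

theorem corollary3p3:
  fixes a b :: "nat \<Rightarrow> nat \<Rightarrow> real"
    and \<omega> :: "nat \<Rightarrow> nat \<Rightarrow> nat \<times> nat \<Rightarrow> (nat \<times> nat \<Rightarrow> real) \<Rightarrow> real"
    and c \<eta> \<epsilon> :: real
  assumes pos: "\<And>m n i j. m \<ge> 1 \<Longrightarrow> n \<ge> 1 \<Longrightarrow> i \<in> {1..m} \<Longrightarrow> j \<in> {1..n} \<Longrightarrow> a m i + b n j > 0"
    and indep: "\<And>m n. m \<ge> 1 \<Longrightarrow> n \<ge> 1 \<Longrightarrow>
          prob_space.indep_vars lpp_space (\<lambda>_. borel) (\<omega> m n) ({1..m} \<times> {1..n})"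
    and distr: "\<And>m n i j. m \<ge> 1 \<Longrightarrow> n \<ge> 1 \<Longrightarrow> i \<in> {1..m} \<Longrightarrow> j \<in> {1..n} \<Longrightarrow>
          distributed lpp_space lborel (\<omega> m n (i, j)) (exponential_density (a m i + b n j))"
    and c: "c > 0" and eta: "\<eta> > 0"
    and length: "\<And>m n. m \<ge> 1 \<Longrightarrow> n \<ge> 1 \<Longrightarrow>
          measure lborel (param_interval a b m n) \<ge> c * real (m + n) powr (- 1 / 10 + \<eta>)"
    and eps: "\<epsilon> > 0"
  shows "AE x in lpp_space. \<exists>L::nat. L \<ge> 1 \<and>
           (\<forall>m n. m \<ge> 1 \<longrightarrow> n \<ge> 1 \<longrightarrow> m + n \<ge> L \<longrightarrow>
              \<bar>last_passage_time (\<lambda>p. \<omega> m n p x) m n - shape_centering a b m n\<bar> \<le> \<epsilon> * real (m + n))"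
proof -
  have P: "prob_space lpp_space"
    unfolding lpp_space_def by (intro prob_space_PiM prob_space_exponential_density) simp
  interpret prob_space lpp_space by (rule P)
  \<comment> \<open>A smaller exponent only weakens the bound on the interval, and makes the bound tend to 0.\<close>
  define \<eta>' where "\<eta>' = min \<eta> (1 / 20)"
  have \<eta>': "0 < \<eta>'" "\<eta>' \<le> 1 / 20" "\<eta>' \<le> \<eta>" using eta by (auto simp: \<eta>'_def)
  define \<kappa> where "\<kappa> = (\<lambda>N::real. c * N powr (- 1 / 10 + \<eta>'))"
  have X: "exp_vars lpp_space ({1..m} \<times> {1..n}) (\<omega> m n) (\<lambda>(i, j). a m i + b n j)" if "m \<ge> 1" "n \<ge> 1" for m n
    using that indep distr pos P by (auto simp: exp_vars_def)
  have gap: "\<kappa> (real m + real n) \<le> a m i + b n j"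
    if mn: "m \<ge> 1" "n \<ge> 1" and ij: "i \<in> {1..m}" "j \<in> {1..n}" for m n i j
  proof -
    have l: "0 < c * real (m + n) powr (- 1 / 10 + \<eta>)" using c mn by simp
    have "\<kappa> (real m + real n) \<le> c * real (m + n) powr (- 1 / 10 + \<eta>)"
      unfolding \<kappa>_def of_nat_add using c mn \<eta>' by (intro mult_left_mono powr_mono) auto
    also have "\<dots> \<le> measure lborel (param_interval a b m n)" using mn by (rule length)
    also have "\<dots> = min_param a m + min_param b n"
    proof (cases "- min_param a m \<le> min_param b n")
      case True
      then show ?thesis by (simp add: param_interval_def)
    next
      case False
      then have "param_interval a b m n = {}" by (auto simp: param_interval_def)
      with l length[OF mn] show ?thesis by simp
    qed
    also have "\<dots> \<le> a m i + b n j" using ij by (intro add_mono min_param_le)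
    finally show ?thesis .
  qed
  have "\<forall>\<^sub>F N in at_top. \<forall>m n. m \<ge> 1 \<longrightarrow> n \<ge> 1 \<longrightarrow> N = real m + real n \<longrightarrow>
     whp lpp_space (1 / N ^ 3) (\<lambda>x. \<bar>last_passage_time (\<lambda>p. \<omega> m n p x) m n - shape_centering a b m n\<bar> \<le> \<epsilon> * N)"
    using eventually_scales[OF c \<eta>'(1,2) eps]
  proof eventually_elim
    case (elim N)
    then obtain \<rho> h t \<tau> e where par: "0 < \<rho>" "\<rho> \<le> \<kappa> N / 4" "0 < h" "h \<le> \<rho> / 2" "0 < \<tau>" "16 * N / (\<kappa> N)\<^sup>2 \<le> \<tau>\<^sup>2"
       "0 \<le> t" "0 \<le> e" "6 * t + 1 / (2 * \<rho>) < \<rho> * e\<^sup>2 / N" "6 * t + 16 * h\<^sup>2 * N / (\<rho> * (\<kappa> N)\<^sup>2) < h * e\<^sup>2 / N"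
       "2 / \<kappa> N + 4 * \<rho> * N / (\<kappa> N)\<^sup>2 \<le> e"
       and fin: "9 * t + 2 * e + 1 / \<kappa> N \<le> \<epsilon> * N" "13 * N * tail \<tau> t \<le> 1 / N ^ 3"
      unfolding \<kappa>_def by blast
    show ?case
    proof (intro allI impI)
      fix m n :: nat assume mn: "1 \<le> m" "1 \<le> n" and N: "N = real m + real n"
      have g: "\<kappa> N \<le> a m i + b n j" if "i \<in> {1..m}" "j \<in> {1..n}" for i j
        unfolding N using gap[OF mn that] .
      from last_passage_estimate[where a = a and b = b and m = m and n = n, OF X[OF mn] mn g par(1-4) N par(5-11)]
      show "whp lpp_space (1 / N ^ 3) (\<lambda>x. \<bar>last_passage_time (\<lambda>p. \<omega> m n p x) m n - shape_centering a b m n\<bar> \<le> \<epsilon> * N)"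
        by (rule whp_mono) (use fin in auto)
    qed
  qed
  then obtain N0 :: real where N0: "\<And>N m n. N0 \<le> N \<Longrightarrow> m \<ge> 1 \<Longrightarrow> n \<ge> 1 \<Longrightarrow> N = real m + real n \<Longrightarrow>
     whp lpp_space (1 / N ^ 3) (\<lambda>x. \<bar>last_passage_time (\<lambda>p. \<omega> m n p x) m n - shape_centering a b m n\<bar> \<le> \<epsilon> * N)"
    unfolding eventually_at_top_linorder by blast
  \<comment> \<open>There are fewer than \<open>k\<close> pairs with \<open>m + n = k\<close>, so the failure probabilities are summable.\<close>
  define good where "good = (\<lambda>k x. \<forall>m\<in>{1..k}. \<forall>n. n \<ge> 1 \<longrightarrow> m + n = k \<longrightarrow>
     \<bar>last_passage_time (\<lambda>p. \<omega> m n p x) m n - shape_centering a b m n\<bar> \<le> \<epsilon> * real k)"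
  have good: "whp lpp_space (1 / real k ^ 2) (good k)" if k: "N0 \<le> real k" "k \<ge> 1" for k
  proof -
    have "whp lpp_space (card {1..k} * (1 / real k ^ 3)) (\<lambda>x. \<forall>m\<in>{1..k}. \<forall>n. n \<ge> 1 \<longrightarrow> m + n = k \<longrightarrow>
     \<bar>last_passage_time (\<lambda>p. \<omega> m n p x) m n - shape_centering a b m n\<bar> \<le> \<epsilon> * real k)"
    proof (intro whp_ball P finite_atLeastAtMost)
      fix m assume m: "m \<in> {1..k}"
      show "whp lpp_space (1 / real k ^ 3) (\<lambda>x. \<forall>n. n \<ge> 1 \<longrightarrow> m + n = k \<longrightarrow>
        \<bar>last_passage_time (\<lambda>p. \<omega> m n p x) m n - shape_centering a b m n\<bar> \<le> \<epsilon> * real k)"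
      proof (cases "m = k")
        case True
        then show ?thesis by (intro whp_mono[OF whp_AE[OF AE_I2[OF TrueI]]]) auto
      next
        case False
        then have "real k = real m + real (k - m)" "1 \<le> m" "1 \<le> k - m" using m by auto
        from N0[OF k(1) this(2,3,1)] show ?thesis
          by (rule whp_mono) auto
      qed
    qed
    moreover have "real (card {1..k}) * (1 / real k ^ 3) = 1 / real k ^ 2"
      using k by (simp add: power2_eq_square power3_eq_cube)
    ultimately show ?thesis unfolding good_def by (simp only:)
  qed
  have "\<exists>E. E \<in> sets lpp_space \<and> measure lpp_space E \<le> 1 / real k ^ 2 \<and> (\<forall>x\<in>space lpp_space - E. good k x)"
    if "N0 \<le> real k" "k \<ge> 1" for k
    using good[OF that] unfolding whp_def by blast
  then obtain E where E: "\<And>k. N0 \<le> real k \<Longrightarrow> k \<ge> 1 \<Longrightarrow>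
      E k \<in> sets lpp_space \<and> measure lpp_space (E k) \<le> 1 / real k ^ 2 \<and> (\<forall>x\<in>space lpp_space - E k. good k x)"
    by metis
  define k0 where "k0 = nat \<lceil>max N0 1\<rceil>"
  have k0: "N0 \<le> real k" "k \<ge> 1" if "k \<ge> k0" for k
    using that by (auto simp: k0_def)
  define B where "B = (\<lambda>k. if k \<ge> k0 then E k else {})"
  have "AE x in lpp_space. eventually (\<lambda>k. x \<in> space lpp_space - B k) sequentially"
  proof (rule borel_cantelli_AE1)
    show "B k \<in> sets lpp_space" for k using E k0 by (auto simp: B_def)
    show "emeasure lpp_space (B k) < \<infinity>" for k by (simp add: less_top[symmetric])
    have "summable (\<lambda>k. 1 / real k ^ 2)"
      using inverse_power_summable[of 2, where 'a = real] by (simp add: inverse_eq_divide)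
    then show "summable (\<lambda>k. measure lpp_space (B k))"
    proof (rule summable_comparison_test'[where N = 0])
      fix k show "norm (measure lpp_space (B k)) \<le> 1 / real k ^ 2"
        using E[OF k0] by (auto simp: B_def)
    qed
  qed
  then show ?thesis
  proof (rule AE_mp, intro AE_I2 impI)
    fix x assume x: "x \<in> space lpp_space" "\<forall>\<^sub>F k in sequentially. x \<in> space lpp_space - B k"
    then obtain k1 where k1: "\<And>k. k \<ge> k1 \<Longrightarrow> x \<in> space lpp_space - B k"
      unfolding eventually_sequentially by auto
    show "\<exists>L::nat. L \<ge> 1 \<and> (\<forall>m n. m \<ge> 1 \<longrightarrow> n \<ge> 1 \<longrightarrow> m + n \<ge> L \<longrightarrow>
              \<bar>last_passage_time (\<lambda>p. \<omega> m n p x) m n - shape_centering a b m n\<bar> \<le> \<epsilon> * real (m + n))"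
    proof (intro exI[of _ "max 1 (max k0 k1)"] conjI allI impI)
      fix m n :: nat assume mn: "m \<ge> 1" "n \<ge> 1" "max 1 (max k0 k1) \<le> m + n"
      then have "x \<in> space lpp_space - E (m + n)" using k1[of "m + n"] by (simp add: B_def)
      then have "good (m + n) x" using E[OF k0, of "m + n"] mn by simp
      then show "\<bar>last_passage_time (\<lambda>p. \<omega> m n p x) m n - shape_centering a b m n\<bar> \<le> \<epsilon> * real (m + n)"
        using mn by (simp add: good_def)
    qed simp
  qed
qed

end
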